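(* If $y\in\mathcal{I}_{\mathbb{Z}}$ and $(p,q)\in\mathrm{Cyc}_{\mathbb{Z}}(y)$, then $$\sum_{z\in\hat\Phi^-(y,p)}|\hat{\mathcal{R}}(z)|=\sum_{z\in\hat\Phi^+(y,q)}|\hat{\mathcal{R}}(z)|.$$
   Context: $S_{\mathbb{Z}}$ is the group of permutations of $\mathbb{Z}$ fixing all but finitely many integers; $s_i=(i,i+1)$; $\ell(w)$ is the number of pairs $i<j$ with $w(i)>w(j)$. The Bruhat order $<$ on $S_{\mathbb{Z}}$ is the weakest strict partial order with $w<wt$ whenever $t$ is a transposition with $\ell(w)<\ell(wt)$. $\mathcal{I}_{\mathbb{Z}}=\{y\in S_{\mathbb{Z}}:y=y^{-1}\}$; for $y,z\in\mathcal{I}_{\mathbb{Z}}$ write $y\lessdot_{\mathcal{I}}z$ if $\{y\}=\{\sigma\in\mathcal{I}_{\mathbb{Z}}:y\le\sigma<z\}$. $\mathrm{Cyc}_{\mathbb{Z}}(y)=\{(i,j)\in\mathbb{Z}\times\mathbb{Z}:i\le j=y(i)\}$. The Demazure product is the unique associative map $\circ:S_{\mathbb{Z}}\times S_{\mathbb{Z}}\to S_{\mathbb{Z}}$ with $u\circ v=uv$ if $\ell(uv)=\ell(u)+\ell(v)$ and $s_i\circ s_i=s_i$ for all $i$. For $z\in\mathcal{I}_{\mathbb{Z}}$, $\hat{\mathcal{R}}(z)$ (the set of involution words of $z$) is the set of sequences $(s_{i_1},\dots,s_{i_k})$ of simple transpositions of minimal possible length $k$ such that $z=s_{i_k}\circ\cdots\circ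 s_{i_2}\circ s_{i_1}\circ s_{i_2}\circ\cdots\circ s_{i_k}$ (when $z=1$ this is the empty word); equivalently the set of all reduced words of all minimal-length $w\in S_{\mathbb{Z}}$ with $z=w^{-1}\circ w$. The maps $\tau_{ij}$: for $y\in\mathcal{I}_{\mathbb{Z}}$ and $i<j$ let $A=\{i,j,y(i),y(j)\}$. Then $\tau_{ij}(y)$ is the involution $z$ that agrees with $y$ on $\mathbb{Z}\setminus A$ and whose restriction to the $y$-invariant set $A$ is as follows (restrictions are written by their 2-cycles; unlisted elements of $A$ are fixed). (1) $A=\{a<b\}$, $y|_A=1$, $(i,j)=(a,b)$: $z|_A=(a,b)$. (2) $A=\{a<b<c\}$, $y|_A=(a,b)$, $(i,j)\in\{(b,c),(a,c)\}$: $z|_A=(a,c)$. (3) $A=\{a<b<c\}$, $y|_A=(b,c)$, $(i,j)\in\{(a,b),(a,c)\}$: $z|_A=(a,c)$. (4) $A=\{a<b<c<d\}$, $y|_A=(a,b)(c,d)$, $(i,j)=(b,c)$: $z|_A=(a,c)(b,d)$. (5) $A=\{a<b<c<d\}$, $y|_A=(a,b)(c,d)$, $(i,j)\in\{(a,c),(b,d),(a,d)\}$: $z|_A=(a,d)$. (6) $A=\{a<b<c<d\}$, $y|_A=(a,c)(b,d)$, $(i,j)\in\{(a,b),(c,d),(a,d)\}$: $z|_A=(a,d)(b,c)$. In all other cases $\tau_{ij}(y)=y$. For $y\in\mathcal{I}_{\mathbb{Z}}$ and $r\in\mathbb{Z}$: $\hat\Phi^+(y,r)=\{z\in\mathcal{I}_{\mathbb{Z}}:y\lessdot_{\mathcal{I}}z$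 and $z=\tau_{rj}(y)$ for an integer $j>r\}$, $\hat\Phi^-(y,r)=\{z\in\mathcal{I}_{\mathbb{Z}}:y\lessdot_{\mathcal{I}}z$ and $z=\tau_{ir}(y)$ for an integer $i<r\}$. *)

theory Defs
  imports "HOL-Combinatorics.Perm"
begin

text \<open>
  The type \<^typ>\<open>int perm\<close> of finitely supported bijections of the integers is the group
  \<open>S\<^sub>\<int>\<close>; its product is composition, \<open>(u * v)(x) = u(v(x))\<close>.
\<close>

unbundle permutation_syntax

definition simple_transposition :: "int \<Rightarrow> int perm" where
  "simple_transposition i = \<langle>i \<leftrightarrow> i + 1\<rangle>"

definition perm_length :: "int perm \<Rightarrow> nat" where
  "perm_length w = card {(i, j). i < j \<and> w \<langle>$\<rangle> i > w \<langle>$\<rangle> j}"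

lemma finite_inversions: "finite {(i, j). i < j \<and> w \<langle>$\<rangle> i > w \<langle>$\<rangle> j}" for w :: "int perm"
proof -
  define m where "m = Min (insert 0 (affected w))"
  define M where "M = Max (insert 0 (affected w))"
  have bnd: "m \<le> x" "x \<le> M" if "x \<in> affected w" for x
    using that by (simp_all add: m_def M_def)
  have "m \<le> i \<and> j \<le> M" if "i < j" "w \<langle>$\<rangle> i > w \<langle>$\<rangle> j" for i j
  proof (cases "i \<in> affected w"; cases "j \<in> affected w")
    assume "i \<in> affected w" "j \<in> affected w"
    then show ?thesis using bnd by simp
  next
    assume i: "i \<in> affected w" and "j \<notin> affected w"
    then show ?thesis using bnd(1,2)[OF i] bnd[of "w \<langle>$\<rangle> i", unfolded apply_affected, OF i] that
      by (simp add: in_affected)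
  next
    assume "i \<notin> affected w" and j: "j \<in> affected w"
    then show ?thesis using bnd(1,2)[OF j] bnd[of "w \<langle>$\<rangle> j", unfolded apply_affected, OF j] that
      by (simp add: in_affected)
  next
    assume "i \<notin> affected w" "j \<notin> affected w"
    then show ?thesis using that by (simp add: in_affected)
  qed
  then have "{(i, j). i < j \<and> w \<langle>$\<rangle> i > w \<langle>$\<rangle> j} \<subseteq> {m..M} \<times> {m..M}"
    by fastforce
  then show ?thesis by (rule finite_subset) simp
qed


subsection \<open>Bruhat order\<close>

definition bruhat_step :: "int perm \<Rightarrow> int perm \<Rightarrow> bool" where
  "bruhat_step u v \<longleftrightarrow>
     (\<exists>a b. a \<noteq> b \<and> v = u * \<langle>a \<leftrightarrow> b\<rangle> \<and> perm_length u < perm_length v)"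

definition bruhat_less :: "int perm \<Rightarrow> int perm \<Rightarrow> bool" where
  "bruhat_less = bruhat_step\<^sup>+\<^sup>+"

definition bruhat_le :: "int perm \<Rightarrow> int perm \<Rightarrow> bool" where
  "bruhat_le u v \<longleftrightarrow> u = v \<or> bruhat_less u v"

text \<open>
  The transitive closure really is the weakest strict partial order containing the steps.
\<close>

lemma bruhat_less_length: "bruhat_less u v \<Longrightarrow> perm_length u < perm_length v"
  unfolding bruhat_less_def
  by (induction rule: tranclp_induct) (auto simp: bruhat_step_def)

lemma bruhat_less_strict_order: "irreflp bruhat_less" "transp bruhat_less"
proof -
  show "irreflp bruhat_less"
    using bruhat_less_length by (fastforce intro: irreflpI)
  show "transp bruhat_less"
    unfolding bruhat_less_def by (auto intro: transpI)
qed

lemma bruhat_less_step: "bruhat_step u v \<Longrightarrow> bruhat_less u v"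
  by (simp add: bruhat_less_def)

lemma bruhat_less_weakest:
  assumes "transp R" and "bruhat_step \<le> R"
  shows "bruhat_less \<le> R"
proof (intro predicate2I)
  fix u v assume "bruhat_less u v"
  then have "bruhat_step\<^sup>+\<^sup>+ u v" by (simp add: bruhat_less_def)
  then show "R u v"
    by (induction rule: tranclp_induct) (use assms in \<open>blast dest: transpD\<close>)+
qed


subsection \<open>Involutions\<close>

definition involutions :: "int perm set" where
  "involutions = {y. y = inverse y}"

definition inv_covers :: "int perm \<Rightarrow> int perm \<Rightarrow> bool" where
  "inv_covers y z \<longleftrightarrow> y \<in> involutions \<and> z \<in> involutions \<and>
     {y} = {\<sigma> \<in> involutions. bruhat_le y \<sigma> \<and> bruhat_less \<sigma> z}"

definition Cyc :: "int perm \<Rightarrow> (int \<times> int) set" where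
  "Cyc y = {(i, j). i \<le> j \<and> j = y \<langle>$\<rangle> i}"


subsection \<open>Demazure product and involution words\<close>

definition demazure :: "int perm \<Rightarrow> int perm \<Rightarrow> int perm" where
  "demazure = (THE m.
     (\<forall>u v w. m (m u v) w = m u (m v w)) \<and>
     (\<forall>u v. perm_length (u * v) = perm_length u + perm_length v \<longrightarrow> m u v = u * v) \<and>
     (\<forall>i. m (simple_transposition i) (simple_transposition i) = simple_transposition i))"

text \<open>
  The first letter of the word occurs only once, in the middle of the palindrome:
  \<open>[t\<^sub>1, \<dots>, t\<^sub>k]\<close> is sent to \<open>t\<^sub>k \<circ> \<dots> \<circ> t\<^sub>2 \<circ> t\<^sub>1 \<circ> t\<^sub>2 \<circ> \<dots> \<circ> t\<^sub>k\<close>.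
\<close>

fun palindrome_product :: "int perm list \<Rightarrow> int perm" where
  "palindrome_product [] = 1"
| "palindrome_product (t # ts) = foldl (\<lambda>z s. demazure (demazure s z) s) t ts"

definition words_for :: "int perm \<Rightarrow> int perm list set" where
  "words_for z = {ts. set ts \<subseteq> range simple_transposition \<and> palindrome_product ts = z}"

definition involution_words :: "int perm \<Rightarrow> int perm list set" where
  "involution_words z =
     {ts \<in> words_for z. \<forall>us \<in> words_for z. length ts \<le> length us}"


subsection \<open>The operators \<open>\<tau>\<^sub>i\<^sub>j\<close>\<close>

definition agree_on :: "int set \<Rightarrow> int perm \<Rightarrow> int perm \<Rightarrow> bool" where
  "agree_on A y \<sigma> \<longleftrightarrow> (\<forall>x\<in>A. y \<langle>$\<rangle> x = \<sigma> \<langle>$\<rangle> x)"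

definition replace_on :: "int set \<Rightarrow> int perm \<Rightarrow> int perm \<Rightarrow> int perm" where
  "replace_on A y \<sigma> = Perm (override_on (apply y) (apply \<sigma>) A)"

text \<open>
  The argument of \<^const>\<open>Perm\<close> is a finitely supported bijection, and the result an
  involution, in every case in which \<^const>\<open>replace_on\<close> is used below.
\<close>

lemma apply_replace_on:
  assumes "y \<in> involutions" "\<sigma> \<in> involutions" "finite A"
    and "\<And>x. x \<in> A \<Longrightarrow> y \<langle>$\<rangle> x \<in> A" "\<And>x. x \<in> A \<Longrightarrow> \<sigma> \<langle>$\<rangle> x \<in> A"
  shows "apply (replace_on A y \<sigma>) = override_on (apply y) (apply \<sigma>) A"
    and "replace_on A y \<sigma> \<in> involutions"
proof -
  let ?f = "override_on (apply y) (apply \<sigma>) A"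
  have invol: "w \<langle>$\<rangle> (w \<langle>$\<rangle> x) = x" if "w \<in> involutions" for w x
    by (metis (mono_tags, lifting) apply_sequence apply_one id_apply involutions_def mem_Collect_eq
        that perm.left_inverse)
  have yA: "y \<langle>$\<rangle> x \<notin> A" if "x \<notin> A" for x
    using assms(4)[of "y \<langle>$\<rangle> x"] invol[OF assms(1), of x] that by auto
  have ff: "?f (?f x) = x" for x
    using assms(5) yA by (cases "x \<in> A") (auto simp: override_on_def invol assms(1,2))
  then have "bij ?f"
    by (metis involuntory_imp_bij)
  moreover have "{a. ?f a \<noteq> a} \<subseteq> A \<union> affected y"
    by (auto simp: override_on_def in_affected split: if_splits)
  then have "finite {a. ?f a \<noteq> a}"
    by (rule finite_subset) (simp add: assms(3))
  ultimately show *: "apply (replace_on A y \<sigma>) = ?f"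
    by (simp add: replace_on_def Perm_inverse)
  have "replace_on A y \<sigma> * replace_on A y \<sigma> = 1"
    using ff by (intro perm_eqI) (simp add: apply_times *)
  then show "replace_on A y \<sigma> \<in> involutions"
    by (metis (mono_tags, lifting) involutions_def mem_Collect_eq perm.inverse_unique)
qed

definition tau :: "int \<Rightarrow> int \<Rightarrow> int perm \<Rightarrow> int perm" where
  "tau i j y =
    (let A = {i, j, y \<langle>$\<rangle> i, y \<langle>$\<rangle> j} in
     case sorted_list_of_set A of
       [a, b] \<Rightarrow>
         if agree_on A y 1 \<and> (i, j) = (a, b)
         then replace_on A y \<langle>a \<leftrightarrow> b\<rangle>
         else y
     | [a, b, c] \<Rightarrow>
         if agree_on A y \<langle>a \<leftrightarrow> b\<rangle> \<and> (i, j) \<in> {(b, c), (a, c)}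
         then replace_on A y \<langle>a \<leftrightarrow> c\<rangle>
         else if agree_on A y \<langle>b \<leftrightarrow> c\<rangle> \<and> (i, j) \<in> {(a, b), (a, c)}
         then replace_on A y \<langle>a \<leftrightarrow> c\<rangle>
         else y
     | [a, b, c, d] \<Rightarrow>
         if agree_on A y (\<langle>a \<leftrightarrow> b\<rangle> * \<langle>c \<leftrightarrow> d\<rangle>) \<and> (i, j) = (b, c)
         then replace_on A y (\<langle>a \<leftrightarrow> c\<rangle> * \<langle>b \<leftrightarrow> d\<rangle>)
         else if agree_on A y (\<langle>a \<leftrightarrow> b\<rangle> * \<langle>c \<leftrightarrow> d\<rangle>) \<and> (i, j) \<in> {(a, c), (b, d), (a, d)}
         then replace_on A y \<langle>a \<leftrightarrow> d\<rangle>
         else if agree_on A y (\<langle>a \<leftrightarrow> c\<rangle> * \<langle>b \<leftrightarrow> d\<rangle>) \<and> (i, j) \<in> {(a, b), (c, d), (a, d)}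
         then replace_on A y (\<langle>a \<leftrightarrow> d\<rangle> * \<langle>b \<leftrightarrow> c\<rangle>)
         else y
     | _ \<Rightarrow> y)"

definition Phi_plus :: "int perm \<Rightarrow> int \<Rightarrow> int perm set" where
  "Phi_plus y r = {z \<in> involutions. inv_covers y z \<and> (\<exists>j > r. z = tau r j y)}"

definition Phi_minus :: "int perm \<Rightarrow> int \<Rightarrow> int perm set" where
  "Phi_minus y r = {z \<in> involutions. inv_covers y z \<and> (\<exists>i < r. z = tau i r y)}"

end

theory Submission
  imports Defs
begin

text \<open>
  Write \<open>s\<close> for a simple transposition and \<open>N(z)\<close> for the number of involution words of \<open>z\<close>. The
  operation \<open>z \<mapsto> s \<circ> z \<circ> s\<close> moves \<open>z\<close> up at an ascent \<open>s\<close> and does nothing at a descent; conversely,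
  for each descent \<open>s\<close> of \<open>z\<close> there is a unique \<open>z' \<noteq> z\<close> with \<open>z = s \<circ> z' \<circ> s\<close>. Removing the last
  letter of a word therefore gives \<open>N(z) = \<Sum>\<^sub>s N(z')\<close> for \<open>z \<noteq> 1\<close>, where \<open>s\<close> runs over the descents
  of \<open>z\<close> (\<open>card_involution_words\<close>).

  The involutions \<open>z\<close> that cover \<open>y\<close> all have the same form: the points where \<open>z\<close> is larger than
  \<open>y\<close> form one cycle of \<open>y\<close>, and so do those where it is smaller (\<open>inv_covers_moves\<close>). This leaves six
  possible shapes (\<open>moves_shape\<close>), which are exactly the values of \<open>\<tau>\<^sub>i\<^sub>j\<close>: here \<open>i\<close> belongs to the
  first cycle and \<open>j\<close> to the second. So \<open>\<Phi>\<^sup>+(y, q)\<close> consists of the covers with \<open>z(q) > y(q)\<close> and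
  \<open>\<Phi>\<^sup>-(y, p)\<close> of those with \<open>z(p) < y(p)\<close> (\<open>Phi_plus_eq\<close>, \<open>Phi_minus_eq\<close>). Since the sign of
  \<open>z - y\<close> is constant on the cycles of \<open>y\<close>, the claim becomes that, for every integer \<open>x\<close>, the sum of
  \<open>sgn (z(x) - y(x)) N(z)\<close> over the covers \<open>z\<close> of \<open>y\<close> vanishes (\<open>sum_moving_covers\<close>).

  This is proved by induction on the length of \<open>y\<close>. Expand each \<open>N(z)\<close> over the descents \<open>s\<close> of \<open>z\<close>.
  If \<open>s\<close> is not a descent of \<open>y\<close>, then \<open>z = s \<circ> y \<circ> s\<close>, and the term is \<open>N(y)\<close> with a sign. If it is
  one, then \<open>z'\<close> covers \<open>y'\<close>, and by the lifting property all covers of \<open>y'\<close> other than \<open>y\<close> itself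
  arise in this way. Lowering transports the signs (\<open>shift_sgn_raise\<close>), so by induction the terms
  for \<open>s\<close> sum up to the negative of the missing term for \<open>y\<close> as a cover of \<open>y'\<close>. In both cases
  \<open>s\<^sub>k\<close> contributes \<open>N(y)\<close> times the number \<open>[k \<in> C] - [k + 1 \<in> C]\<close>, where \<open>C\<close> is the cycle of \<open>x\<close>,
  and these numbers sum to zero over all \<open>k\<close> (\<open>sum_weight\<close>).
\<close>

section \<open>Permutations of the integers and their lengths\<close>

lemma apply_mult: "(f * g) \<langle>$\<rangle> x = f \<langle>$\<rangle> (g \<langle>$\<rangle> x)"
  by (simp add: apply_times)

lemma apply_swap_if: "\<langle>a \<leftrightarrow> b\<rangle> \<langle>$\<rangle> x = (if x = a then b else if x = b then a else x)"
  by auto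

lemma apply_simple_transposition:
  "simple_transposition k \<langle>$\<rangle> x = (if x = k then k + 1 else if x = k + 1 then k else x)"
  by (simp add: simple_transposition_def apply_swap_if)

lemma simple_transposition_self [simp]:
  "simple_transposition k * simple_transposition k = 1"
  by (simp add: simple_transposition_def)

lemma inverse_simple_transposition [simp]:
  "inverse (simple_transposition k) = simple_transposition k"
  by (simp add: simple_transposition_def)

lemma mult_simple_cancel [simp]: "w * simple_transposition k * simple_transposition k = w"
  by (simp add: mult.assoc)

lemma simple_mult_cancel [simp]: "simple_transposition k * (simple_transposition k * w) = w"
  by (simp flip: mult.assoc)

lemma inverse_mult: "inverse (u * v) = inverse v * inverse (u :: 'a perm)"
  by (rule perm.inverse_distrib_swap)

lemma inverse_inverse_perm [simp]: "inverse (inverse u) = (u :: 'a perm)"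
  by (rule perm.inverse_inverse)

lemma apply_inverse_apply [simp]:
  "inverse w \<langle>$\<rangle> (w \<langle>$\<rangle> x) = x" "w \<langle>$\<rangle> (inverse w \<langle>$\<rangle> x) = x"
  by (simp_all add: apply_sequence)

lemma inverse_apply_eq_iff: "inverse w \<langle>$\<rangle> x = z \<longleftrightarrow> x = w \<langle>$\<rangle> z"
  by (metis apply_inverse_apply)

text \<open>
  Left multiplication by an adjacent transposition compares values as before, except that it
  exchanges the two adjacent values themselves.
\<close>

lemma simple_transposition_less_iff:
  assumes "\<not> (x = k \<and> z = k + 1)" "\<not> (x = k + 1 \<and> z = k)"
  shows "simple_transposition k \<langle>$\<rangle> x < simple_transposition k \<langle>$\<rangle> z \<longleftrightarrow> x < z"
  using assms by (auto simp: apply_simple_transposition)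

definition descent :: "int perm \<Rightarrow> int \<Rightarrow> bool" where
  "descent w k \<longleftrightarrow> w \<langle>$\<rangle> (k + 1) < w \<langle>$\<rangle> k"

lemma not_descent_iff: "\<not> descent w k \<longleftrightarrow> w \<langle>$\<rangle> k < w \<langle>$\<rangle> (k + 1)"
  using apply_inj[of w k "k + 1"] by (auto simp: descent_def)

lemma descent_mult_simple: "descent (w * simple_transposition k) k \<longleftrightarrow> \<not> descent w k"
  unfolding not_descent_iff by (simp add: descent_def apply_mult apply_simple_transposition)

text \<open>
  Applying \<open>s\<^sub>k\<close> to both entries carries the inversions of \<open>w\<close> to inversions of \<open>w s\<^sub>k\<close>, and
  \<open>(k, k + 1)\<close> is the only one not obtained in this way.
\<close>

lemma perm_length_mult_simple_ascent:
  assumes "\<not> descent w k"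
  shows "perm_length (w * simple_transposition k) = perm_length w + 1"
proof -
  let ?s = "simple_transposition k"
  let ?I = "\<lambda>w. {(i, j). i < j \<and> w \<langle>$\<rangle> i > w \<langle>$\<rangle> j}"
  let ?f = "map_prod (apply ?s) (apply ?s)"
  have ss: "?s \<langle>$\<rangle> (?s \<langle>$\<rangle> x) = x" for x
    by (simp add: apply_simple_transposition)
  have asc: "w \<langle>$\<rangle> k < w \<langle>$\<rangle> (k + 1)" using assms by (simp add: not_descent_iff)
  have inj: "inj ?f"
    by (intro prod.inj_map) (auto simp: inj_def apply_inj)
  have "?I (w * ?s) = insert (k, k + 1) (?f ` ?I w)" (is "?L = ?R")
  proof (intro equalityI subsetI)
    fix x assume "x \<in> ?L"
    then obtain i j where x: "x = (i, j)" and ij: "i < j" "(w * ?s) \<langle>$\<rangle> i > (w * ?s) \<langle>$\<rangle> j" by auto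
    show "x \<in> ?R"
    proof (cases "i = k \<and> j = k + 1")
      case False
      then have "?s \<langle>$\<rangle> i < ?s \<langle>$\<rangle> j"
        using ij(1) by (subst simple_transposition_less_iff) auto
      then have "(?s \<langle>$\<rangle> i, ?s \<langle>$\<rangle> j) \<in> ?I w" using ij by (simp add: apply_mult)
      moreover have "x = ?f (?s \<langle>$\<rangle> i, ?s \<langle>$\<rangle> j)" by (simp add: x ss)
      ultimately show ?thesis by blast
    qed (simp add: x)
  next
    fix x assume "x \<in> ?R"
    then consider "x = (k, k + 1)"
      | i j where "x = (?s \<langle>$\<rangle> i, ?s \<langle>$\<rangle> j)" "i < j" "w \<langle>$\<rangle> i > w \<langle>$\<rangle> j" by auto
    then show "x \<in> ?L"
    proof cases
      case 1
      then show ?thesis using asc by (simp add: apply_mult apply_simple_transposition)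
    next
      case 2
      then have "\<not> (i = k \<and> j = k + 1)" using asc by auto
      then have "?s \<langle>$\<rangle> i < ?s \<langle>$\<rangle> j"
        using 2 by (subst simple_transposition_less_iff) auto
      then show ?thesis using 2 by (simp add: apply_mult ss)
    qed
  qed
  moreover have "(k, k + 1) \<notin> ?f ` ?I w"
    by (auto simp: apply_simple_transposition split: if_splits)
  ultimately have "card (?I (w * ?s)) = Suc (card (?f ` ?I w))"
    by (simp add: finite_inversions)
  also have "card (?f ` ?I w) = card (?I w)"
    by (rule card_image) (rule inj_on_subset[OF inj], simp)
  finally show ?thesis by (simp add: perm_length_def)
qed

lemma perm_length_mult_simple_descent:
  assumes "descent w k"
  shows "perm_length w = perm_length (w * simple_transposition k) + 1"
  using perm_length_mult_simple_ascent[of "w * simple_transposition k" k] assms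
  by (simp add: descent_mult_simple)

lemma perm_length_inverse [simp]: "perm_length (inverse w) = perm_length w"
proof -
  have "bij_betw (\<lambda>(i, j). (w \<langle>$\<rangle> j, w \<langle>$\<rangle> i)) {(i, j). i < j \<and> w \<langle>$\<rangle> i > w \<langle>$\<rangle> j}
      {(i, j). i < j \<and> inverse w \<langle>$\<rangle> i > inverse w \<langle>$\<rangle> j}"
    by (rule bij_betw_byWitness[where f' = "\<lambda>(i, j). (inverse w \<langle>$\<rangle> j, inverse w \<langle>$\<rangle> i)"]) auto
  then show ?thesis
    by (simp add: perm_length_def bij_betw_same_card)
qed

lemma perm_length_simple_mult:
  "perm_length (simple_transposition k * w) = perm_length (inverse w * simple_transposition k)"
  by (metis inverse_mult inverse_simple_transposition inverse_inverse_perm perm_length_inverse)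

lemma perm_length_one [simp]: "perm_length 1 = 0"
proof -
  have "{(i::int, j). i < j \<and> 1 \<langle>$\<rangle> i > 1 \<langle>$\<rangle> j} = {}" by auto
  then show ?thesis unfolding perm_length_def by (metis card.empty)
qed

text \<open>
  Without descents \<open>w\<close> is increasing, so it moves no integer between two fixed points; and it fixes
  everything outside a bounded interval.
\<close>

lemma descent_exists:
  assumes "w \<noteq> 1"
  shows "\<exists>k. descent w k"
proof (rule ccontr)
  assume "\<nexists>k. descent w k"
  then have asc: "w \<langle>$\<rangle> k < w \<langle>$\<rangle> (k + 1)" for k by (auto simp: not_descent_iff)
  have mono: "w \<langle>$\<rangle> x + int n \<le> w \<langle>$\<rangle> (x + int n)" for x n
  proof (induction n)
    case (Suc n)
    then show ?case using asc[of "x + int n"] by (simp add: algebra_simps)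
  qed simp
  have mono': "w \<langle>$\<rangle> x + (z - x) \<le> w \<langle>$\<rangle> z" if "x \<le> z" for x z
    using mono[of x "nat (z - x)"] that by simp
  have "w \<langle>$\<rangle> x = x" for x
  proof -
    define F where "F = insert x (affected w)"
    have F: "finite F" "x \<in> F" by (auto simp: F_def)
    have up: "Max F + 1 \<notin> F" and lo: "Min F - 1 \<notin> F"
      using F(1) Max_ge[of F "Max F + 1"] Min_le[of F "Min F - 1"] by force+
    have "x \<le> Max F" "Min F \<le> x" using F by auto
    then show ?thesis
      using mono'[of x "Max F + 1"] mono'[of "Min F - 1" x] up lo
      unfolding F_def in_affected insert_iff de_Morgan_disj not_not by linarith
  qed
  then have "w = 1" by (intro perm_eqI) simp
  with assms show False by simp
qed

lemma finite_descents [simp]: "finite {k. descent w k}"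
proof -
  have "(\<lambda>k. (k, k + 1)) ` {k. descent w k} \<subseteq> {(i, j). i < j \<and> w \<langle>$\<rangle> i > w \<langle>$\<rangle> j}"
    by (auto simp: descent_def)
  then have "finite ((\<lambda>k. (k, k + 1)) ` {k. descent w k})"
    using finite_inversions finite_subset by blast
  then show ?thesis by (rule finite_imageD) (auto intro: inj_onI)
qed

lemma descent_induct [case_names one descent]:
  assumes "P 1"
    and "\<And>w k. descent w k \<Longrightarrow> P (w * simple_transposition k) \<Longrightarrow> P w"
  shows "P w"
proof (induction "perm_length w" arbitrary: w rule: less_induct)
  case less
  show ?case
  proof (cases "w = 1")
    case False
    then obtain k where k: "descent w k" using descent_exists by blast
    then show ?thesis
      using assms(2)[OF k] less perm_length_mult_simple_descent[OF k] by simp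
  qed (simp add: assms(1))
qed

text \<open>
  Write the transposition of \<open>a\<close> and \<open>b\<close> as \<open>s\<^sub>a\<close> times that of \<open>a + 1\<close> and \<open>b\<close> times \<open>s\<^sub>a\<close>.
  The middle factor raises the length by induction, and at most one of the outer factors lowers it.
\<close>

lemma perm_length_mult_swap:
  assumes "a < b" "u \<langle>$\<rangle> a < u \<langle>$\<rangle> b"
  shows "perm_length u < perm_length (u * \<langle>a \<leftrightarrow> b\<rangle>)"
  using assms
proof (induction "nat (b - a)" arbitrary: a u rule: less_induct)
  case less
  show ?case
  proof (cases "b = a + 1")
    case True
    then show ?thesis
      using perm_length_mult_simple_ascent[of u a] less.prems
      by (simp add: not_descent_iff simple_transposition_def)
  next
    case False
    let ?s = "simple_transposition a"
    define u1 where "u1 = u * ?s"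
    define u2 where "u2 = u1 * \<langle>a + 1 \<leftrightarrow> b\<rangle>"
    have ab: "a + 1 < b" using less.prems False by simp
    have eq: "u * \<langle>a \<leftrightarrow> b\<rangle> = u2 * ?s"
      unfolding u1_def u2_def using ab
      by (intro perm_eqI) (simp add: apply_mult apply_simple_transposition apply_swap_if)
    have "u1 \<langle>$\<rangle> (a + 1) < u1 \<langle>$\<rangle> b"
      using less.prems ab by (simp add: u1_def apply_mult apply_simple_transposition)
    then have l12: "perm_length u1 < perm_length u2"
      unfolding u2_def using ab by (intro less.hyps) auto
    show ?thesis
    proof (cases "descent u a")
      case True
      have "\<not> descent u2 a"
        using True less.prems ab
        by (simp add: u2_def u1_def not_descent_iff descent_def apply_mult
            apply_simple_transposition apply_swap_if)
      then show ?thesis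
        unfolding eq using l12 perm_length_mult_simple_ascent[of u2 a]
          perm_length_mult_simple_descent[OF True] by (simp add: u1_def)
    next
      case asc: False
      have "perm_length u2 \<le> perm_length (u2 * ?s) + 1"
        using perm_length_mult_simple_ascent[of u2 a] perm_length_mult_simple_descent[of u2 a]
        by (cases "descent u2 a") auto
      then show ?thesis
        unfolding eq using l12 perm_length_mult_simple_ascent[OF asc] by (simp add: u1_def)
    qed
  qed
qed

section \<open>Bruhat order\<close>

text \<open>
  Among \<open>u\<close> and \<open>u t\<close> the longer one is the one with the larger value at the right position, so
  that lengths need not be computed to recognise a step.
\<close>

lemma bruhat_step_iff:
  "bruhat_step u v \<longleftrightarrow> (\<exists>a b. a < b \<and> u \<langle>$\<rangle> a < u \<langle>$\<rangle> b \<and> v = u * \<langle>a \<leftrightarrow> b\<rangle>)"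
proof
  assume "bruhat_step u v"
  then obtain a b where ab: "a \<noteq> b" "v = u * \<langle>a \<leftrightarrow> b\<rangle>" "perm_length u < perm_length v"
    unfolding bruhat_step_def by blast
  obtain c d where cd: "c < d" "v = u * \<langle>c \<leftrightarrow> d\<rangle>"
    using ab by (metis linorder_neqE swap_sym)
  have uv: "v * \<langle>c \<leftrightarrow> d\<rangle> = u" using cd by (simp add: mult.assoc)
  have "\<not> u \<langle>$\<rangle> c > u \<langle>$\<rangle> d"
  proof
    assume "u \<langle>$\<rangle> c > u \<langle>$\<rangle> d"
    then have "v \<langle>$\<rangle> c < v \<langle>$\<rangle> d" by (simp add: cd apply_mult)
    from perm_length_mult_swap[OF cd(1) this] show False using ab uv by simp
  qed
  then have "u \<langle>$\<rangle> c < u \<langle>$\<rangle> d" using cd apply_inj[of u c d] by auto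
  then show "\<exists>a b. a < b \<and> u \<langle>$\<rangle> a < u \<langle>$\<rangle> b \<and> v = u * \<langle>a \<leftrightarrow> b\<rangle>" using cd by blast
next
  assume "\<exists>a b. a < b \<and> u \<langle>$\<rangle> a < u \<langle>$\<rangle> b \<and> v = u * \<langle>a \<leftrightarrow> b\<rangle>"
  then show "bruhat_step u v"
    unfolding bruhat_step_def using perm_length_mult_swap by (metis less_irrefl)
qed

lemma bruhat_less_mult_swap:
  "a < b \<Longrightarrow> u \<langle>$\<rangle> a < u \<langle>$\<rangle> b \<Longrightarrow> bruhat_less u (u * \<langle>a \<leftrightarrow> b\<rangle>)"
  by (rule bruhat_less_step) (auto simp: bruhat_step_iff)

lemma bruhat_less_trans: "bruhat_less u v \<Longrightarrow> bruhat_less v w \<Longrightarrow> bruhat_less u w"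
  by (meson bruhat_less_strict_order(2) transpD)

lemma bruhat_less_irrefl [simp]: "\<not> bruhat_less u u"
  by (meson bruhat_less_strict_order(1) irreflpD)

lemma bruhat_less_le_trans: "bruhat_less u v \<Longrightarrow> bruhat_le v w \<Longrightarrow> bruhat_less u w"
  using bruhat_less_trans by (auto simp: bruhat_le_def)

lemma bruhat_le_less_trans: "bruhat_le u v \<Longrightarrow> bruhat_less v w \<Longrightarrow> bruhat_less u w"
  using bruhat_less_trans by (auto simp: bruhat_le_def)

lemma bruhat_le_trans: "bruhat_le u v \<Longrightarrow> bruhat_le v w \<Longrightarrow> bruhat_le u w"
  using bruhat_less_trans by (auto simp: bruhat_le_def)

lemma bruhat_le_neq: "bruhat_le u v \<Longrightarrow> u \<noteq> v \<Longrightarrow> bruhat_less u v"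
  by (simp add: bruhat_le_def)

text \<open>Monotonicity only has to be checked along single steps.\<close>

lemma bruhat_monoI:
  assumes "\<And>u v. bruhat_step u v \<Longrightarrow> bruhat_le (f u) (f v)" and "bruhat_le u v"
  shows "bruhat_le (f u) (f v)"
proof -
  have "bruhat_le (f u) (f v)" if "bruhat_step\<^sup>+\<^sup>+ u v" for u v
    using that by (induction rule: tranclp_induct) (blast intro: assms(1) bruhat_le_trans)+
  then show ?thesis
    using assms(2) by (auto simp: bruhat_le_def bruhat_less_def)
qed

text \<open>Read on the values instead of the positions, a transposition acts from the left.\<close>

lemma bruhat_step_inverse:
  assumes "bruhat_step u v"
  shows "bruhat_step (inverse u) (inverse v)"
proof -
  obtain a b where ab: "a < b" "u \<langle>$\<rangle> a < u \<langle>$\<rangle> b" "v = u * \<langle>a \<leftrightarrow> b\<rangle>"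
    using assms by (auto simp: bruhat_step_iff)
  have "inverse v = inverse u * \<langle>u \<langle>$\<rangle> a \<leftrightarrow> u \<langle>$\<rangle> b\<rangle>"
    by (rule perm_eqI)
      (auto simp: ab(3) inverse_mult apply_mult apply_swap_if inverse_apply_eq_iff)
  then show ?thesis
    unfolding bruhat_step_iff using ab by (metis apply_inverse_apply(1))
qed

lemma bruhat_le_inverse: "bruhat_le u v \<Longrightarrow> bruhat_le (inverse u) (inverse v)"
  using bruhat_monoI[of inverse] bruhat_step_inverse
  by (meson bruhat_le_def bruhat_less_step)

text \<open>
  Conjugating the transposition of \<open>a < b\<close> by \<open>s\<^sub>k\<close> keeps its two entries in order unless the
  transposition is \<open>s\<^sub>k\<close> itself.
\<close>

lemma bruhat_step_mult_simple:
  assumes "bruhat_step u v" and "v \<noteq> u * simple_transposition k"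
  shows "bruhat_step (u * simple_transposition k) (v * simple_transposition k)"
proof -
  let ?s = "simple_transposition k"
  obtain a b where ab: "a < b" "u \<langle>$\<rangle> a < u \<langle>$\<rangle> b" "v = u * \<langle>a \<leftrightarrow> b\<rangle>"
    using assms(1) by (auto simp: bruhat_step_iff)
  have "\<not> (a = k \<and> b = k + 1)" using assms(2) ab(3) by (auto simp: simple_transposition_def)
  then have lt: "?s \<langle>$\<rangle> a < ?s \<langle>$\<rangle> b"
    using ab(1) by (subst simple_transposition_less_iff) auto
  have "v * ?s = u * ?s * \<langle>?s \<langle>$\<rangle> a \<leftrightarrow> ?s \<langle>$\<rangle> b\<rangle>"
    by (rule perm_eqI) (auto simp: ab(3) apply_mult apply_swap_if apply_simple_transposition)
  moreover have "(u * ?s) \<langle>$\<rangle> (?s \<langle>$\<rangle> x) = u \<langle>$\<rangle> x" for x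
    by (simp add: apply_mult apply_simple_transposition)
  ultimately show ?thesis
    unfolding bruhat_step_iff using ab(2) lt by metis
qed

definition raise_right :: "int \<Rightarrow> int perm \<Rightarrow> int perm" where
  "raise_right k w = (if descent w k then w else w * simple_transposition k)"

definition lower_right :: "int \<Rightarrow> int perm \<Rightarrow> int perm" where
  "lower_right k w = (if descent w k then w * simple_transposition k else w)"

text \<open>
  The operators on the left are conjugates of those on the right under inversion, which is an
  automorphism of the Bruhat order; monotonicity then only has to be shown on the right.
\<close>

definition raise_left :: "int \<Rightarrow> int perm \<Rightarrow> int perm" where
  "raise_left k w = inverse (raise_right k (inverse w))"

definition lower_left :: "int \<Rightarrow> int perm \<Rightarrow> int perm" where
  "lower_left k w = inverse (lower_right k (inverse w))"

lemma mult_simple_bruhat: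
  "descent w k \<Longrightarrow> bruhat_less (w * simple_transposition k) w"
  "\<not> descent w k \<Longrightarrow> bruhat_less w (w * simple_transposition k)"
proof -
  have *: "bruhat_less w (w * simple_transposition k)" if "\<not> descent w k" for w
    unfolding simple_transposition_def
    by (rule bruhat_less_mult_swap) (use that in \<open>auto simp: not_descent_iff\<close>)
  show "\<not> descent w k \<Longrightarrow> bruhat_less w (w * simple_transposition k)" by (rule *)
  show "descent w k \<Longrightarrow> bruhat_less (w * simple_transposition k) w"
    using *[of "w * simple_transposition k"] by (simp add: descent_mult_simple)
qed

text \<open>
  For a step from \<open>u\<close> to \<open>v \<noteq> u s\<^sub>k\<close>, both \<open>u < v\<close> and \<open>u s\<^sub>k < v s\<^sub>k\<close> hold, and the larger of
  \<open>v\<close> and \<open>v s\<^sub>k\<close> lies above both \<open>u\<close> and \<open>u s\<^sub>k\<close>.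
\<close>

lemma raise_right_mono:
  assumes "bruhat_le u v"
  shows "bruhat_le (raise_right k u) (raise_right k v)"
proof (rule bruhat_monoI[OF _ assms])
  fix u v assume st: "bruhat_step u v"
  let ?s = "simple_transposition k"
  show "bruhat_le (raise_right k u) (raise_right k v)"
  proof (cases "v = u * ?s")
    case True
    have "\<not> descent u k"
      using st mult_simple_bruhat[of u k] True bruhat_less_irrefl bruhat_less_step bruhat_less_trans
      by blast
    then show ?thesis by (simp add: raise_right_def True descent_mult_simple bruhat_le_def)
  next
    case False
    then have "bruhat_less (u * ?s) (v * ?s)" "bruhat_less u v"
      using st bruhat_step_mult_simple bruhat_less_step by blast+
    then show ?thesis
      using mult_simple_bruhat[of v k] bruhat_less_trans
      by (auto simp: raise_right_def bruhat_le_def)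
  qed
qed

lemma lower_right_mono:
  assumes "bruhat_le u v"
  shows "bruhat_le (lower_right k u) (lower_right k v)"
proof (rule bruhat_monoI[OF _ assms])
  fix u v assume st: "bruhat_step u v"
  let ?s = "simple_transposition k"
  show "bruhat_le (lower_right k u) (lower_right k v)"
  proof (cases "v = u * ?s")
    case True
    have "\<not> descent u k"
      using st mult_simple_bruhat[of u k] True bruhat_less_irrefl bruhat_less_step bruhat_less_trans
      by blast
    then show ?thesis by (simp add: lower_right_def True descent_mult_simple bruhat_le_def)
  next
    case False
    then have "bruhat_less (u * ?s) (v * ?s)" "bruhat_less u v"
      using st bruhat_step_mult_simple bruhat_less_step by blast+
    then show ?thesis
      using mult_simple_bruhat[of u k] bruhat_less_trans
      by (auto simp: lower_right_def bruhat_le_def)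
  qed
qed

lemma raise_left_mono: "bruhat_le u v \<Longrightarrow> bruhat_le (raise_left k u) (raise_left k v)"
  by (simp add: raise_left_def raise_right_mono bruhat_le_inverse)

lemma lower_left_mono: "bruhat_le u v \<Longrightarrow> bruhat_le (lower_left k u) (lower_left k v)"
  by (simp add: lower_left_def lower_right_mono bruhat_le_inverse)

lemma raise_left_eq:
  "raise_left k w = (if descent (inverse w) k then w else simple_transposition k * w)"
  by (simp add: raise_left_def raise_right_def inverse_mult)

lemma lower_left_eq:
  "lower_left k w = (if descent (inverse w) k then simple_transposition k * w else w)"
  by (simp add: lower_left_def lower_right_def inverse_mult)

section \<open>The Demazure product\<close>

lemma raise_left_idem: "raise_left k (raise_left k w) = raise_left k w"
  by (simp add: raise_left_def raise_right_def descent_mult_simple)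

text \<open>
  Left multiplication by \<open>s\<^sub>k\<close> changes whether \<open>j\<close> is a descent only if the values at \<open>j\<close> and
  \<open>j + 1\<close> are \<open>k\<close> and \<open>k + 1\<close>, that is, only if it agrees with right multiplication by \<open>s\<^sub>j\<close>.
\<close>

lemma descent_simple_mult:
  assumes "simple_transposition k * w \<noteq> w * simple_transposition j"
  shows "descent (simple_transposition k * w) j \<longleftrightarrow> descent w j"
proof -
  have "\<not> (w \<langle>$\<rangle> (j + 1) = k \<and> w \<langle>$\<rangle> j = k + 1) \<and> \<not> (w \<langle>$\<rangle> (j + 1) = k + 1 \<and> w \<langle>$\<rangle> j = k)"
  proof (rule ccontr)
    assume "\<not> ?thesis"
    then have ends: "{w \<langle>$\<rangle> j, w \<langle>$\<rangle> (j + 1)} = {k, k + 1}" by auto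
    have "(simple_transposition k * w) \<langle>$\<rangle> x = (w * simple_transposition j) \<langle>$\<rangle> x" for x
    proof (cases "x \<in> {j, j + 1}")
      case False
      then have "w \<langle>$\<rangle> x \<notin> {k, k + 1}" by (simp add: apply_inj flip: ends)
      then show ?thesis using False by (simp add: apply_mult apply_simple_transposition)
    qed (use ends in \<open>auto simp: apply_mult apply_simple_transposition doubleton_eq_iff\<close>)
    with assms show False by (blast intro: perm_eqI)
  qed
  then show ?thesis
    unfolding descent_def apply_mult by (subst simple_transposition_less_iff) auto
qed

lemma descent_inverse_mult_simple:
  assumes "simple_transposition k * w \<noteq> w * simple_transposition j"
  shows "descent (inverse (w * simple_transposition j)) k \<longleftrightarrow> descent (inverse w) k"
proof -
  have "simple_transposition j * inverse w \<noteq> inverse w * simple_transposition k"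
    using assms by (metis inverse_inverse_perm inverse_mult inverse_simple_transposition)
  from descent_simple_mult[OF this] show ?thesis by (simp add: inverse_mult)
qed

text \<open>
  If \<open>s\<^sub>k w = w s\<^sub>j\<close>, then both operators take \<open>w\<close> to the longer of \<open>w\<close> and \<open>w s\<^sub>j\<close>; otherwise neither
  operator affects what the other one does.
\<close>

lemma raise_left_right_commute: "raise_left k (raise_right j w) = raise_right j (raise_left k w)"
proof (cases "simple_transposition k * w = w * simple_transposition j")
  case True
  have "perm_length (inverse w * simple_transposition k) = perm_length (w * simple_transposition j)"
    by (metis True perm_length_simple_mult)
  moreover have "perm_length (v * simple_transposition i) < perm_length v \<longleftrightarrow> descent v i" for v i
    using perm_length_mult_simple_ascent[of v i] perm_length_mult_simple_descent[of v i] by force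
  ultimately have "descent (inverse w) k \<longleftrightarrow> descent w j"
    by (metis perm_length_inverse)
  moreover have "inverse (w * simple_transposition j) = inverse w * simple_transposition k"
    unfolding True[symmetric] by (simp add: inverse_mult)
  ultimately show ?thesis
    using True by (simp add: raise_left_eq raise_right_def descent_mult_simple)
next
  case False
  then show ?thesis
    using descent_simple_mult[OF False] descent_inverse_mult_simple[OF False]
    by (auto simp: raise_left_eq raise_right_def mult.assoc)
qed

definition raise_word :: "int list \<Rightarrow> int perm \<Rightarrow> int perm" where
  "raise_word ks v = foldr raise_left ks v"

lemma raise_word_simps [simp]:
  "raise_word [] v = v"
  "raise_word (k # ks) v = raise_left k (raise_word ks v)"
  by (simp_all add: raise_word_def)

lemma raise_word_append [simp]: "raise_word (ks @ js) v = raise_word ks (raise_word js v)"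
  by (induction ks) auto

lemma raise_word_raise_right: "raise_word ks (raise_right j v) = raise_right j (raise_word ks v)"
  by (induction ks) (simp_all add: raise_left_right_commute)

abbreviation word_product :: "int list \<Rightarrow> int perm" where
  "word_product ks \<equiv> prod_list (map simple_transposition ks)"

lemma reduced_word_exists: "\<exists>ks. word_product ks = w \<and> length ks = perm_length w"
proof (induction w rule: descent_induct)
  case one
  show ?case by (rule exI[of _ "[]"]) simp
next
  case (descent w k)
  then obtain ks where "word_product ks = w * simple_transposition k"
    "length ks = perm_length (w * simple_transposition k)" by blast
  then show ?case
    using perm_length_mult_simple_descent[OF descent(1)] by (intro exI[of _ "ks @ [k]"]) simp
qed

lemma perm_length_simple_mult_cases:
  "perm_length (simple_transposition k * w) =
     (if descent (inverse w) k then perm_length w - 1 else perm_length w + 1)"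
  using perm_length_mult_simple_ascent[of "inverse w" k]
    perm_length_mult_simple_descent[of "inverse w" k]
  by (simp add: perm_length_simple_mult)

lemma perm_length_word_mult_le: "perm_length (word_product ks * v) \<le> length ks + perm_length v"
proof (induction ks)
  case (Cons k ks)
  then show ?case
    using perm_length_simple_mult_cases[of k "word_product ks * v"] by (simp add: mult.assoc split: if_splits)
qed simp

text \<open>
  If the lengths add up, every letter of the word meets an ascent and multiplies.
\<close>

lemma raise_word_reduced:
  assumes "perm_length (word_product ks * v) = length ks + perm_length v"
  shows "raise_word ks v = word_product ks * v"
  using assms
proof (induction ks)
  case (Cons k ks)
  let ?w = "word_product ks * v"
  have eq: "perm_length (simple_transposition k * ?w) = Suc (length ks + perm_length v)"
    using Cons.prems by (simp add: mult.assoc)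
  with perm_length_word_mult_le[of ks v]
  have "\<not> descent (inverse ?w) k" "perm_length ?w = length ks + perm_length v"
    using perm_length_simple_mult_cases[of k ?w] by (auto split: if_splits)
  then show ?case using Cons.IH by (simp add: raise_left_eq mult.assoc)
qed simp

lemma raise_word_one: 
  assumes "length ks = perm_length (word_product ks)"
  shows "raise_word ks 1 = word_product ks"
  using raise_word_reduced[of ks 1] assms by simp

lemma raise_right_word_exists: "\<exists>js. v = foldr raise_right js 1"
proof (induction v rule: descent_induct)
  case one
  show ?case by (rule exI[of _ "[]"]) simp
next
  case (descent w k)
  then obtain js where "w * simple_transposition k = foldr raise_right js 1" by blast
  moreover have "w = raise_right k (w * simple_transposition k)"
    using descent(1) by (simp add: raise_right_def descent_mult_simple)
  ultimately show ?case by (metis foldr_Cons comp_apply)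
qed

text \<open>
  Every \<open>v\<close> arises from the identity by raising on the right, which commutes with raising on the
  left; so what a word does on the left depends only on what it does to the identity.
\<close>

lemma raise_word_cong:
  assumes "raise_word ks 1 = raise_word js 1"
  shows "raise_word ks v = raise_word js v"
proof -
  obtain ls where v: "v = foldr raise_right ls 1" using raise_right_word_exists by blast
  have "raise_word ks (foldr raise_right ls 1) = foldr raise_right ls (raise_word ks 1)" for ks
    by (induction ls) (simp_all add: raise_word_raise_right)
  then show ?thesis by (simp add: v assms)
qed

abbreviation is_demazure :: "(int perm \<Rightarrow> int perm \<Rightarrow> int perm) \<Rightarrow> bool" where
  "is_demazure m \<equiv>
     (\<forall>u v w. m (m u v) w = m u (m v w)) \<and>
     (\<forall>u v. perm_length (u * v) = perm_length u + perm_length v \<longrightarrow> m u v = u * v) \<and>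
     (\<forall>i. m (simple_transposition i) (simple_transposition i) = simple_transposition i)"

lemma perm_length_simple [simp]: "perm_length (simple_transposition k) = 1"
  using perm_length_mult_simple_ascent[of 1 k] by (simp add: descent_def)

text \<open>
  Peeling off the letters of a reduced word shows that a Demazure product is unique: the factor
  \<open>s\<^sub>k\<close> acts on the left as \<open>raise_left k\<close>.
\<close>

lemma is_demazure_raise_word:
  assumes m: "is_demazure m" and ks: "length ks = perm_length (word_product ks)"
  shows "m (word_product ks) v = raise_word ks v"
proof -
  have m_assoc: "m (m u v) w = m u (m v w)" for u v w
    using m by (elim conjE allE)
  have m_length: "m u v = u * v" if "perm_length (u * v) = perm_length u + perm_length v" for u v
    using conjunct1[OF conjunct2[OF m]] that by (elim allE impE)
  have m_idem: "m (simple_transposition i) (simple_transposition i) = simple_transposition i" for i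
    using conjunct2[OF conjunct2[OF m]] by (elim allE)
  show ?thesis
    using ks
  proof (induction ks)
    case Nil
    then show ?case using m_length by simp
  next
    case (Cons k ks)
    let ?s = "simple_transposition k"
    have simple: "m ?s v = raise_left k v" for v
    proof (cases "descent (inverse v) k")
      case False
      then have "m ?s v = ?s * v"
        by (intro m_length) (simp add: perm_length_simple_mult_cases)
      then show ?thesis using False by (simp add: raise_left_eq)
    next
      case True
      \<comment> \<open>\<open>v\<close> is the reduced product of \<open>s\<^sub>k\<close> and \<open>s\<^sub>k v\<close>, so that the second \<open>s\<^sub>k\<close> is absorbed.\<close>
      have "perm_length v = perm_length ?s + perm_length (?s * v)"
        using perm_length_mult_simple_descent[OF True] by (simp add: perm_length_simple_mult)
      then have "m ?s (?s * v) = v" using m_length[of ?s "?s * v"] by simp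
      then have "m ?s v = v" using m_assoc[of ?s ?s "?s * v"] m_idem[of k] by simp
      then show ?thesis using True by (simp add: raise_left_eq)
    qed
    have red: "length ks = perm_length (word_product ks)"
      using Cons.prems perm_length_word_mult_le[of ks 1]
        perm_length_simple_mult_cases[of k "word_product ks"] by (auto split: if_splits)
    with Cons.prems have "m ?s (word_product ks) = ?s * word_product ks"
      by (intro m_length) simp
    then have "m (word_product (k # ks)) v = m (m ?s (word_product ks)) v" by simp
    also have "\<dots> = m ?s (m (word_product ks) v)" by (rule m_assoc)
    finally show ?case using Cons.IH[OF red] simple by simp
  qed
qed

lemma is_demazure_demazure: "is_demazure demazure"
proof -
  define rw where "rw u = (SOME ks. word_product ks = u \<and> length ks = perm_length u)" for u
  have rw: "word_product (rw u) = u" "length (rw u) = perm_length u" for u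
    using someI_ex[OF reduced_word_exists[of u]] by (auto simp: rw_def)
  define m where "m u v = raise_word (rw u) v" for u v
  have rw1: "raise_word (rw u) 1 = u" for u
    using raise_word_one[of "rw u"] rw[of u] by simp
  have mw: "m (raise_word ks 1) v = raise_word ks v" for ks v
    unfolding m_def by (rule raise_word_cong) (rule rw1)
  have "is_demazure m"
  proof (intro conjI allI impI)
    fix u v w
    have "m u v = raise_word (rw u @ rw v) 1" by (simp add: m_def rw1)
    then have "m (m u v) w = raise_word (rw u @ rw v) w" by (simp only: mw)
    then show "m (m u v) w = m u (m v w)" by (simp add: m_def)
  next
    fix u v assume "perm_length (u * v) = perm_length u + perm_length v"
    then show "m u v = u * v"
      unfolding m_def using raise_word_reduced[of "rw u" v] rw[of u] by simp
  next
    fix i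
    have s: "raise_left i 1 = simple_transposition i"
      by (simp add: raise_left_eq descent_def)
    then show "m (simple_transposition i) (simple_transposition i) = simple_transposition i"
      using mw[of "[i]" "simple_transposition i"] raise_left_idem[of i 1] by simp
  qed
  moreover have "m' = m" if "is_demazure m'" for m'
  proof (intro ext)
    fix u v
    show "m' u v = m u v"
      using is_demazure_raise_word[OF that, of "rw u" v] rw[of u] by (simp add: m_def)
  qed
  ultimately show ?thesis
    unfolding demazure_def by (rule theI)
qed

lemma demazure_simple_left: "demazure (simple_transposition k) v = raise_left k v"
  using is_demazure_raise_word[OF is_demazure_demazure, of "[k]"] by simp

lemma demazure_simple_right: "demazure u (simple_transposition k) = raise_right k u"
proof -
  obtain ks where ks: "word_product ks = u" "length ks = perm_length u"
    using reduced_word_exists by blast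
  have s: "simple_transposition k = raise_right k 1"
    by (simp add: raise_right_def descent_def)
  have "demazure u (simple_transposition k) = raise_word ks (raise_right k 1)"
    using is_demazure_raise_word[OF is_demazure_demazure, of ks] ks s by simp
  also have "\<dots> = raise_right k u"
    using raise_word_one[of ks] ks by (simp add: raise_word_raise_right)
  finally show ?thesis .
qed

section \<open>Raising and lowering involutions\<close>

lemma involution_inverse: "y \<in> involutions \<Longrightarrow> inverse y = y"
  by (simp add: involutions_def)

lemma involution_apply [simp]: "y \<in> involutions \<Longrightarrow> y \<langle>$\<rangle> (y \<langle>$\<rangle> x) = x"
  by (metis apply_inverse_apply(1) involution_inverse)

lemma involution_apply_eq_iff: "y \<in> involutions \<Longrightarrow> y \<langle>$\<rangle> x = z \<longleftrightarrow> y \<langle>$\<rangle> z = x"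
  by (metis involution_apply)

lemma involutionI:
  assumes "\<And>x. y \<langle>$\<rangle> (y \<langle>$\<rangle> x) = x"
  shows "y \<in> involutions"
proof -
  have "y * y = 1" by (rule perm_eqI) (simp add: apply_mult assms)
  then show ?thesis
    unfolding involutions_def by (metis (mono_tags) mem_Collect_eq perm.inverse_unique)
qed

lemma one_involution [simp]: "1 \<in> involutions"
  by (rule involutionI) simp

text \<open>
  The operator \<open>y \<mapsto> s\<^sub>k \<circ> y \<circ> s\<^sub>k\<close>, in terms of the operators of the two sides.
\<close>

definition raise :: "int \<Rightarrow> int perm \<Rightarrow> int perm" where
  "raise k y = raise_right k (raise_left k y)"

definition lower :: "int \<Rightarrow> int perm \<Rightarrow> int perm" where
  "lower k y = lower_right k (lower_left k y)"

lemma raise_mono: "bruhat_le u v \<Longrightarrow> bruhat_le (raise k u) (raise k v)"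
  by (simp add: raise_def raise_right_mono raise_left_mono)

lemma lower_mono: "bruhat_le u v \<Longrightarrow> bruhat_le (lower k u) (lower k v)"
  by (simp add: lower_def lower_right_mono lower_left_mono)

lemma raise_descent: "y \<in> involutions \<Longrightarrow> descent y k \<Longrightarrow> raise k y = y"
  by (simp add: raise_def raise_left_eq raise_right_def involution_inverse)

lemma lower_ascent: "y \<in> involutions \<Longrightarrow> \<not> descent y k \<Longrightarrow> lower k y = y"
  by (simp add: lower_def lower_left_eq lower_right_def involution_inverse)

text \<open>
  At an ascent, an involution \<open>y\<close> commutes with \<open>s\<^sub>k\<close> exactly if it fixes \<open>k\<close> and \<open>k + 1\<close>; then the
  second factor \<open>s\<^sub>k\<close> is absorbed.
\<close>

lemma raise_ascent:
  assumes "y \<in> involutions" "\<not> descent y k"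
  shows "raise k y = (if y \<langle>$\<rangle> k = k \<and> y \<langle>$\<rangle> (k + 1) = k + 1
    then simple_transposition k * y
    else simple_transposition k * y * simple_transposition k)"
proof -
  let ?s = "simple_transposition k"
  have lt: "y \<langle>$\<rangle> k < y \<langle>$\<rangle> (k + 1)" using assms(2) by (simp add: not_descent_iff)
  then have "descent (?s * y) k \<longleftrightarrow> y \<langle>$\<rangle> k = k \<and> y \<langle>$\<rangle> (k + 1) = k + 1"
    by (auto simp: descent_def apply_mult apply_simple_transposition)
  then show ?thesis
    using assms by (simp add: raise_def raise_left_eq raise_right_def involution_inverse)
qed

lemma raise_ascent_apply:
  assumes "y \<in> involutions" "\<not> descent y k"
  shows "raise k y \<langle>$\<rangle> x = (if y \<langle>$\<rangle> k = k \<and> y \<langle>$\<rangle> (k + 1) = k + 1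
    then simple_transposition k \<langle>$\<rangle> (y \<langle>$\<rangle> x)
    else simple_transposition k \<langle>$\<rangle> (y \<langle>$\<rangle> (simple_transposition k \<langle>$\<rangle> x)))"
  by (simp add: raise_ascent[OF assms] apply_mult)

lemma lower_descent:
  assumes "y \<in> involutions" "descent y k"
  shows "lower k y = (if y \<langle>$\<rangle> k = k + 1 then simple_transposition k * y
    else simple_transposition k * y * simple_transposition k)"
proof -
  let ?s = "simple_transposition k"
  have lt: "y \<langle>$\<rangle> k > y \<langle>$\<rangle> (k + 1)" using assms(2) by (simp add: descent_def)
  have "y \<langle>$\<rangle> (k + 1) = k" if "y \<langle>$\<rangle> k = k + 1"
    using that assms(1) by (metis involution_apply)
  then have "\<not> descent (?s * y) k \<longleftrightarrow> y \<langle>$\<rangle> k = k + 1"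
    using lt by (auto simp: descent_def apply_mult apply_simple_transposition)
  then show ?thesis
    using assms
    by (cases "y \<langle>$\<rangle> k = k + 1") (simp_all add: lower_def lower_left_eq lower_right_def involution_inverse)
qed

lemma simple_involution [simp]: "simple_transposition k \<langle>$\<rangle> (simple_transposition k \<langle>$\<rangle> x) = x"
  by (simp add: apply_simple_transposition)

lemma conj_simple_involution:
  "y \<in> involutions \<Longrightarrow> simple_transposition k * y * simple_transposition k \<in> involutions"
  by (rule involutionI) (simp add: apply_mult)

lemma simple_mult_involution:
  assumes "y \<in> involutions" "{y \<langle>$\<rangle> k, y \<langle>$\<rangle> (k + 1)} = {k, k + 1}"
  shows "simple_transposition k * y \<in> involutions"
proof (rule involutionI)
  fix x
  show "(simple_transposition k * y) \<langle>$\<rangle> ((simple_transposition k * y) \<langle>$\<rangle> x) = x"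
  proof (cases "y \<langle>$\<rangle> x \<in> {k, k + 1}")
    case False
    then have "x \<notin> {k, k + 1}" using assms(2) by auto
    with False show ?thesis using assms(1) by (simp add: apply_mult apply_simple_transposition)
  next
    case True
    then have "x \<in> {k, k + 1}"
      using assms by (metis (no_types, opaque_lifting) insert_iff empty_iff involution_apply)
    with True show ?thesis
      using assms(2) by (auto simp: apply_mult apply_simple_transposition doubleton_eq_iff)
  qed
qed

lemma raise_involution: "y \<in> involutions \<Longrightarrow> raise k y \<in> involutions"
  by (cases "descent y k")
    (auto simp: raise_descent raise_ascent intro: conj_simple_involution simple_mult_involution)

lemma lower_involution: "y \<in> involutions \<Longrightarrow> lower k y \<in> involutions"
proof (cases "descent y k")
  case True
  assume y: "y \<in> involutions"
  then have "y \<langle>$\<rangle> (k + 1) = k" if "y \<langle>$\<rangle> k = k + 1" using that by (metis involution_apply)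
  then show ?thesis
    using y True
    by (auto simp: lower_descent intro!: conj_simple_involution simple_mult_involution)
qed (simp add: lower_ascent)

lemma raise_ascent_descent:
  assumes "y \<in> involutions" "\<not> descent y k"
  shows "descent (raise k y) k"
proof (cases "y \<langle>$\<rangle> k = k \<and> y \<langle>$\<rangle> (k + 1) = k + 1")
  case False
  have lt: "y \<langle>$\<rangle> k < y \<langle>$\<rangle> (k + 1)" using assms(2) by (simp add: not_descent_iff)
  then have "simple_transposition k \<langle>$\<rangle> (y \<langle>$\<rangle> k) < simple_transposition k \<langle>$\<rangle> (y \<langle>$\<rangle> (k + 1))"
    using False by (subst simple_transposition_less_iff) auto
  then show ?thesis
    using assms False by (simp add: descent_def raise_ascent_apply) (simp add: apply_simple_transposition)
qed (use assms in \<open>simp add: raise_ascent_apply descent_def apply_simple_transposition\<close>)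

lemma lower_descent_ascent:
  assumes "y \<in> involutions" "descent y k"
  shows "\<not> descent (lower k y) k"
proof -
  have "y \<langle>$\<rangle> (k + 1) = k" if "y \<langle>$\<rangle> k = k + 1" using that assms by (metis involution_apply)
  then show ?thesis
    using assms
    by (auto simp: lower_descent apply_mult descent_def apply_simple_transposition)
qed

text \<open>
  The two branches of \<open>raise\<close> are told apart by the value at \<open>k\<close>: it is \<open>k + 1\<close> exactly after a
  multiplication that created the cycle of \<open>k\<close> and \<open>k + 1\<close>.
\<close>

lemma lower_raise:
  assumes "y \<in> involutions" "\<not> descent y k"
  shows "lower k (raise k y) = y"
proof (cases "y \<langle>$\<rangle> k = k \<and> y \<langle>$\<rangle> (k + 1) = k + 1")
  case True
  then show ?thesis
    using assms raise_ascent_descent[OF assms] raise_involution[OF assms(1), of k]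
    by (simp add: lower_descent raise_ascent apply_mult apply_simple_transposition)
next
  case False
  have "y \<langle>$\<rangle> (k + 1) \<noteq> k" 
    using assms by (metis involution_apply not_descent_iff less_add_one order_less_asym)
  then have "raise k y \<langle>$\<rangle> k \<noteq> k + 1"
    using False assms involution_apply_eq_iff[OF assms(1), of k k]
    by (auto simp: raise_ascent_apply not_descent_iff apply_simple_transposition)
  then show ?thesis
    using assms False raise_ascent_descent[OF assms] raise_involution[OF assms(1), of k]
    by (auto simp: lower_descent raise_ascent mult.assoc)
qed

lemma raise_lower:
  assumes "y \<in> involutions" "descent y k"
  shows "raise k (lower k y) = y"
proof -
  let ?y' = "lower k y"
  have y': "?y' \<in> involutions" "\<not> descent ?y' k"
    using assms by (simp_all add: lower_involution lower_descent_ascent)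
  have sw: "y \<langle>$\<rangle> (k + 1) = k" if "y \<langle>$\<rangle> k = k + 1" using that assms by (metis involution_apply)
  have fixes_iff: "?y' \<langle>$\<rangle> k = k \<and> ?y' \<langle>$\<rangle> (k + 1) = k + 1 \<longleftrightarrow> y \<langle>$\<rangle> k = k + 1"
    using assms sw
    by (auto simp: lower_descent descent_def apply_mult apply_simple_transposition split: if_splits)
  show ?thesis
  proof (cases "y \<langle>$\<rangle> k = k + 1")
    case True
    then have "raise k ?y' = simple_transposition k * ?y'"
      using fixes_iff y' by (simp add: raise_ascent)
    then show ?thesis using True assms by (simp add: lower_descent)
  next
    case False
    then have "raise k ?y' = simple_transposition k * ?y' * simple_transposition k"
      using fixes_iff y' by (auto simp: raise_ascent)
    then show ?thesis using False assms by (simp add: lower_descent mult.assoc)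
  qed
qed

lemma raise_greater:
  assumes "y \<in> involutions" "\<not> descent y k"
  shows "bruhat_less y (raise k y)"
proof -
  have "bruhat_le (y) (raise k y)"
  proof -
    have r: "bruhat_le w (raise_right k w)" for w
      using mult_simple_bruhat(2)[of w k] by (auto simp: raise_right_def bruhat_le_def)
    have l: "bruhat_le w (raise_left k w)" for w
      using bruhat_le_inverse[OF r[of "inverse w"]] by (simp add: raise_left_def)
    show ?thesis unfolding raise_def by (rule bruhat_le_trans[OF l r])
  qed
  moreover have "y \<noteq> raise k y" using raise_ascent_descent[OF assms] assms by metis
  ultimately show ?thesis by (rule bruhat_le_neq)
qed

lemma lower_less:
  assumes "y \<in> involutions" "descent y k"
  shows "bruhat_less (lower k y) y"
  using raise_greater[OF lower_involution[OF assms(1)] lower_descent_ascent[OF assms]] raise_lower[OF assms]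
  by simp

section \<open>Covers among involutions\<close>

lemma inv_covers_iff:
  "inv_covers y z \<longleftrightarrow> y \<in> involutions \<and> z \<in> involutions \<and> bruhat_less y z \<and>
     (\<forall>\<sigma>\<in>involutions. bruhat_less y \<sigma> \<longrightarrow> \<not> bruhat_less \<sigma> z)"
proof
  assume cov: "inv_covers y z"
  then have eq: "{y} = {\<sigma> \<in> involutions. bruhat_le y \<sigma> \<and> bruhat_less \<sigma> z}"
    and I: "y \<in> involutions" "z \<in> involutions"
    unfolding inv_covers_def by blast+
  have "y \<in> {\<sigma> \<in> involutions. bruhat_le y \<sigma> \<and> bruhat_less \<sigma> z}"
    unfolding eq[symmetric] by simp
  moreover have "\<not> bruhat_less \<sigma> z" if "\<sigma> \<in> involutions" "bruhat_less y \<sigma>" for \<sigma>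
  proof
    assume "bruhat_less \<sigma> z"
    then have "\<sigma> \<in> {\<sigma> \<in> involutions. bruhat_le y \<sigma> \<and> bruhat_less \<sigma> z}"
      using that by (simp add: bruhat_le_def)
    then have "\<sigma> = y" unfolding eq[symmetric] by simp
    then show False using that(2) by simp
  qed
  ultimately show "y \<in> involutions \<and> z \<in> involutions \<and> bruhat_less y z \<and>
     (\<forall>\<sigma>\<in>involutions. bruhat_less y \<sigma> \<longrightarrow> \<not> bruhat_less \<sigma> z)"
    using I by simp
next
  assume "y \<in> involutions \<and> z \<in> involutions \<and> bruhat_less y z \<and>
     (\<forall>\<sigma>\<in>involutions. bruhat_less y \<sigma> \<longrightarrow> \<not> bruhat_less \<sigma> z)"
  then show "inv_covers y z"
    unfolding inv_covers_def by (intro conjI equalityI subsetI) (auto simp: bruhat_le_def)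
qed

lemma inv_covers_between:
  "inv_covers y z \<Longrightarrow> \<sigma> \<in> involutions \<Longrightarrow> bruhat_less y \<sigma> \<Longrightarrow> bruhat_less \<sigma> z \<Longrightarrow> False"
  by (auto simp: inv_covers_iff)

lemma inv_coversD:
  "inv_covers y z \<Longrightarrow> y \<in> involutions" "inv_covers y z \<Longrightarrow> z \<in> involutions"
  "inv_covers y z \<Longrightarrow> bruhat_less y z"
  by (simp_all add: inv_covers_iff)

text \<open>
  Lowering an involution strictly between \<open>y\<close> and \<open>raise k y\<close> squeezes it onto \<open>y\<close>.
\<close>

lemma inv_covers_raise:
  assumes "y \<in> involutions" "\<not> descent y k"
  shows "inv_covers y (raise k y)"
  unfolding inv_covers_iff
proof (intro conjI ballI impI notI)
  fix \<sigma> assume \<sigma>: "\<sigma> \<in> involutions" "bruhat_less y \<sigma>" "bruhat_less \<sigma> (raise k y)"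
  then have le: "bruhat_le (lower k \<sigma>) y" "bruhat_le y (lower k \<sigma>)"
    using lower_mono[of \<sigma> "raise k y" k] lower_mono[of y \<sigma> k] assms
    by (simp_all add: bruhat_le_def lower_raise lower_ascent)
  then have eq: "lower k \<sigma> = y" 
    by (metis bruhat_le_def bruhat_less_trans bruhat_less_irrefl)
  show False
  proof (cases "descent \<sigma> k")
    case True
    then show False using eq raise_lower[OF \<sigma>(1)] \<sigma>(3) bruhat_less_irrefl by metis
  next
    case False
    then show False using eq lower_ascent[OF \<sigma>(1)] \<sigma>(2) by simp
  qed
qed (use assms in \<open>auto simp: raise_involution raise_greater\<close>)

text \<open>
  The lifting property: \<open>raise k\<close> fixes \<open>z\<close>, so it maps \<open>y < z\<close> to \<open>raise k y \<le> z\<close>.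
\<close>

lemma inv_covers_new_descent:
  assumes "inv_covers y z" "descent z k" "\<not> descent y k"
  shows "z = raise k y"
proof (rule ccontr)
  assume "z \<noteq> raise k y"
  moreover have "bruhat_le (raise k y) z"
    using raise_mono[of y z k] assms inv_coversD[OF assms(1)] by (simp add: raise_descent bruhat_le_def)
  ultimately have "bruhat_less (raise k y) z" by (auto simp: bruhat_le_def)
  then show False
    using inv_covers_between[OF assms(1), of "raise k y"] inv_coversD(1)[OF assms(1)] assms(3)
    by (simp add: raise_involution raise_greater)
qed

text \<open>
  Together with its converse, this identifies the covers of \<open>y\<close> that share the descent \<open>k\<close>
  with the covers of \<open>lower k y\<close> other than \<open>y\<close>. An involution between the lowered ones would be
  raised to one between \<open>y\<close> and \<open>z\<close>, or would put \<open>lower k z\<close> there.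
\<close>

lemma inv_covers_lower:
  assumes cov: "inv_covers y z" and dz: "descent z k" and dy: "descent y k"
  shows "inv_covers (lower k y) (lower k z)" "lower k z \<noteq> y"
proof -
  note I = inv_coversD[OF cov]
  show ne: "lower k z \<noteq> y"
    using lower_descent_ascent[OF I(2) dz] dy by metis
  show "inv_covers (lower k y) (lower k z)"
    unfolding inv_covers_iff
  proof (intro conjI ballI impI notI)
    show "bruhat_less (lower k y) (lower k z)"
    proof (rule bruhat_le_neq)
      show "bruhat_le (lower k y) (lower k z)" using lower_mono I(3) by (simp add: bruhat_le_def)
      show "lower k y \<noteq> lower k z"
        using raise_lower[OF I(1) dy] raise_lower[OF I(2) dz] I(3) by (metis bruhat_less_irrefl)
    qed
  next
    fix \<sigma> assume \<sigma>: "\<sigma> \<in> involutions" "bruhat_less (lower k y) \<sigma>" "bruhat_less \<sigma> (lower k z)"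
    have le: "bruhat_le y (raise k \<sigma>)" "bruhat_le (raise k \<sigma>) z"
      using raise_mono[of "lower k y" \<sigma> k] raise_mono[of \<sigma> "lower k z" k] \<sigma>
      by (simp_all add: bruhat_le_def raise_lower I dy dz)
    show False
    proof (cases "descent \<sigma> k")
      case True
      then have "bruhat_le y \<sigma>" using le(1) \<sigma>(1) by (simp add: raise_descent)
      then have "bruhat_less y (lower k z)" using \<sigma>(3) bruhat_le_less_trans by blast
      then show False
        using inv_covers_between[OF cov lower_involution[OF I(2)]] lower_less[OF I(2) dz] by blast
    next
      case False
      have "raise k \<sigma> \<noteq> y" "raise k \<sigma> \<noteq> z"
        using lower_raise[OF \<sigma>(1) False] \<sigma>(2,3) by (metis bruhat_less_irrefl)+
      then show False
        using inv_covers_between[OF cov raise_involution[OF \<sigma>(1)]] le by (metis bruhat_le_neq)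
    qed
  qed (use I in \<open>auto simp: lower_involution\<close>)
qed

text \<open>
  If \<open>k\<close> were a descent of \<open>v\<close>, then \<open>y\<close> would lie strictly between \<open>lower k y\<close> and \<open>v\<close>.
\<close>

lemma inv_covers_raise_both:
  assumes cov: "inv_covers (lower k y) v" and y: "y \<in> involutions" "descent y k" and ne: "v \<noteq> y"
  shows "\<not> descent v k" "inv_covers y (raise k v)"
proof -
  note I = inv_coversD[OF cov]
  have le: "bruhat_le y (raise k v)"
    using raise_mono[of "lower k y" v k] I(3) by (simp add: bruhat_le_def raise_lower y)
  have nlt: "\<not> bruhat_less y v"
    using inv_covers_between[OF cov y(1) lower_less[OF y]] by blast
  show nd: "\<not> descent v k"
    using le nlt ne by (auto simp: raise_descent I bruhat_le_def)
  show "inv_covers y (raise k v)"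
    unfolding inv_covers_iff
  proof (intro conjI ballI impI notI)
    show "bruhat_less y (raise k v)"
    proof (rule bruhat_le_neq[OF le])
      show "y \<noteq> raise k v" using lower_raise[OF I(2) nd] I(3) by (metis bruhat_less_irrefl)
    qed
  next
    fix \<sigma> assume \<sigma>: "\<sigma> \<in> involutions" "bruhat_less y \<sigma>" "bruhat_less \<sigma> (raise k v)"
    have le: "bruhat_le (lower k y) (lower k \<sigma>)" "bruhat_le (lower k \<sigma>) v"
      using lower_mono[of y \<sigma> k] lower_mono[of \<sigma> "raise k v" k] \<sigma>
      by (simp_all add: bruhat_le_def lower_raise I nd)
    show False
    proof (cases "descent \<sigma> k")
      case False
      then have "bruhat_le \<sigma> v" using le(2) \<sigma>(1) by (simp add: lower_ascent)
      then show False using \<sigma>(2) nlt bruhat_less_le_trans by blast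
    next
      case True
      have "lower k \<sigma> \<noteq> lower k y" "lower k \<sigma> \<noteq> v"
        using raise_lower[OF \<sigma>(1) True] raise_lower[OF y] \<sigma>(2,3) by (metis bruhat_less_irrefl)+
      then show False
        using inv_covers_between[OF cov lower_involution[OF \<sigma>(1)]] le by (metis bruhat_le_neq)
    qed
  qed (use I y in \<open>auto simp: raise_involution\<close>)
qed

section \<open>Involution words\<close>

text \<open>The length of the involution words of \<open>y\<close>; the numerator is a multiple of 4 for involutions.\<close>

definition inv_rank :: "int perm \<Rightarrow> nat" where
  "inv_rank y = (2 * perm_length y + card (affected y)) div 4"

lemma inv_rank_one [simp]: "inv_rank 1 = 0"
  by (simp add: inv_rank_def)

text \<open>
  A conjugation adds 2 to the length and keeps the number of moved points; a multiplication adds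
  1 to the length and moves two new points. Both add 4 to the numerator.
\<close>

lemma inv_rank_raise:
  assumes y: "y \<in> involutions" "\<not> descent y k"
  shows "inv_rank (raise k y) = inv_rank y + 1" "perm_length y < perm_length (raise k y)"
proof -
  let ?s = "simple_transposition k"
  have l1: "perm_length (?s * y) = perm_length y + 1"
    using y by (simp add: perm_length_simple_mult_cases involution_inverse)
  have "inv_rank (raise k y) = inv_rank y + 1 \<and> perm_length y < perm_length (raise k y)"
  proof (cases "y \<langle>$\<rangle> k = k \<and> y \<langle>$\<rangle> (k + 1) = k + 1")
    case True
    have "affected (?s * y) = insert k (insert (k + 1) (affected y))"
    proof (rule set_eqI)
      fix x
      have "y \<langle>$\<rangle> x = k \<longleftrightarrow> x = k" "y \<langle>$\<rangle> x = k + 1 \<longleftrightarrow> x = k + 1"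
        using True y(1) by (metis involution_apply)+
      then show "x \<in> affected (?s * y) \<longleftrightarrow> x \<in> insert k (insert (k + 1) (affected y))"
        using True by (auto simp: in_affected apply_mult apply_simple_transposition)
    qed
    moreover have "k \<notin> affected y" "k + 1 \<notin> affected y" using True by (simp_all add: in_affected)
    ultimately show ?thesis using True y l1 by (simp add: inv_rank_def raise_ascent)
  next
    case False
    then have eq: "raise k y = ?s * y * ?s" using y by (auto simp: raise_ascent)
    have "affected (?s * y * ?s) = apply ?s ` affected y"
    proof (rule set_eqI)
      fix x
      have "x \<in> affected (?s * y * ?s) \<longleftrightarrow> ?s \<langle>$\<rangle> x \<in> affected y"
        by (metis apply_mult in_affected simple_involution)
      also have "\<dots> \<longleftrightarrow> x \<in> apply ?s ` affected y"
        by (metis image_iff simple_involution)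
      finally show "x \<in> affected (?s * y * ?s) \<longleftrightarrow> x \<in> apply ?s ` affected y" .
    qed
    then have "card (affected (?s * y * ?s)) = card (affected y)"
      by (simp add: card_image inj_on_def apply_inj)
    moreover have "perm_length (?s * y * ?s) = perm_length y + 2"
      using raise_ascent_descent[OF y] l1 perm_length_mult_simple_ascent[of "?s * y" k]
        descent_mult_simple[of "?s * y" k] by (simp add: eq)
    ultimately show ?thesis by (simp add: inv_rank_def eq)
  qed
  then show "inv_rank (raise k y) = inv_rank y + 1" "perm_length y < perm_length (raise k y)" by auto
qed

lemma inv_rank_lower:
  assumes "y \<in> involutions" "descent y k"
  shows "inv_rank y = inv_rank (lower k y) + 1" "perm_length (lower k y) < perm_length y"
  using inv_rank_raise[OF lower_involution[OF assms(1)] lower_descent_ascent[OF assms]] raise_lower[OF assms]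
  by simp_all

text \<open>
  Since \<open>t \<circ> 1 \<circ> t = t\<close>, the middle letter of the palindrome may be treated like all others.
\<close>

lemma palindrome_product_eq:
  assumes "set ts \<subseteq> range simple_transposition"
  shows "palindrome_product ts = foldl (\<lambda>z s. demazure (demazure s z) s) 1 ts"
proof (cases ts)
  case (Cons t us)
  then obtain k where t: "t = simple_transposition k" using assms Cons by auto
  have "demazure (demazure t 1) t = t"
    by (simp add: t demazure_simple_left demazure_simple_right raise_left_eq raise_right_def
        descent_mult_simple[of 1 k, simplified] descent_def apply_simple_transposition)
  then show ?thesis by (simp add: Cons)
qed simp

lemma palindrome_product_snoc:
  assumes "set ts \<subseteq> range simple_transposition"
  shows "palindrome_product (ts @ [simple_transposition k]) = raise k (palindrome_product ts)"
  using assms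
  by (simp add: palindrome_product_eq demazure_simple_left demazure_simple_right raise_def)

lemma palindrome_product_involution:
  assumes "set ts \<subseteq> range simple_transposition"
  shows "palindrome_product ts \<in> involutions \<and> inv_rank (palindrome_product ts) \<le> length ts"
  using assms
proof (induction ts rule: rev_induct)
  case (snoc t ts)
  then obtain k where t: "t = simple_transposition k" by auto
  then show ?case
    using snoc inv_rank_raise[of "palindrome_product ts" k]
    by (cases "descent (palindrome_product ts) k")
      (auto simp: palindrome_product_snoc raise_involution raise_descent)
qed simp

lemma word_of_rank_exists:
  assumes "z \<in> involutions"
  shows "\<exists>ts\<in>words_for z. length ts = inv_rank z"
  using assms
proof (induction "perm_length z" arbitrary: z rule: less_induct)
  case less
  show ?case
  proof (cases "z = 1")
    case True
    then show ?thesis by (intro bexI[of _ "[]"]) (auto simp: words_for_def)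
  next
    case False
    then obtain k where k: "descent z k" using descent_exists by blast
    obtain ts where "ts \<in> words_for (lower k z)" "length ts = inv_rank (lower k z)"
      using less inv_rank_lower[OF less.prems k] lower_involution by blast
    then show ?thesis
      using inv_rank_lower[OF less.prems k] raise_lower[OF less.prems k]
      by (intro bexI[of _ "ts @ [simple_transposition k]"])
        (auto simp: words_for_def palindrome_product_snoc)
  qed
qed

lemma involution_words_eq:
  assumes "z \<in> involutions"
  shows "involution_words z = {ts \<in> words_for z. length ts = inv_rank z}"
proof -
  have "inv_rank z \<le> length ts" if "ts \<in> words_for z" for ts
    using that palindrome_product_involution[of ts] by (auto simp: words_for_def)
  moreover obtain us where "us \<in> words_for z" "length us = inv_rank z"
    using word_of_rank_exists[OF assms] by blast
  ultimately have "(\<forall>us\<in>words_for z. length ts \<le> length us) \<longleftrightarrow> length ts = inv_rank z"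
    if "ts \<in> words_for z" for ts
    using that by (metis antisym)
  then show ?thesis unfolding involution_words_def by (intro Collect_cong conj_cong refl)
qed

text \<open>
  In a word of minimal length every letter raises the involution, so the last letter is a descent
  of the product, and the remaining word is a minimal one for the lowered involution.
\<close>

lemma involution_words_step:
  assumes z: "z \<in> involutions" and ne: "z \<noteq> 1"
  shows "involution_words z =
    (\<Union>k\<in>{k. descent z k}. (\<lambda>ts. ts @ [simple_transposition k]) ` involution_words (lower k z))"
proof (intro equalityI subsetI)
  fix ts assume "ts \<in> involution_words z"
  then have ts: "set ts \<subseteq> range simple_transposition" "palindrome_product ts = z" "length ts = inv_rank z"
    using z by (auto simp: involution_words_eq words_for_def)
  have "ts \<noteq> []" using ts(2) ne by auto
  then obtain us t where "ts = us @ [t]" by (metis append_butlast_last_id)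
  with ts(1) obtain k where us: "ts = us @ [simple_transposition k]"
    "set us \<subseteq> range simple_transposition" by auto
  let ?y = "palindrome_product us"
  have zy: "z = raise k ?y" using ts us by (simp add: palindrome_product_snoc)
  have y: "?y \<in> involutions" "inv_rank ?y \<le> length us" using palindrome_product_involution[OF us(2)] by auto
  have nd: "\<not> descent ?y k"
  proof
    assume "descent ?y k"
    then have "z = ?y" using zy y by (simp add: raise_descent)
    then show False using y(2) ts(3) us(1) by simp
  qed
  then have "descent z k" "lower k z = ?y" using zy y by (simp_all add: raise_ascent_descent lower_raise)
  moreover have "us \<in> involution_words ?y"
    using y us ts inv_rank_raise[OF y(1) nd] by (simp add: involution_words_eq words_for_def flip: zy)
  ultimately show "ts \<in> (\<Union>k\<in>{k. descent z k}. (\<lambda>ts. ts @ [simple_transposition k]) ` involution_words (lower k z))"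
    unfolding us(1) by (intro UN_I[of k] imageI) simp_all
next
  fix ts assume "ts \<in> (\<Union>k\<in>{k. descent z k}. (\<lambda>ts. ts @ [simple_transposition k]) ` involution_words (lower k z))"
  then obtain k us where k: "descent z k" "ts = us @ [simple_transposition k]" "us \<in> involution_words (lower k z)"
    by (elim UN_E imageE) simp
  then show "ts \<in> involution_words z"
    using z inv_rank_lower[OF z k(1)] raise_lower[OF z k(1)]
    by (auto simp: involution_words_eq lower_involution words_for_def palindrome_product_snoc)
qed

lemma involution_words_one: "involution_words 1 = {[]}"
  by (auto simp: involution_words_eq words_for_def)

lemma finite_involution_words: "z \<in> involutions \<Longrightarrow> finite (involution_words z)"
proof (induction "perm_length z" arbitrary: z rule: less_induct)
  case less
  show ?case
  proof (cases "z = 1")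
    case False
    show ?thesis
      unfolding involution_words_step[OF less.prems False]
    proof (intro finite_UN_I finite_imageI finite_descents)
      fix k assume "k \<in> {k. descent z k}"
      then show "finite (involution_words (lower k z))"
        using less inv_rank_lower(2)[of z k] lower_involution[of z k] by simp
    qed
  qed (simp add: involution_words_one)
qed

lemma inj_simple_transposition: "simple_transposition k = simple_transposition j \<longleftrightarrow> k = j"
proof
  assume "simple_transposition k = simple_transposition j"
  then have "simple_transposition j \<langle>$\<rangle> k = simple_transposition k \<langle>$\<rangle> k" by simp
  then show "k = j"
    by (cases "k = j"; cases "k = j + 1") (simp_all add: apply_simple_transposition)
qed simp

lemma card_involution_words:
  assumes z: "z \<in> involutions" "z \<noteq> 1"
  shows "card (involution_words z) = (\<Sum>k\<in>{k. descent z k}. card (involution_words (lower k z)))"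
proof -
  have "card (involution_words z) =
      (\<Sum>k\<in>{k. descent z k}. card ((\<lambda>ts. ts @ [simple_transposition k]) ` involution_words (lower k z)))"
    unfolding involution_words_step[OF z]
    by (rule card_UN_disjoint)
      (auto simp: finite_involution_words lower_involution z inj_simple_transposition)
  also have "\<dots> = (\<Sum>k\<in>{k. descent z k}. card (involution_words (lower k z)))"
    by (intro sum.cong refl card_image) (auto intro: inj_onI)
  finally show ?thesis .
qed

section \<open>The shape of an involution cover\<close>

text \<open>
  The conjugation multiplies by the transposition first on the left and then on the right. The
  second multiplication goes up unless the first one has reversed the order of the values at \<open>a\<close>
  and \<open>b\<close>; this is what the conditions on fixed points exclude.
\<close>

lemma bruhat_less_conj_swap:
  assumes u: "u \<in> involutions" and ab: "a < b" "u \<langle>$\<rangle> a < u \<langle>$\<rangle> b"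
    and fx: "u \<langle>$\<rangle> a = a \<Longrightarrow> b < u \<langle>$\<rangle> b" "u \<langle>$\<rangle> b = b \<Longrightarrow> u \<langle>$\<rangle> a < a"
  shows "bruhat_less u (\<langle>a \<leftrightarrow> b\<rangle> * u * \<langle>a \<leftrightarrow> b\<rangle>)"
proof -
  let ?t = "\<langle>a \<leftrightarrow> b\<rangle>"
  have "u \<langle>$\<rangle> a \<noteq> b" "u \<langle>$\<rangle> b \<noteq> a" using ab involution_apply[OF u] by (metis less_asym)+
  then have "(?t * u) \<langle>$\<rangle> a < (?t * u) \<langle>$\<rangle> b"
    using ab fx by (cases "u \<langle>$\<rangle> a = a"; cases "u \<langle>$\<rangle> b = b") (simp_all add: apply_mult apply_swap_if)
  then have "bruhat_less (?t * u) (?t * u * ?t)" by (rule bruhat_less_mult_swap[OF ab(1)])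
  moreover have "bruhat_less u (?t * u)"
  proof -
    have "bruhat_step u (u * ?t)" using ab by (auto simp: bruhat_step_iff)
    from bruhat_step_inverse[OF this] show ?thesis
      using u by (simp add: inverse_mult involution_inverse bruhat_less_step)
  qed
  ultimately show ?thesis by (rule bruhat_less_trans[rotated])
qed

text \<open>
  An involution goes up when a 2-cycle swallows a fixed point to its right, or one to its left, or
  when two 2-cycles, one to the left of the other, merge into a single one.
\<close>

lemma bruhat_less_extend_right:
  assumes u: "u \<in> involutions" and ord: "p < q" "q < c"
    and ua: "u \<langle>$\<rangle> p = q" "u \<langle>$\<rangle> c = c"
    and va: "v \<langle>$\<rangle> p = c" "v \<langle>$\<rangle> c = p" "v \<langle>$\<rangle> q = q"
    and eq: "\<And>x. x \<notin> {p, q, c} \<Longrightarrow> v \<langle>$\<rangle> x = u \<langle>$\<rangle> x"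
  shows "bruhat_less u v"
proof -
  have uq: "u \<langle>$\<rangle> q = p" using ua(1) u by (metis involution_apply)
  have "v = \<langle>q \<leftrightarrow> c\<rangle> * u * \<langle>q \<leftrightarrow> c\<rangle>"
  proof (rule perm_eqI)
    fix x
    show "v \<langle>$\<rangle> x = (\<langle>q \<leftrightarrow> c\<rangle> * u * \<langle>q \<leftrightarrow> c\<rangle>) \<langle>$\<rangle> x"
    proof (cases "x \<in> {p, q, c}")
      case False
      then have "u \<langle>$\<rangle> x \<noteq> q" "u \<langle>$\<rangle> x \<noteq> c"
        using uq ua(2) involution_apply_eq_iff[OF u, of x q] involution_apply_eq_iff[OF u, of x c]
        by auto
      then show ?thesis using False eq[OF False] by (simp add: apply_mult apply_swap_if)
    qed (use ord ua uq va in \<open>auto simp: apply_mult apply_swap_if\<close>)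
  qed
  then show ?thesis using bruhat_less_conj_swap[OF u ord(2)] ord uq ua by simp
qed

lemma bruhat_less_extend_left:
  assumes u: "u \<in> involutions" and ord: "p < c" "c < d"
    and ua: "u \<langle>$\<rangle> p = p" "u \<langle>$\<rangle> c = d"
    and va: "v \<langle>$\<rangle> p = d" "v \<langle>$\<rangle> d = p" "v \<langle>$\<rangle> c = c"
    and eq: "\<And>x. x \<notin> {p, c, d} \<Longrightarrow> v \<langle>$\<rangle> x = u \<langle>$\<rangle> x"
  shows "bruhat_less u v"
proof -
  have ud: "u \<langle>$\<rangle> d = c" using ua(2) u by (metis involution_apply)
  have "v = \<langle>p \<leftrightarrow> c\<rangle> * u * \<langle>p \<leftrightarrow> c\<rangle>"
  proof (rule perm_eqI)
    fix x
    show "v \<langle>$\<rangle> x = (\<langle>p \<leftrightarrow> c\<rangle> * u * \<langle>p \<leftrightarrow> c\<rangle>) \<langle>$\<rangle> x"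
    proof (cases "x \<in> {p, c, d}")
      case False
      then have "u \<langle>$\<rangle> x \<noteq> p" "u \<langle>$\<rangle> x \<noteq> c"
        using ua involution_apply_eq_iff[OF u, of x p] involution_apply_eq_iff[OF u, of x c]
        by auto
      then show ?thesis using False eq[OF False] by (simp add: apply_mult apply_swap_if)
    qed (use ord ua ud va in \<open>auto simp: apply_mult apply_swap_if\<close>)
  qed
  then show ?thesis using bruhat_less_conj_swap[OF u ord(1)] ord ua by simp
qed

text \<open>
  The values at the four positions pass through \<open>qpdc\<close>, \<open>dpqc\<close>, \<open>dqpc\<close>, \<open>dqcp\<close>.
\<close>

lemma bruhat_less_merge:
  assumes u: "u \<in> involutions" and ord: "p < q" "q < c" "c < d"
    and ua: "u \<langle>$\<rangle> p = q" "u \<langle>$\<rangle> c = d"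
    and va: "v \<langle>$\<rangle> p = d" "v \<langle>$\<rangle> d = p" "v \<langle>$\<rangle> q = q" "v \<langle>$\<rangle> c = c"
    and eq: "\<And>x. x \<notin> {p, q, c, d} \<Longrightarrow> v \<langle>$\<rangle> x = u \<langle>$\<rangle> x"
  shows "bruhat_less u v"
proof -
  have uq: "u \<langle>$\<rangle> q = p" "u \<langle>$\<rangle> d = c" using ua u by (metis involution_apply)+
  define u1 where "u1 = u * \<langle>p \<leftrightarrow> c\<rangle>"
  define u2 where "u2 = u1 * \<langle>q \<leftrightarrow> c\<rangle>"
  have v: "v = u2 * \<langle>c \<leftrightarrow> d\<rangle>"
  proof (rule perm_eqI)
    fix x
    show "v \<langle>$\<rangle> x = (u2 * \<langle>c \<leftrightarrow> d\<rangle>) \<langle>$\<rangle> x"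
    proof (cases "x \<in> {p, q, c, d}")
      case False
      then show ?thesis using eq[OF False] by (simp add: u1_def u2_def apply_mult apply_swap_if)
    qed (use ord ua uq va in \<open>auto simp: u1_def u2_def apply_mult apply_swap_if\<close>)
  qed
  have "bruhat_less u u1"
    unfolding u1_def using ord ua by (intro bruhat_less_mult_swap) auto
  moreover have "bruhat_less u1 u2"
    unfolding u2_def using ord ua uq
    by (intro bruhat_less_mult_swap) (auto simp: u1_def apply_mult apply_swap_if)
  moreover have "bruhat_less u2 v"
    unfolding v using ord ua uq
    by (intro bruhat_less_mult_swap) (auto simp: u2_def u1_def apply_mult apply_swap_if)
  ultimately show ?thesis using bruhat_less_trans by blast
qed

definition above :: "int perm \<Rightarrow> int \<Rightarrow> int \<Rightarrow> int set" where
  "above w i j = {x. x \<le> i \<and> j \<le> w \<langle>$\<rangle> x}"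

lemma finite_above [simp]: "finite (above w i j)"
proof -
  have "above w i j \<subseteq> affected w \<union> {j..i}" by (auto simp: above_def in_affected)
  then show ?thesis by (rule finite_subset) simp
qed

text \<open>
  Along a step the larger of two values moves to the left, which cannot remove entries from the
  quadrant counted here. This gives a simple obstruction to Bruhat comparability.
\<close>

lemma card_above_mono:
  assumes "bruhat_less u v"
  shows "card (above u i j) \<le> card (above v i j)"
proof -
  have step: "card (above u i j) \<le> card (above v i j)" if st: "bruhat_step u v" for u v
  proof -
    obtain a b where ab: "a < b" "u \<langle>$\<rangle> a < u \<langle>$\<rangle> b" and v: "v = u * \<langle>a \<leftrightarrow> b\<rangle>"
      using st by (auto simp: bruhat_step_iff)
    show ?thesis
    proof (cases "b \<le> i")
      case True
      have "apply \<langle>a \<leftrightarrow> b\<rangle> ` above u i j \<subseteq> above v i j"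
        using True ab(1) by (auto simp: above_def v apply_mult apply_swap_if)
      then have "card (apply \<langle>a \<leftrightarrow> b\<rangle> ` above u i j) \<le> card (above v i j)"
        by (intro card_mono) auto
      then show ?thesis by (simp add: card_image inj_on_def apply_inj)
    next
      case False
      then have "above u i j \<subseteq> above v i j"
        using ab by (auto simp: above_def v apply_mult apply_swap_if)
      then show ?thesis by (intro card_mono) auto
    qed
  qed
  have "bruhat_step\<^sup>+\<^sup>+ u v" using assms by (simp add: bruhat_less_def)
  then show ?thesis
    by (induction rule: tranclp_induct) (use step in \<open>auto intro: order_trans\<close>)
qed

text \<open>
  How a cover \<open>z\<close> differs from \<open>y\<close>: one cycle of \<open>y\<close> rises and one falls. Naming both by their
  least elements makes \<open>p\<close> and \<open>c\<close> unique.
\<close>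

definition moves :: "int perm \<Rightarrow> int perm \<Rightarrow> int \<Rightarrow> int \<Rightarrow> bool" where
  "moves y z p c \<longleftrightarrow> p \<le> y \<langle>$\<rangle> p \<and> c \<le> y \<langle>$\<rangle> c \<and>
     (\<forall>x. y \<langle>$\<rangle> x < z \<langle>$\<rangle> x \<longleftrightarrow> x = p \<or> x = y \<langle>$\<rangle> p) \<and>
     (\<forall>x. z \<langle>$\<rangle> x < y \<langle>$\<rangle> x \<longleftrightarrow> x = c \<or> x = y \<langle>$\<rangle> c)"

lemma movesI:
  assumes y: "y \<in> involutions"
    and up: "\<And>x. y \<langle>$\<rangle> x < z \<langle>$\<rangle> x \<longleftrightarrow> x = a \<or> x = y \<langle>$\<rangle> a"
    and dn: "\<And>x. z \<langle>$\<rangle> x < y \<langle>$\<rangle> x \<longleftrightarrow> x = b \<or> x = y \<langle>$\<rangle> b"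
  shows "\<exists>p c. moves y z p c"
proof (intro exI)
  show "moves y z (min a (y \<langle>$\<rangle> a)) (min b (y \<langle>$\<rangle> b))"
    using assms by (auto simp: moves_def min_def)
qed

lemma moves_sgn:
  assumes "y \<in> involutions" "moves y z p c"
  shows "sgn (z \<langle>$\<rangle> (y \<langle>$\<rangle> x) - y \<langle>$\<rangle> (y \<langle>$\<rangle> x)) = sgn (z \<langle>$\<rangle> x - y \<langle>$\<rangle> x)"
proof -
  have "y \<langle>$\<rangle> (y \<langle>$\<rangle> x) < z \<langle>$\<rangle> (y \<langle>$\<rangle> x) \<longleftrightarrow> y \<langle>$\<rangle> x < z \<langle>$\<rangle> x"
    "z \<langle>$\<rangle> (y \<langle>$\<rangle> x) < y \<langle>$\<rangle> (y \<langle>$\<rangle> x) \<longleftrightarrow> z \<langle>$\<rangle> x < y \<langle>$\<rangle> x"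
    using assms unfolding moves_def by (metis involution_apply)+
  then show ?thesis by (auto simp: sgn_if)
qed

text \<open>
  Outside the two cycles \<open>z\<close> agrees with \<open>y\<close>, so it permutes their at most four points. The
  inequalities between \<open>z\<close> and \<open>y\<close> leave the six shapes below and two more for a pair of
  2-cycles; those two are not covers.
\<close>

lemma moves_shape:
  assumes cov: "inv_covers y z" and mv: "moves y z p c"
  defines "q \<equiv> y \<langle>$\<rangle> p" and "d \<equiv> y \<langle>$\<rangle> c"
  shows "p = q \<and> c = d \<and> p < c \<and> z \<langle>$\<rangle> p = c \<or>
    p < q \<and> q < c \<and> c = d \<and> z \<langle>$\<rangle> p = c \<and> z \<langle>$\<rangle> q = q \<or>
    p = q \<and> p < c \<and> c < d \<and> z \<langle>$\<rangle> p = d \<and> z \<langle>$\<rangle> c = c \<or>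
    p < q \<and> q < c \<and> c < d \<and> z \<langle>$\<rangle> p = c \<and> z \<langle>$\<rangle> q = d \<or>
    p < q \<and> q < c \<and> c < d \<and> z \<langle>$\<rangle> p = d \<and> z \<langle>$\<rangle> q = q \<and> z \<langle>$\<rangle> c = c \<or>
    p < c \<and> c < q \<and> q < d \<and> z \<langle>$\<rangle> p = d \<and> z \<langle>$\<rangle> q = c"
    and "\<And>x. x \<notin> {p, q, c, d} \<Longrightarrow> z \<langle>$\<rangle> x = y \<langle>$\<rangle> x"
proof -
  note I = inv_coversD[OF cov]
  have le: "p \<le> q" "c \<le> d" using mv by (auto simp: moves_def q_def d_def)
  have yq: "y \<langle>$\<rangle> p = q" "y \<langle>$\<rangle> q = p" "y \<langle>$\<rangle> c = d" "y \<langle>$\<rangle> d = c" using I by (auto simp: q_def d_def)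
  have up: "y \<langle>$\<rangle> x < z \<langle>$\<rangle> x \<longleftrightarrow> x = p \<or> x = q" and dn: "z \<langle>$\<rangle> x < y \<langle>$\<rangle> x \<longleftrightarrow> x = c \<or> x = d" for x
    using mv by (auto simp: moves_def q_def d_def)
  show out: "z \<langle>$\<rangle> x = y \<langle>$\<rangle> x" if "x \<notin> {p, q, c, d}" for x
    using that up[of x] dn[of x] by auto
  have zA: "z \<langle>$\<rangle> x \<in> {p, q, c, d}" if "x \<in> {p, q, c, d}" for x
  proof (rule ccontr)
    assume n: "z \<langle>$\<rangle> x \<notin> {p, q, c, d}"
    then have "x = y \<langle>$\<rangle> (z \<langle>$\<rangle> x)" using out[OF n] I by simp
    then have "z \<langle>$\<rangle> x = y \<langle>$\<rangle> x" using I by (metis involution_apply)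
    then show False using that n yq by auto
  qed
  have disj: "p \<noteq> c" "p \<noteq> d" "q \<noteq> c" "q \<noteq> d"
    using up dn by (metis order_less_asym)+
  have lt: "q < z \<langle>$\<rangle> p" "p < z \<langle>$\<rangle> q" "z \<langle>$\<rangle> c < d" "z \<langle>$\<rangle> d < c"
    using up[of p] up[of q] dn[of c] dn[of d] yq by auto
  have zp: "z \<langle>$\<rangle> p = c \<or> z \<langle>$\<rangle> p = d" using zA[of p] lt(1) le by auto
  have zz: "z \<langle>$\<rangle> (z \<langle>$\<rangle> x) = x" for x using I by simp
  have inj: "z \<langle>$\<rangle> x = z \<langle>$\<rangle> x' \<longleftrightarrow> x = x'" for x x' by (rule apply_inj)
  consider "p = q" "c = d" | "p < q" "c = d" | "p = q" "c < d" | "p < q" "c < d" using le by linarith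
  then show "p = q \<and> c = d \<and> p < c \<and> z \<langle>$\<rangle> p = c \<or>
    p < q \<and> q < c \<and> c = d \<and> z \<langle>$\<rangle> p = c \<and> z \<langle>$\<rangle> q = q \<or>
    p = q \<and> p < c \<and> c < d \<and> z \<langle>$\<rangle> p = d \<and> z \<langle>$\<rangle> c = c \<or>
    p < q \<and> q < c \<and> c < d \<and> z \<langle>$\<rangle> p = c \<and> z \<langle>$\<rangle> q = d \<or>
    p < q \<and> q < c \<and> c < d \<and> z \<langle>$\<rangle> p = d \<and> z \<langle>$\<rangle> q = q \<and> z \<langle>$\<rangle> c = c \<or>
    p < c \<and> c < q \<and> q < d \<and> z \<langle>$\<rangle> p = d \<and> z \<langle>$\<rangle> q = c"
  proof cases
    case 1
    then show ?thesis using zp lt(1) by simp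
  next
    case 2
    then have "z \<langle>$\<rangle> p = c" using zp by simp
    moreover from this have "z \<langle>$\<rangle> q \<noteq> c" using inj[of p q] 2 by simp
    then have "z \<langle>$\<rangle> q = q" using zA[of q] lt(2) 2 by auto
    ultimately show ?thesis using 2 lt(1) by simp
  next
    case 3
    have "z \<langle>$\<rangle> p \<noteq> c"
    proof
      assume "z \<langle>$\<rangle> p = c"
      then have "z \<langle>$\<rangle> c = p" using zz[of p] by simp
      moreover from this have "z \<langle>$\<rangle> d \<noteq> c" "z \<langle>$\<rangle> d \<noteq> p"
        using \<open>z \<langle>$\<rangle> p = c\<close> 3 disj inj[of p d] inj[of c d] by simp_all
      ultimately have "z \<langle>$\<rangle> d = d" using zA[of d] 3 by simp
      then show False using lt(4) 3 by simp
    qed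
    then have "z \<langle>$\<rangle> p = d" using zp by simp
    moreover from this have "z \<langle>$\<rangle> d = p" using zz[of p] by simp
    moreover from calculation have "z \<langle>$\<rangle> c \<noteq> d" "z \<langle>$\<rangle> c \<noteq> p"
      using 3 disj inj[of c p] inj[of c d] by simp_all
    then have "z \<langle>$\<rangle> c = c" using zA[of c] 3 by simp
    ultimately show ?thesis using 3 lt(4) by simp
  next
    case 4
    show ?thesis
    proof (cases "z \<langle>$\<rangle> p = c")
      case True
      then have "z \<langle>$\<rangle> c = p" using zz[of p] by simp
      then have "z \<langle>$\<rangle> d \<noteq> p" "z \<langle>$\<rangle> d \<noteq> c" "z \<langle>$\<rangle> d \<noteq> d"
        using True 4 lt(4) disj inj[of d c] inj[of d p] by simp_all
      then have "z \<langle>$\<rangle> d = q" using zA[of d] by simp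
      moreover from this have "z \<langle>$\<rangle> q = d" using zz[of d] by simp
      ultimately show ?thesis using True 4 lt(1) by simp
    next
      case False
      then have zpd: "z \<langle>$\<rangle> p = d" using zp by simp
      then have zdp: "z \<langle>$\<rangle> d = p" using zz[of p] by simp
      have zq: "z \<langle>$\<rangle> q = q \<or> z \<langle>$\<rangle> q = c"
        
      proof -
        have "z \<langle>$\<rangle> q \<noteq> d" "z \<langle>$\<rangle> q \<noteq> p"
          using inj[of q p] inj[of q d] 4 disj unfolding zpd zdp by simp_all
        then show ?thesis using zA[of q] by simp
      qed
      have qd: "q < d" "p < c" using lt zpd zdp by simp_all
      from zq show ?thesis
      proof
        assume zqq: "z \<langle>$\<rangle> q = q"
        then have zcc: "z \<langle>$\<rangle> c = c"
        proof -
          have "z \<langle>$\<rangle> c \<noteq> d" "z \<langle>$\<rangle> c \<noteq> p" "z \<langle>$\<rangle> c \<noteq> q"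
            using inj[of c p] inj[of c d] inj[of c q] 4 disj unfolding zpd zdp zqq by simp_all
          then show ?thesis using zA[of c] by simp
        qed
        have "q < c"
        proof (rule ccontr)
          \<comment> \<open>If the 2-cycles cross, then \<open>z\<close> has fewer large values than \<open>y\<close> on the integers up to \<open>c\<close>.\<close>
          assume "\<not> q < c"
          then have cq: "c < q" using disj by linarith
          have "above z c q \<subset> above y c q"
          proof (intro psubsetI subsetI)
            fix x assume x: "x \<in> above z c q"
            then have "x \<noteq> c" using zcc cq by (auto simp: above_def)
            then have "x = p \<or> x \<notin> {p, q, c, d}" using x cq qd by (auto simp: above_def)
            then show "x \<in> above y c q" using x yq out[of x] qd by (auto simp: above_def)
          next
            have "c \<in> above y c q" "c \<notin> above z c q" using yq zcc qd cq by (auto simp: above_def)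
            then show "above z c q \<noteq> above y c q" by blast
          qed
          then have "card (above z c q) < card (above y c q)" by (simp add: psubset_card_mono)
          then show False using card_above_mono[OF I(3), of c q] by simp
        qed
        then show ?thesis using 4 zpd zqq zcc by simp
      next
        assume zqc: "z \<langle>$\<rangle> q = c"
        then have zcq: "z \<langle>$\<rangle> c = q" using zz[of q] by simp
        have cq': "c < q"
        proof (rule ccontr)
          \<comment> \<open>If the 2-cycles are disjoint intervals, the crossing pair lies strictly in between.\<close>
          assume "\<not> c < q"
          then have cq: "q < c" using disj by linarith
          let ?t = "\<langle>q \<leftrightarrow> c\<rangle>" and ?r = "\<langle>p \<leftrightarrow> q\<rangle>"
          define \<sigma> where "\<sigma> = ?t * y * ?t"
          have \<sigma>: "\<sigma> \<in> involutions"
          proof (rule involutionI)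
            have "?t \<langle>$\<rangle> (?t \<langle>$\<rangle> x) = x" for x by (simp add: apply_sequence)
            then show "\<sigma> \<langle>$\<rangle> (\<sigma> \<langle>$\<rangle> x) = x" for x using I by (simp add: \<sigma>_def apply_mult)
          qed
          have \<sigma>v: "\<sigma> \<langle>$\<rangle> p = c" "\<sigma> \<langle>$\<rangle> q = d" "\<sigma> \<langle>$\<rangle> c = p" "\<sigma> \<langle>$\<rangle> d = q"
            using cq 4 yq by (auto simp: \<sigma>_def apply_mult apply_swap_if)
          have \<sigma>out: "\<sigma> \<langle>$\<rangle> x = y \<langle>$\<rangle> x" if "x \<notin> {p, q, c, d}" for x
          proof -
            have "y \<langle>$\<rangle> x \<notin> {q, c}"
              using that yq I(1) involution_apply_eq_iff[OF I(1), of x] by auto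
            then show ?thesis using that by (simp add: \<sigma>_def apply_mult apply_swap_if)
          qed
          have "bruhat_less y \<sigma>"
            unfolding \<sigma>_def using cq 4 yq by (intro bruhat_less_conj_swap[OF I(1)]) auto
          moreover have "z = ?r * \<sigma> * ?r"
          proof (rule perm_eqI)
            fix x
            show "z \<langle>$\<rangle> x = (?r * \<sigma> * ?r) \<langle>$\<rangle> x"
            proof (cases "x \<in> {p, q, c, d}")
              case False
              have "y \<langle>$\<rangle> x \<notin> {p, q}"
                using False yq I(1) involution_apply_eq_iff[OF I(1), of x] by auto
              then show ?thesis
                using False out[OF False] \<sigma>out[OF False] by (simp add: apply_mult apply_swap_if)
            qed (use cq 4 \<sigma>v zqc zcq zpd zdp in \<open>auto simp: apply_mult apply_swap_if\<close>)
          qed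
          then have "bruhat_less \<sigma> z"
            using bruhat_less_conj_swap[OF \<sigma>, of p q] cq 4 \<sigma>v by simp
          ultimately show False using inv_covers_between[OF cov \<sigma>] by blast
        qed
        then show ?thesis using 4 zpd zqc qd by simp
      qed
    qed
  qed
qed

text \<open>
  Suppose that \<open>v\<close> fixes \<open>k\<close> and \<open>k + 1\<close>, but \<open>u\<close> fixes only one of them. Conjugation by \<open>s\<^sub>k\<close>
  extends the 2-cycle of \<open>u\<close> at the other point by one step, which gives an involution strictly
  between \<open>u\<close> and \<open>v\<close>.
\<close>

lemma inv_covers_not_fixes_right:
  assumes cov: "inv_covers u v" and mv: "moves u v p c"
    and fix_v: "v \<langle>$\<rangle> k = k" "v \<langle>$\<rangle> (k + 1) = k + 1"
    and fix_u: "u \<langle>$\<rangle> (k + 1) = k + 1" and uk: "u \<langle>$\<rangle> k < k"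
  shows False
proof -
  note I = inv_coversD[OF cov]
  have asc: "\<not> descent u k" using fix_u uk by (simp add: descent_def)
  define y where "y = raise k u"
  have y: "y \<in> involutions" "bruhat_less u y"
    using I asc by (auto simp: y_def raise_involution raise_greater)
  have yx: "y \<langle>$\<rangle> x = simple_transposition k \<langle>$\<rangle> (u \<langle>$\<rangle> (simple_transposition k \<langle>$\<rangle> x))" for x
    using uk by (simp add: y_def raise_ascent_apply[OF I(1) asc])
  have "k = p \<or> k = u \<langle>$\<rangle> p" "p \<le> u \<langle>$\<rangle> p"
    using mv uk fix_v(1) unfolding moves_def by auto
  then have kp: "u \<langle>$\<rangle> p = k" "u \<langle>$\<rangle> k = p" using uk I(1) by (auto simp: involution_apply_eq_iff)
  have out: "v \<langle>$\<rangle> x = u \<langle>$\<rangle> x" if "x \<notin> {p, k, c, u \<langle>$\<rangle> c}" for x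
    using moves_shape(2)[OF cov mv, of x] that kp by simp
  have ck: "c \<noteq> k + 1" using mv fix_u fix_v unfolding moves_def by (metis less_irrefl)
  have vv: "v \<langle>$\<rangle> x' = x" if "v \<langle>$\<rangle> x = x'" for x x' using that I(2) by auto
  have uu: "u \<langle>$\<rangle> (u \<langle>$\<rangle> c) = c" using I(1) by simp
  have ux: "u \<langle>$\<rangle> x \<notin> {k, k + 1}" if "x \<notin> {p, k + 1}" for x
    using that kp fix_u involution_apply_eq_iff[OF I(1), of x] by auto
  have "p < k \<and> k < c \<and> u \<langle>$\<rangle> c = c \<and> v \<langle>$\<rangle> p = c \<or>
      p < k \<and> k < c \<and> c < u \<langle>$\<rangle> c \<and> v \<langle>$\<rangle> p = u \<langle>$\<rangle> c \<and> v \<langle>$\<rangle> c = c"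
    using moves_shape(1)[OF cov mv] fix_v uk unfolding kp by auto
  then have "bruhat_less y v"
  proof (elim disjE conjE)
    assume a: "p < k" "k < c" "u \<langle>$\<rangle> c = c" "v \<langle>$\<rangle> p = c"
    show ?thesis
    proof (rule bruhat_less_extend_right[OF y(1), of p "k + 1" c])
      fix x assume "x \<notin> {p, k + 1, c}"
      then show "v \<langle>$\<rangle> x = y \<langle>$\<rangle> x"
        using out[of x] ux[of x] a fix_u fix_v
        by (cases "x = k") (auto simp: yx apply_simple_transposition)
    qed (use a ck kp fix_v fix_u vv[OF a(4)] in \<open>auto simp: yx apply_simple_transposition\<close>)
  next
    assume a: "p < k" "k < c" "c < u \<langle>$\<rangle> c" "v \<langle>$\<rangle> p = u \<langle>$\<rangle> c" "v \<langle>$\<rangle> c = c"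
    show ?thesis
    proof (rule bruhat_less_merge[OF y(1), of p "k + 1" c "u \<langle>$\<rangle> c"])
      fix x assume "x \<notin> {p, k + 1, c, u \<langle>$\<rangle> c}"
      then show "v \<langle>$\<rangle> x = y \<langle>$\<rangle> x"
        using out[of x] ux[of x] a fix_u fix_v
        by (cases "x = k") (auto simp: yx apply_simple_transposition)
    qed (use a ck kp fix_v fix_u vv[OF a(4)] uu in \<open>auto simp: yx apply_simple_transposition\<close>)
  qed
  then show False using inv_covers_between[OF cov y] by blast
qed

lemma inv_covers_not_fixes_left:
  assumes cov: "inv_covers u v" and mv: "moves u v p c"
    and fix_v: "v \<langle>$\<rangle> k = k" "v \<langle>$\<rangle> (k + 1) = k + 1"
    and fix_u: "u \<langle>$\<rangle> k = k" and uk: "k + 1 < u \<langle>$\<rangle> (k + 1)"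
  shows False
proof -
  note I = inv_coversD[OF cov]
  have asc: "\<not> descent u k" using fix_u uk by (simp add: descent_def)
  define y where "y = raise k u"
  have y: "y \<in> involutions" "bruhat_less u y"
    using I asc by (auto simp: y_def raise_involution raise_greater)
  have yx: "y \<langle>$\<rangle> x = simple_transposition k \<langle>$\<rangle> (u \<langle>$\<rangle> (simple_transposition k \<langle>$\<rangle> x))" for x
    using uk by (simp add: y_def raise_ascent_apply[OF I(1) asc])
  have "k + 1 = c \<or> k + 1 = u \<langle>$\<rangle> c" "c \<le> u \<langle>$\<rangle> c"
    using mv uk fix_v(2) unfolding moves_def by auto
  then have kc: "c = k + 1" using uk I(1) by (auto simp: involution_apply_eq_iff)
  define d where "d = u \<langle>$\<rangle> (k + 1)"
  have ud: "u \<langle>$\<rangle> d = k + 1" "k + 1 < d" using I(1) uk by (simp_all add: d_def)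
  have out: "v \<langle>$\<rangle> x = u \<langle>$\<rangle> x" if "x \<notin> {p, u \<langle>$\<rangle> p, k + 1, d}" for x
    using moves_shape(2)[OF cov mv, of x] that kc by (simp add: d_def)
  have pk: "p \<noteq> k" "u \<langle>$\<rangle> p \<noteq> k" using mv fix_u fix_v unfolding moves_def by (metis less_irrefl)+
  have vv: "v \<langle>$\<rangle> x' = x" if "v \<langle>$\<rangle> x = x'" for x x' using that I(2) by auto
  have ux: "u \<langle>$\<rangle> x \<notin> {k, k + 1}" if "x \<notin> {k, d}" for x
    using that fix_u involution_apply_eq_iff[OF I(1), of x k]
      involution_apply_eq_iff[OF I(1), of x "k + 1"] by (auto simp: d_def)
  have "u \<langle>$\<rangle> p = p \<and> p < k + 1 \<and> v \<langle>$\<rangle> p = d \<or>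
      p < u \<langle>$\<rangle> p \<and> u \<langle>$\<rangle> p < k + 1 \<and> v \<langle>$\<rangle> p = d \<and> v \<langle>$\<rangle> (u \<langle>$\<rangle> p) = u \<langle>$\<rangle> p"
    using moves_shape(1)[OF cov mv] fix_v uk vv[of p "k + 1"] vv[of "u \<langle>$\<rangle> p" "k + 1"]
    unfolding kc d_def[symmetric] by auto
  then have "bruhat_less y v"
  proof (elim disjE conjE)
    assume a: "u \<langle>$\<rangle> p = p" "p < k + 1" "v \<langle>$\<rangle> p = d"
    show ?thesis
    proof (rule bruhat_less_extend_left[OF y(1), of p k d])
      fix x assume "x \<notin> {p, k, d}"
      then show "v \<langle>$\<rangle> x = y \<langle>$\<rangle> x"
        using out[of x] ux[of x] a fix_u fix_v
        by (cases "x = k + 1") (auto simp: yx apply_simple_transposition)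
    qed (use a pk ud fix_v fix_u vv[OF a(3)] in \<open>auto simp: yx apply_simple_transposition d_def\<close>)
  next
    assume a: "p < u \<langle>$\<rangle> p" "u \<langle>$\<rangle> p < k + 1" "v \<langle>$\<rangle> p = d" "v \<langle>$\<rangle> (u \<langle>$\<rangle> p) = u \<langle>$\<rangle> p"
    show ?thesis
    proof (rule bruhat_less_merge[OF y(1), of p "u \<langle>$\<rangle> p" k d])
      fix x assume "x \<notin> {p, u \<langle>$\<rangle> p, k, d}"
      then show "v \<langle>$\<rangle> x = y \<langle>$\<rangle> x"
        using out[of x] ux[of x] a fix_u fix_v
        by (cases "x = k + 1") (auto simp: yx apply_simple_transposition)
    qed (use a pk ud fix_v fix_u vv[OF a(3)] in \<open>auto simp: yx apply_simple_transposition d_def\<close>)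
  qed
  then show False using inv_covers_between[OF cov y] by blast
qed

lemma sgn_diff_simple_transposition:
  assumes "\<not> (a = k \<and> b = k + 1)" "\<not> (a = k + 1 \<and> b = k)"
  shows "sgn (simple_transposition k \<langle>$\<rangle> a - simple_transposition k \<langle>$\<rangle> b) = sgn (a - b)"
  using simple_transposition_less_iff[of a k b] simple_transposition_less_iff[of b k a] assms
  by (auto simp: sgn_if)

text \<open>
  When both involutions are conjugated, the points are renamed by \<open>s\<^sub>k\<close>, and so are the values,
  whose comparison could only be affected if they were \<open>k\<close> and \<open>k + 1\<close>. If \<open>v\<close> fixes these two points,
  it is multiplied instead; this is harmless as \<open>u\<close> then moves both of them.
\<close>

lemma sgn_raise_conj:
  assumes cov: "inv_covers u v" and mv: "moves u v p c"
    and asc: "\<not> descent u k" "\<not> descent v k"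
    and nf: "\<not> (u \<langle>$\<rangle> k = k \<and> u \<langle>$\<rangle> (k + 1) = k + 1)"
  shows "sgn (raise k v \<langle>$\<rangle> x - raise k u \<langle>$\<rangle> x) =
    sgn (v \<langle>$\<rangle> (simple_transposition k \<langle>$\<rangle> x) - u \<langle>$\<rangle> (simple_transposition k \<langle>$\<rangle> x))"
proof -
  let ?s = "simple_transposition k"
  note I = inv_coversD[OF cov]
  define w where "w = ?s \<langle>$\<rangle> x"
  have ltu: "u \<langle>$\<rangle> k < u \<langle>$\<rangle> (k + 1)" and ltv: "v \<langle>$\<rangle> k < v \<langle>$\<rangle> (k + 1)"
    using asc by (simp_all add: not_descent_iff)
  have ru: "raise k u \<langle>$\<rangle> x = ?s \<langle>$\<rangle> (u \<langle>$\<rangle> w)"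
    using nf by (auto simp: raise_ascent_apply[OF I(1) asc(1)] w_def)
  note sg = moves_sgn[OF I(1) mv]
  show ?thesis
  proof (cases "v \<langle>$\<rangle> k = k \<and> v \<langle>$\<rangle> (k + 1) = k + 1")
    case False
    then have rv: "raise k v \<langle>$\<rangle> x = ?s \<langle>$\<rangle> (v \<langle>$\<rangle> w)"
      by (auto simp: raise_ascent_apply[OF I(2) asc(2)] w_def)
    \<comment> \<open>If \<open>u\<close> and \<open>v\<close> take the values \<open>k\<close> and \<open>k + 1\<close> at the same place, the constancy of the
      signs on the cycles of \<open>u\<close> contradicts the ascent of \<open>v\<close>.\<close>
    have "\<not> (v \<langle>$\<rangle> w = k + 1 \<and> u \<langle>$\<rangle> w = k)"
    proof (intro notI, elim conjE)
      assume a: "v \<langle>$\<rangle> w = k + 1" "u \<langle>$\<rangle> w = k"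
      then have "u \<langle>$\<rangle> k = w" "v \<langle>$\<rangle> (k + 1) = w" using I by (auto simp: involution_apply_eq_iff)
      then show False using sg[of w] a ltv by simp
    qed
    moreover have "\<not> (v \<langle>$\<rangle> w = k \<and> u \<langle>$\<rangle> w = k + 1)"
    proof (intro notI, elim conjE)
      assume a: "v \<langle>$\<rangle> w = k" "u \<langle>$\<rangle> w = k + 1"
      then have "u \<langle>$\<rangle> (k + 1) = w" "v \<langle>$\<rangle> k = w" using I by (auto simp: involution_apply_eq_iff)
      then show False using sg[of w] a ltv by simp
    qed
    ultimately show ?thesis
      unfolding ru rv w_def[symmetric] by (intro sgn_diff_simple_transposition) auto
  next
    case True
    then have rv: "raise k v \<langle>$\<rangle> x = ?s \<langle>$\<rangle> (v \<langle>$\<rangle> x)"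
      by (simp add: raise_ascent_apply[OF I(2) asc(2)])
    have nl: "u \<langle>$\<rangle> k \<noteq> k"
    proof
      assume "u \<langle>$\<rangle> k = k"
      then show False
        using inv_covers_not_fixes_left[OF cov mv] True ltu nf by force
    qed
    have nr: "u \<langle>$\<rangle> (k + 1) \<noteq> k + 1"
    proof
      assume "u \<langle>$\<rangle> (k + 1) = k + 1"
      then show False
        using inv_covers_not_fixes_right[OF cov mv] True ltu nf by force
    qed
    have sw: "u \<langle>$\<rangle> (k + 1) = k" if "u \<langle>$\<rangle> k = k + 1" using that I(1) by (metis involution_apply)
    have sw': "u \<langle>$\<rangle> k = k + 1" if "u \<langle>$\<rangle> (k + 1) = k" using that I(1) by (metis involution_apply)
    consider "x = k" | "x = k + 1" | "x \<noteq> k" "x \<noteq> k + 1" by blast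
    then show ?thesis
    proof cases
      case 1
      then show ?thesis
        using True nr sw' ltu unfolding ru rv w_def
        by (cases "u \<langle>$\<rangle> (k + 1) = k") (simp_all add: apply_simple_transposition)
    next
      case 2
      then show ?thesis
        using True nl sw ltu unfolding ru rv w_def
        by (cases "u \<langle>$\<rangle> k = k + 1") (simp_all add: apply_simple_transposition)
    next
      case 3
      then have w: "w = x" by (simp add: w_def apply_simple_transposition)
      have "v \<langle>$\<rangle> x \<noteq> k" "v \<langle>$\<rangle> x \<noteq> k + 1" using 3 True I(2) by (metis involution_apply)+
      then have "sgn (?s \<langle>$\<rangle> (v \<langle>$\<rangle> x) - ?s \<langle>$\<rangle> (u \<langle>$\<rangle> x)) = sgn (v \<langle>$\<rangle> x - u \<langle>$\<rangle> x)"
        by (intro sgn_diff_simple_transposition) auto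
      then show ?thesis by (simp add: ru rv w flip: w_def)
    qed
  qed
qed

text \<open>
  Both points are cycles of \<open>u\<close>. If neither were fixed by \<open>v\<close>, they would be the two moving
  cycles, and \<open>v\<close> would exchange them, against the ascent at \<open>k\<close>.
\<close>

lemma fixed_pair_moves_one:
  assumes cov: "inv_covers u v" and mv: "moves u v p c" and asc: "\<not> descent v k"
    and fx: "u \<langle>$\<rangle> k = k" "u \<langle>$\<rangle> (k + 1) = k + 1" and nf: "\<not> (v \<langle>$\<rangle> k = k \<and> v \<langle>$\<rangle> (k + 1) = k + 1)"
  shows "v \<langle>$\<rangle> k = k \<and> k + 1 < v \<langle>$\<rangle> (k + 1) \<or> v \<langle>$\<rangle> (k + 1) = k + 1 \<and> v \<langle>$\<rangle> k < k"
proof -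
  have lt: "v \<langle>$\<rangle> k < v \<langle>$\<rangle> (k + 1)" using asc by (simp add: not_descent_iff)
  have "v \<langle>$\<rangle> k = k \<or> v \<langle>$\<rangle> (k + 1) = k + 1"
  proof (rule ccontr)
    assume n: "\<not> ?thesis"
    then have "u \<langle>$\<rangle> k < v \<langle>$\<rangle> k \<or> v \<langle>$\<rangle> k < u \<langle>$\<rangle> k"
      "u \<langle>$\<rangle> (k + 1) < v \<langle>$\<rangle> (k + 1) \<or> v \<langle>$\<rangle> (k + 1) < u \<langle>$\<rangle> (k + 1)" using fx by auto
    then have "k \<in> {p, u \<langle>$\<rangle> p, c, u \<langle>$\<rangle> c}" "k + 1 \<in> {p, u \<langle>$\<rangle> p, c, u \<langle>$\<rangle> c}"
      using mv unfolding moves_def by auto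
    then have "k \<in> {p, c}" "k + 1 \<in> {p, c}"
      using fx inv_coversD(1)[OF cov] by (auto simp: involution_apply_eq_iff dest: sym)
    then have "p = k \<and> c = k + 1 \<or> p = k + 1 \<and> c = k" by auto
    then show False
    proof
      assume a: "p = k \<and> c = k + 1"
      then have "v \<langle>$\<rangle> k = k + 1" using moves_shape(1)[OF cov mv] fx by auto
      moreover from this have "v \<langle>$\<rangle> (k + 1) = k" using inv_coversD(2)[OF cov] by (metis involution_apply)
      ultimately show False using lt by simp
    next
      assume a: "p = k + 1 \<and> c = k"
      then show False using moves_shape(1)[OF cov mv] fx by auto
    qed
  qed
  then show ?thesis using lt nf by auto
qed

text \<open>
  Raising \<open>u\<close> joins the fixed points \<open>k\<close> and \<open>k + 1\<close> into one cycle. At most one of them moves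
  from \<open>u\<close> to \<open>v\<close>, and the new cycle moves in the same direction.
\<close>

lemma sgn_raise_fixed:
  assumes cov: "inv_covers u v" and mv: "moves u v p c"
    and asc: "\<not> descent u k" "\<not> descent v k"
    and fx: "u \<langle>$\<rangle> k = k" "u \<langle>$\<rangle> (k + 1) = k + 1"
  shows "sgn (raise k v \<langle>$\<rangle> x - raise k u \<langle>$\<rangle> x) =
    (if x = k \<or> x = k + 1 then sgn (v \<langle>$\<rangle> k - u \<langle>$\<rangle> k) + sgn (v \<langle>$\<rangle> (k + 1) - u \<langle>$\<rangle> (k + 1))
     else sgn (v \<langle>$\<rangle> x - u \<langle>$\<rangle> x))"
proof -
  let ?s = "simple_transposition k"
  note I = inv_coversD[OF cov]
  have ru: "raise k u \<langle>$\<rangle> x = ?s \<langle>$\<rangle> (u \<langle>$\<rangle> x)"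
    using fx by (simp add: raise_ascent_apply[OF I(1) asc(1)])
  have ux: "u \<langle>$\<rangle> x \<noteq> k \<and> u \<langle>$\<rangle> x \<noteq> k + 1" if "x \<noteq> k" "x \<noteq> k + 1"
    using that fx I(1) by (metis involution_apply)
  show ?thesis
  proof (cases "v \<langle>$\<rangle> k = k \<and> v \<langle>$\<rangle> (k + 1) = k + 1")
    case True
    then have rv: "raise k v \<langle>$\<rangle> x = ?s \<langle>$\<rangle> (v \<langle>$\<rangle> x)"
      by (simp add: raise_ascent_apply[OF I(2) asc(2)])
    show ?thesis
    proof (cases "x = k \<or> x = k + 1")
      case False
      then have "sgn (?s \<langle>$\<rangle> (v \<langle>$\<rangle> x) - ?s \<langle>$\<rangle> (u \<langle>$\<rangle> x)) = sgn (v \<langle>$\<rangle> x - u \<langle>$\<rangle> x)"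
        using ux by (intro sgn_diff_simple_transposition) auto
      then show ?thesis using False by (simp add: ru rv)
    qed (use True fx in \<open>auto simp: ru rv\<close>)
  next
    case False
    then have rv: "raise k v \<langle>$\<rangle> x = ?s \<langle>$\<rangle> (v \<langle>$\<rangle> (?s \<langle>$\<rangle> x))"
      by (auto simp: raise_ascent_apply[OF I(2) asc(2)])
    show ?thesis
    proof (cases "x = k \<or> x = k + 1")
      case False
      then have "sgn (?s \<langle>$\<rangle> (v \<langle>$\<rangle> x) - ?s \<langle>$\<rangle> (u \<langle>$\<rangle> x)) = sgn (v \<langle>$\<rangle> x - u \<langle>$\<rangle> x)"
        using ux by (intro sgn_diff_simple_transposition) auto
      moreover have "?s \<langle>$\<rangle> x = x" using False by (simp add: apply_simple_transposition)
      ultimately show ?thesis using False by (simp add: ru rv)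
    next
      case True
      from fixed_pair_moves_one[OF cov mv asc(2) fx False] show ?thesis
      proof (elim disjE conjE)
        assume a: "v \<langle>$\<rangle> k = k" "k + 1 < v \<langle>$\<rangle> (k + 1)"
        then show ?thesis using True fx by (auto simp: ru rv apply_simple_transposition)
      next
        assume a: "v \<langle>$\<rangle> (k + 1) = k + 1" "v \<langle>$\<rangle> k < k"
        then show ?thesis using True fx by (auto simp: ru rv apply_simple_transposition)
      qed
    qed
  qed
qed

text \<open>
  A conjugation and a multiplication both increase the value at \<open>k\<close> and decrease the one at \<open>k + 1\<close>;
  the values on the rest of the two cycles follow suit, as the graph of an involution is symmetric.
\<close>

lemma raise_sgn:
  assumes y: "y \<in> involutions" "\<not> descent y k"
  shows "sgn (raise k y \<langle>$\<rangle> x - y \<langle>$\<rangle> x) =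
    of_bool (k = x \<or> k = y \<langle>$\<rangle> x) - of_bool (k + 1 = x \<or> k + 1 = y \<langle>$\<rangle> x)"
proof -
  let ?s = "simple_transposition k"
  have lt: "y \<langle>$\<rangle> k < y \<langle>$\<rangle> (k + 1)" using y by (simp add: not_descent_iff)
  have ne: "y \<langle>$\<rangle> k \<noteq> k + 1" "y \<langle>$\<rangle> (k + 1) \<noteq> k"
    using lt involution_apply[OF y(1), of k] involution_apply[OF y(1), of "k + 1"] by auto
  show ?thesis
  proof (cases "y \<langle>$\<rangle> k = k \<and> y \<langle>$\<rangle> (k + 1) = k + 1")
    case True
    then have "y \<langle>$\<rangle> x = k \<longleftrightarrow> x = k" "y \<langle>$\<rangle> x = k + 1 \<longleftrightarrow> x = k + 1"
      using y(1) by (metis involution_apply)+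
    then show ?thesis using True y by (auto simp: raise_ascent_apply apply_simple_transposition)
  next
    case False
    then have r: "raise k y \<langle>$\<rangle> x = ?s \<langle>$\<rangle> (y \<langle>$\<rangle> (?s \<langle>$\<rangle> x))"
      using y by (auto simp: raise_ascent_apply)
    consider "x = k" | "x = k + 1" | "x \<noteq> k" "x \<noteq> k + 1" by blast
    then show ?thesis
    proof cases
      case 1
      have "?s \<langle>$\<rangle> (y \<langle>$\<rangle> (k + 1)) > y \<langle>$\<rangle> k"
        using lt False ne by (auto simp: apply_simple_transposition)
      then show ?thesis using 1 ne unfolding r by (simp add: apply_simple_transposition)
    next
      case 2
      have "?s \<langle>$\<rangle> (y \<langle>$\<rangle> k) < y \<langle>$\<rangle> (k + 1)"
        using lt False ne by (auto simp: apply_simple_transposition)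
      then show ?thesis using 2 ne unfolding r by (simp add: apply_simple_transposition)
    next
      case 3
      then show ?thesis unfolding r by (auto simp: apply_simple_transposition)
    qed
  qed
qed

text \<open>
  By induction along a descent of \<open>z\<close>: either \<open>z\<close> is \<open>raise k y\<close>, where the cycle of \<open>k\<close> goes up
  and that of \<open>k + 1\<close> goes down, or the property is transported from the lowered cover.
\<close>

lemma inv_covers_moves:
  assumes "inv_covers y z"
  shows "\<exists>p c. moves y z p c"
  using assms
proof (induction "perm_length z" arbitrary: y z rule: less_induct)
  case less
  note I = inv_coversD[OF less.prems]
  have "z \<noteq> 1" using bruhat_less_length[OF I(3)] by auto
  then obtain k where dz: "descent z k" using descent_exists by blast
  let ?s = "simple_transposition k"
  have iff: "y \<langle>$\<rangle> x < z \<langle>$\<rangle> x \<longleftrightarrow> sgn (z \<langle>$\<rangle> x - y \<langle>$\<rangle> x) = 1"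
    "z \<langle>$\<rangle> x < y \<langle>$\<rangle> x \<longleftrightarrow> sgn (z \<langle>$\<rangle> x - y \<langle>$\<rangle> x) = - 1"
    for x :: int and y z :: "int perm"
    by (auto simp: sgn_if)
  show ?case
  proof (cases "descent y k")
    case False
    then have z: "z = raise k y" using inv_covers_new_descent[OF less.prems dz] by simp
    have "y \<langle>$\<rangle> k < y \<langle>$\<rangle> (k + 1)" using False by (simp add: not_descent_iff)
    then have ne: "y \<langle>$\<rangle> k \<noteq> k + 1" "y \<langle>$\<rangle> (k + 1) \<noteq> k"
      using involution_apply[OF I(1), of k] involution_apply[OF I(1), of "k + 1"] by auto
    have eqs: "k = y \<langle>$\<rangle> x \<longleftrightarrow> x = y \<langle>$\<rangle> k" "k + 1 = y \<langle>$\<rangle> x \<longleftrightarrow> x = y \<langle>$\<rangle> (k + 1)" for x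
      using involution_apply[OF I(1)] by metis+
    show ?thesis
    proof (rule movesI[OF I(1), where a = k and b = "k + 1"])
      show "y \<langle>$\<rangle> x < z \<langle>$\<rangle> x \<longleftrightarrow> x = k \<or> x = y \<langle>$\<rangle> k" for x
        unfolding iff(1) z raise_sgn[OF I(1) False] eqs using ne apply_inj[of y k "k + 1"] by auto
      show "z \<langle>$\<rangle> x < y \<langle>$\<rangle> x \<longleftrightarrow> x = k + 1 \<or> x = y \<langle>$\<rangle> (k + 1)" for x
        unfolding iff(2) z raise_sgn[OF I(1) False] eqs using ne apply_inj[of y k "k + 1"] by auto
    qed
  next
    case dy: True
    define u v where "u = lower k y" and "v = lower k z"
    have cov: "inv_covers u v" using inv_covers_lower[OF less.prems dz dy] by (simp add: u_def v_def)
    have asc: "\<not> descent u k" "\<not> descent v k"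
      using I dy dz by (simp_all add: u_def v_def lower_descent_ascent)
    have r: "raise k u = y" "raise k v = z" using I dy dz by (simp_all add: u_def v_def raise_lower)
    obtain p c where mv: "moves u v p c"
      using less.hyps[OF _ cov] inv_rank_lower(2)[OF I(2) dz] by (auto simp: v_def)
    have mvx: "u \<langle>$\<rangle> x < v \<langle>$\<rangle> x \<longleftrightarrow> x = p \<or> x = u \<langle>$\<rangle> p" "v \<langle>$\<rangle> x < u \<langle>$\<rangle> x \<longleftrightarrow> x = c \<or> x = u \<langle>$\<rangle> c" for x
      using mv by (auto simp: moves_def)
    note Iu = inv_coversD[OF cov]
    show ?thesis
    proof (cases "u \<langle>$\<rangle> k = k \<and> u \<langle>$\<rangle> (k + 1) = k + 1")
      case False
      have yx: "y \<langle>$\<rangle> (?s \<langle>$\<rangle> x) = ?s \<langle>$\<rangle> (u \<langle>$\<rangle> x)" for x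
        using raise_ascent_apply[OF Iu(1) asc(1), of "?s \<langle>$\<rangle> x"] False unfolding r by auto
      have s: "?s \<langle>$\<rangle> x = w \<longleftrightarrow> x = ?s \<langle>$\<rangle> w" for x w by (metis simple_involution)
      have sg: "sgn (z \<langle>$\<rangle> x - y \<langle>$\<rangle> x) = sgn (v \<langle>$\<rangle> (?s \<langle>$\<rangle> x) - u \<langle>$\<rangle> (?s \<langle>$\<rangle> x))" for x
        using sgn_raise_conj[OF cov mv asc False, of x] unfolding r .
      show ?thesis
      proof (rule movesI[OF I(1), where a = "?s \<langle>$\<rangle> p" and b = "?s \<langle>$\<rangle> c"])
        show "y \<langle>$\<rangle> x < z \<langle>$\<rangle> x \<longleftrightarrow> x = ?s \<langle>$\<rangle> p \<or> x = y \<langle>$\<rangle> (?s \<langle>$\<rangle> p)" for x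
          unfolding iff(1) sg yx unfolding iff(1)[symmetric] mvx s by (rule refl)
        show "z \<langle>$\<rangle> x < y \<langle>$\<rangle> x \<longleftrightarrow> x = ?s \<langle>$\<rangle> c \<or> x = y \<langle>$\<rangle> (?s \<langle>$\<rangle> c)" for x
          unfolding iff(2) sg yx unfolding iff(2)[symmetric] mvx s by (rule refl)
      qed
    next
      case True
      then have fx: "u \<langle>$\<rangle> k = k" "u \<langle>$\<rangle> (k + 1) = k + 1" by auto
      have yx: "y \<langle>$\<rangle> x = ?s \<langle>$\<rangle> (u \<langle>$\<rangle> x)" for x
        using raise_ascent_apply[OF Iu(1) asc(1), of x] True unfolding r by auto
      have sg: "sgn (z \<langle>$\<rangle> x - y \<langle>$\<rangle> x) =
        (if x = k \<or> x = k + 1 then sgn (v \<langle>$\<rangle> k - u \<langle>$\<rangle> k) + sgn (v \<langle>$\<rangle> (k + 1) - u \<langle>$\<rangle> (k + 1))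
         else sgn (v \<langle>$\<rangle> x - u \<langle>$\<rangle> x))" for x
        using sgn_raise_fixed[OF cov mv asc fx, of x] unfolding r .
      have one: "v \<langle>$\<rangle> k = k \<or> v \<langle>$\<rangle> (k + 1) = k + 1"
        using fixed_pair_moves_one[OF cov mv asc(2) fx] by blast
      have iff_k: "sgn (v \<langle>$\<rangle> k - u \<langle>$\<rangle> k) + sgn (v \<langle>$\<rangle> (k + 1) - u \<langle>$\<rangle> (k + 1)) = e \<longleftrightarrow>
          sgn (v \<langle>$\<rangle> k - u \<langle>$\<rangle> k) = e \<or> sgn (v \<langle>$\<rangle> (k + 1) - u \<langle>$\<rangle> (k + 1)) = e" if "e \<noteq> 0" for e
        using one fx that by auto
      have uin: "u \<langle>$\<rangle> w = k \<longleftrightarrow> w = k" "u \<langle>$\<rangle> w = k + 1 \<longleftrightarrow> w = k + 1" for w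
        using fx Iu(1) by (metis involution_apply)+
      have cyc: "(if x = k \<or> x = k + 1 then (k = w \<or> k = u \<langle>$\<rangle> w) \<or> (k + 1 = w \<or> k + 1 = u \<langle>$\<rangle> w)
          else x = w \<or> x = u \<langle>$\<rangle> w) \<longleftrightarrow> x = w \<or> x = y \<langle>$\<rangle> w" for x w
        using uin[of w] fx unfolding yx
        by (cases "w = k \<or> w = k + 1") (auto simp: apply_simple_transposition)
      show ?thesis
      proof (rule movesI[OF I(1), where a = p and b = c])
        show "y \<langle>$\<rangle> x < z \<langle>$\<rangle> x \<longleftrightarrow> x = p \<or> x = y \<langle>$\<rangle> p" for x
          unfolding cyc[symmetric] mvx(1)[symmetric] iff(1) sg by (simp add: iff_k)
        show "z \<langle>$\<rangle> x < y \<langle>$\<rangle> x \<longleftrightarrow> x = c \<or> x = y \<langle>$\<rangle> c" for x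
          unfolding cyc[symmetric] mvx(2)[symmetric] iff(2) sg by (simp add: iff_k)
      qed
    qed
  qed
qed

section \<open>The alternating sum over the covers\<close>

abbreviation shift_sgn :: "int perm \<Rightarrow> int perm \<Rightarrow> int \<Rightarrow> int" where
  "shift_sgn y z x \<equiv> sgn (z \<langle>$\<rangle> x - y \<langle>$\<rangle> x)"

text \<open>
  There are infinitely many covers of \<open>y\<close>, as \<open>s\<^sub>k y\<close> is one for every \<open>k\<close> far away. Those that do
  not change the value at \<open>x\<close> contribute nothing to the alternating sum and are left out.
\<close>

definition moving_covers :: "int perm \<Rightarrow> int \<Rightarrow> int perm set" where
  "moving_covers y x = {z. inv_covers y z \<and> z \<langle>$\<rangle> x \<noteq> y \<langle>$\<rangle> x}"

text \<open>
  The points of \<open>lower k y\<close> that correspond to \<open>x\<close>: both fixed points \<open>k\<close> and \<open>k + 1\<close> if \<open>x\<close> lies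
  on the cycle that is split, and otherwise the image under \<open>s\<^sub>k\<close>.
\<close>

definition lowered_points :: "int \<Rightarrow> int perm \<Rightarrow> int \<Rightarrow> int set" where
  "lowered_points k y x =
     (if y \<langle>$\<rangle> k = k + 1 \<and> (x = k \<or> x = k + 1) then {k, k + 1} else {simple_transposition k \<langle>$\<rangle> x})"

text \<open>
  The coefficient of \<open>N(y)\<close> contributed by \<open>s\<^sub>k\<close> to the alternating sum at \<open>x\<close>.
\<close>

definition weight :: "int perm \<Rightarrow> int \<Rightarrow> int \<Rightarrow> int" where
  "weight y x k = of_bool (k = x \<or> k = y \<langle>$\<rangle> x) - of_bool (k + 1 = x \<or> k + 1 = y \<langle>$\<rangle> x)"

lemma shift_sgn_raise_self:
  "y \<in> involutions \<Longrightarrow> \<not> descent y k \<Longrightarrow> shift_sgn y (raise k y) x = weight y x k"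
  unfolding weight_def by (rule raise_sgn)

lemma finite_lowered_points [simp]: "finite (lowered_points k y x)"
  by (simp add: lowered_points_def)

lemma lower_fixes_iff:
  assumes "y \<in> involutions" "descent y k"
  shows "lower k y \<langle>$\<rangle> k = k \<and> lower k y \<langle>$\<rangle> (k + 1) = k + 1 \<longleftrightarrow> y \<langle>$\<rangle> k = k + 1"
proof -
  have "y \<langle>$\<rangle> (k + 1) = k" if "y \<langle>$\<rangle> k = k + 1" using that assms by (metis involution_apply)
  then show ?thesis
    using assms by (auto simp: lower_descent descent_def apply_mult apply_simple_transposition split: if_splits)
qed

lemma shift_sgn_raise:
  assumes y: "y \<in> involutions" "descent y k"
    and cov: "inv_covers (lower k y) v" and ne: "v \<noteq> y"
  shows "shift_sgn y (raise k v) x = (\<Sum>w\<in>lowered_points k y x. shift_sgn (lower k y) v w)"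
proof -
  let ?u = "lower k y"
  obtain p c where mv: "moves ?u v p c" using inv_covers_moves[OF cov] by blast
  have asc: "\<not> descent ?u k" "\<not> descent v k"
    using inv_covers_raise_both(1)[OF cov y ne] lower_descent_ascent[OF y] by auto
  have r: "raise k ?u = y" by (rule raise_lower[OF y])
  show ?thesis
  proof (cases "y \<langle>$\<rangle> k = k + 1")
    case True
    then have "?u \<langle>$\<rangle> k = k" "?u \<langle>$\<rangle> (k + 1) = k + 1" using lower_fixes_iff[OF y] by auto
    from sgn_raise_fixed[OF cov mv asc this, of x] show ?thesis
      using True unfolding r by (auto simp: lowered_points_def apply_simple_transposition)
  next
    case False
    then have "\<not> (?u \<langle>$\<rangle> k = k \<and> ?u \<langle>$\<rangle> (k + 1) = k + 1)" using lower_fixes_iff[OF y] by auto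
    from sgn_raise_conj[OF cov mv asc this, of x] show ?thesis
      using False unfolding r by (simp add: lowered_points_def)
  qed
qed

text \<open>
  The involution \<open>y\<close> is itself a cover of \<open>lower k y\<close>; this is its sign there.
\<close>

lemma shift_sgn_lowered:
  assumes y: "y \<in> involutions" "descent y k"
  shows "(\<Sum>w\<in>lowered_points k y x. shift_sgn (lower k y) y w) = - weight y x k"
proof -
  let ?u = "lower k y" and ?s = "simple_transposition k"
  have u: "?u \<in> involutions" "\<not> descent ?u k" using y by (simp_all add: lower_involution lower_descent_ascent)
  have sg: "shift_sgn ?u y w = weight ?u w k" for w
    using shift_sgn_raise_self[OF u, of w] unfolding raise_lower[OF y] .
  have s: "k = ?s \<langle>$\<rangle> w \<longleftrightarrow> k + 1 = w" "k + 1 = ?s \<langle>$\<rangle> w \<longleftrightarrow> k = w" for w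
    by (auto simp: apply_simple_transposition)
  show ?thesis
  proof (cases "y \<langle>$\<rangle> k = k + 1")
    case False
    then have us: "?u \<langle>$\<rangle> (?s \<langle>$\<rangle> x) = ?s \<langle>$\<rangle> (y \<langle>$\<rangle> x)" using y by (simp add: lower_descent apply_mult)
    have "weight ?u (?s \<langle>$\<rangle> x) k = - weight y x k" unfolding weight_def us s by simp
    then show ?thesis using False unfolding sg by (simp add: lowered_points_def)
  next
    case True
    then have fx: "?u \<langle>$\<rangle> k = k" "?u \<langle>$\<rangle> (k + 1) = k + 1" using lower_fixes_iff[OF y] by auto
    have yk: "y \<langle>$\<rangle> (k + 1) = k" using True y(1) by (metis involution_apply)
    show ?thesis
    proof (cases "x = k \<or> x = k + 1")
      case xk: True
      then have "weight y x k = 0" "lowered_points k y x = {k, k + 1}"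
        using True yk by (auto simp: lowered_points_def weight_def)
      then show ?thesis unfolding sg by (simp add: weight_def fx)
    next
      case xk: False
      then have "y \<langle>$\<rangle> x \<noteq> k" "y \<langle>$\<rangle> x \<noteq> k + 1" using True yk y(1) by (metis involution_apply)+
      moreover from this have "?u \<langle>$\<rangle> x = y \<langle>$\<rangle> x"
        using True y by (simp add: lower_descent apply_mult apply_simple_transposition)
      moreover have "?s \<langle>$\<rangle> x = x" using xk by (simp add: apply_simple_transposition)
      ultimately have "weight y x k = 0" "weight ?u x k = 0" "lowered_points k y x = {x}"
        using xk by (auto simp: lowered_points_def weight_def)
      then show ?thesis unfolding sg by simp
    qed
  qed
qed

lemma weight_eq_0: "k \<notin> {x, y \<langle>$\<rangle> x, x - 1, y \<langle>$\<rangle> x - 1} \<Longrightarrow> weight y x k = 0"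
  by (auto simp: weight_def)

text \<open>
  The positive terms are indexed by the cycle of \<open>x\<close> and the negative ones by its translate.
\<close>

lemma sum_weight:
  assumes "finite K" "{x, y \<langle>$\<rangle> x, x - 1, y \<langle>$\<rangle> x - 1} \<subseteq> K"
  shows "(\<Sum>k\<in>K. weight y x k) = 0"
proof -
  have "(\<Sum>k\<in>K. weight y x k) =
      int (card {k \<in> K. k = x \<or> k = y \<langle>$\<rangle> x}) - int (card {k \<in> K. k + 1 = x \<or> k + 1 = y \<langle>$\<rangle> x})"
    using assms(1) by (simp add: weight_def sum_subtractf of_bool_def sum.If_cases Int_def conj_commute)
  also have "{k \<in> K. k = x \<or> k = y \<langle>$\<rangle> x} = {x, y \<langle>$\<rangle> x}" using assms(2) by auto
  also have "{k \<in> K. k + 1 = x \<or> k + 1 = y \<langle>$\<rangle> x} = (\<lambda>k. k - 1) ` {x, y \<langle>$\<rangle> x}" using assms(2) by auto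
  also have "card ((\<lambda>k. k - 1) ` {x, y \<langle>$\<rangle> x}) = card {x, y \<langle>$\<rangle> x}" by (rule card_image) (auto intro: inj_onI)
  finally show ?thesis by simp
qed

lemma cover_neq_one: "inv_covers y z \<Longrightarrow> z \<noteq> 1"
  using bruhat_less_length[OF inv_coversD(3)] by force

abbreviation num_words :: "int perm \<Rightarrow> int" where
  "num_words z \<equiv> int (card (involution_words z))"

text \<open>
  A cover is determined by one of its descents \<open>k\<close> and its lowering at \<open>k\<close>. If the lowering is
  \<open>y\<close>, then \<open>k\<close> or \<open>k + 1\<close> is on the cycle of \<open>x\<close>; otherwise \<open>k\<close> is one of the finitely many descents
  of \<open>y\<close>, and the lowered cover moves a point that corresponds to \<open>x\<close>.
\<close>

lemma moving_covers_finite_step: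
  assumes y: "y \<in> involutions"
    and IH: "\<And>k w. descent y k \<Longrightarrow> finite (moving_covers (lower k y) w)"
  shows "finite (moving_covers y x)"
proof (rule finite_subset)
  let ?A = "(\<lambda>k. raise k y) ` {x, y \<langle>$\<rangle> x, x - 1, y \<langle>$\<rangle> x - 1}"
  let ?B = "\<Union>k\<in>{k. descent y k}. raise k ` (\<Union>w\<in>lowered_points k y x. moving_covers (lower k y) w)"
  show "finite (?A \<union> ?B)" using IH by (intro finite_UnI finite_UN_I finite_imageI) auto
  show "moving_covers y x \<subseteq> ?A \<union> ?B"
  proof
    fix z assume "z \<in> moving_covers y x"
    then have cov: "inv_covers y z" and zx: "z \<langle>$\<rangle> x \<noteq> y \<langle>$\<rangle> x" by (auto simp: moving_covers_def)
    note I = inv_coversD[OF cov]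
    obtain k where k: "descent z k" using cover_neq_one[OF cov] descent_exists by blast
    show "z \<in> ?A \<union> ?B"
    proof (cases "descent y k")
      case False
      then have z: "z = raise k y" using inv_covers_new_descent[OF cov k] by simp
      have "weight y x k \<noteq> 0" using shift_sgn_raise_self[OF y False, of x] zx by (metis right_minus_eq sgn_0_0 z)
      then have "k \<in> {x, y \<langle>$\<rangle> x, x - 1, y \<langle>$\<rangle> x - 1}" using weight_eq_0 by blast
      then show ?thesis using z by blast
    next
      case True
      let ?v = "lower k z"
      note low = inv_covers_lower[OF cov k True]
      have z: "z = raise k ?v" using raise_lower[OF I(2) k] by simp
      have "(\<Sum>w\<in>lowered_points k y x. shift_sgn (lower k y) ?v w) \<noteq> 0"
        using shift_sgn_raise[OF y True low, of x] zx z by (metis right_minus_eq sgn_0_0)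
      then obtain w where "w \<in> lowered_points k y x" "shift_sgn (lower k y) ?v w \<noteq> 0"
        by (meson sum.neutral)
      then have "?v \<in> (\<Union>w\<in>lowered_points k y x. moving_covers (lower k y) w)"
        using low(1) unfolding moving_covers_def sgn_0_0 by force
      then have "z \<in> raise k ` (\<Union>w\<in>lowered_points k y x. moving_covers (lower k y) w)"
        by (subst z) (rule imageI)
      then show ?thesis using True by blast
    qed
  qed
qed

text \<open>
  The lowered covers of \<open>y\<close> are all covers of \<open>lower k y\<close> except \<open>y\<close>. As the complete sums
  over them vanish at every point, what remains is the negative of the term for \<open>y\<close>.
\<close>

lemma sum_covers_common_descent:
  assumes y: "y \<in> involutions" and dy: "descent y k"
    and fin: "\<And>w. finite (moving_covers (lower k y) w)"
    and sum0: "\<And>w. (\<Sum>v\<in>moving_covers (lower k y) w. shift_sgn (lower k y) v w * num_words v) = 0"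
  shows "(\<Sum>z\<in>{z \<in> moving_covers y x. descent z k}. shift_sgn y z x * num_words (lower k z)) =
    weight y x k * num_words y"
proof -
  let ?u = "lower k y" and ?L = "lowered_points k y x"
  let ?W = "\<Union>w\<in>?L. moving_covers ?u w"
  let ?f = "\<lambda>v. (\<Sum>w\<in>?L. shift_sgn ?u v w) * num_words v"
  have finW: "finite ?W" using fin by simp
  have cov: "inv_covers ?u v" if "v \<in> ?W" for v using that by (auto simp: moving_covers_def)
  have cov_y: "inv_covers ?u y"
    using inv_covers_raise[OF lower_involution[OF y] lower_descent_ascent[OF y dy]]
    by (simp add: raise_lower[OF y dy])
  have "(\<Sum>v\<in>?W. ?f v) = (\<Sum>w\<in>?L. \<Sum>v\<in>?W. shift_sgn ?u v w * num_words v)"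
    by (simp add: sum_distrib_right sum.swap[of _ ?W])
  also have "\<dots> = (\<Sum>w\<in>?L. \<Sum>v\<in>moving_covers ?u w. shift_sgn ?u v w * num_words v)"
    by (intro sum.cong refl sum.mono_neutral_right finW) (use cov in \<open>auto simp: moving_covers_def\<close>)
  also have "\<dots> = 0" by (simp add: sum0)
  finally have W0: "(\<Sum>v\<in>?W. ?f v) = 0" .
  have fy: "?f y = - weight y x k * num_words y" by (simp add: shift_sgn_lowered[OF y dy])
  have "(\<Sum>v\<in>?W - {y}. ?f v) = weight y x k * num_words y"
  proof (cases "y \<in> ?W")
    case True
    then show ?thesis using W0 fy sum.remove[OF finW True, of ?f] by simp
  next
    case False
    then have "shift_sgn ?u y w = 0" if "w \<in> ?L" for w
      using that cov_y by (auto simp: moving_covers_def)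
    then have "?f y = 0" by simp
    then show ?thesis using W0 fy False by simp
  qed
  moreover have "(\<Sum>z\<in>{z \<in> moving_covers y x. descent z k}. shift_sgn y z x * num_words (lower k z)) =
      (\<Sum>v\<in>{v \<in> ?W - {y}. (\<Sum>w\<in>?L. shift_sgn ?u v w) \<noteq> 0}. ?f v)"
  proof (rule sum.reindex_bij_witness[where i = "raise k" and j = "lower k"])
    fix z assume z: "z \<in> {z \<in> moving_covers y x. descent z k}"
    then have covz: "inv_covers y z" "descent z k" "z \<langle>$\<rangle> x \<noteq> y \<langle>$\<rangle> x" by (auto simp: moving_covers_def)
    note low = inv_covers_lower[OF covz(1,2) dy]
    show r: "raise k (lower k z) = z" using raise_lower covz inv_coversD(2) by blast
    have eq: "shift_sgn y z x = (\<Sum>w\<in>?L. shift_sgn ?u (lower k z) w)"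
      using shift_sgn_raise[OF y dy low, of x] by (simp add: r)
    then have nz: "(\<Sum>w\<in>?L. shift_sgn ?u (lower k z) w) \<noteq> 0" using covz(3) by (simp add: sgn_0_0 flip: eq)
    then obtain w where "w \<in> ?L" "shift_sgn ?u (lower k z) w \<noteq> 0" by (meson sum.neutral)
    then have "lower k z \<in> ?W" using low(1) unfolding moving_covers_def sgn_0_0 by force
    then show "lower k z \<in> {v \<in> ?W - {y}. (\<Sum>w\<in>?L. shift_sgn ?u v w) \<noteq> 0}" using low(2) nz by simp
    show "?f (lower k z) = shift_sgn y z x * num_words (lower k z)" by (simp add: eq)
  next
    fix v assume v: "v \<in> {v \<in> ?W - {y}. (\<Sum>w\<in>?L. shift_sgn ?u v w) \<noteq> 0}"
    then have cv: "inv_covers ?u v" "v \<noteq> y" using cov by auto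
    note up = inv_covers_raise_both[OF cv(1) y dy cv(2)]
    note Iv = inv_coversD(2)[OF cv(1)]
    show "lower k (raise k v) = v" by (rule lower_raise[OF Iv up(1)])
    have "shift_sgn y (raise k v) x \<noteq> 0" using shift_sgn_raise[OF y dy cv, of x] v by simp
    then have "raise k v \<langle>$\<rangle> x \<noteq> y \<langle>$\<rangle> x" by (metis diff_self sgn_0)
    then show "raise k v \<in> {z \<in> moving_covers y x. descent z k}"
      using up(2) raise_ascent_descent[OF Iv up(1)] by (simp add: moving_covers_def)
  qed
  moreover have "(\<Sum>v\<in>{v \<in> ?W - {y}. (\<Sum>w\<in>?L. shift_sgn ?u v w) \<noteq> 0}. ?f v) = (\<Sum>v\<in>?W - {y}. ?f v)"
    using finW by (intro sum.mono_neutral_left) auto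
  ultimately show ?thesis by simp
qed

theorem sum_moving_covers:
  assumes "y \<in> involutions"
  shows "finite (moving_covers y x) \<and>
    (\<Sum>z\<in>moving_covers y x. shift_sgn y z x * num_words z) = 0"
  using assms
proof (induction "perm_length y" arbitrary: y x rule: less_induct)
  case less
  let ?C = "moving_covers y x" and ?D = "{k. descent y k}"
  let ?P = "{x, y \<langle>$\<rangle> x, x - 1, y \<langle>$\<rangle> x - 1}"
  have IH: "finite (moving_covers (lower k y) w)"
    "(\<Sum>v\<in>moving_covers (lower k y) w. shift_sgn (lower k y) v w * num_words v) = 0"
    if "descent y k" for k w
    using less.hyps[OF inv_rank_lower(2)[OF less.prems that] lower_involution[OF less.prems]] by auto
  have finC: "finite ?C" by (rule moving_covers_finite_step[OF less.prems IH(1)])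
  have CI: "inv_covers y z" "z \<in> involutions" if "z \<in> ?C" for z
    using that inv_coversD(2) by (auto simp: moving_covers_def)
  have "(\<Sum>z\<in>?C. shift_sgn y z x * num_words z) =
      (\<Sum>z\<in>?C. \<Sum>k\<in>{k. descent z k}. shift_sgn y z x * num_words (lower k z))"
  proof (intro sum.cong refl)
    fix z assume "z \<in> ?C"
    note z = CI[OF this]
    show "shift_sgn y z x * num_words z =
        (\<Sum>k\<in>{k. descent z k}. shift_sgn y z x * num_words (lower k z))"
      unfolding card_involution_words[OF z(2) cover_neq_one[OF z(1)]] by (simp add: sum_distrib_left)
  qed
  also have "\<dots> = (\<Sum>z\<in>?C. \<Sum>k\<in>{k. descent z k} \<inter> ?D. shift_sgn y z x * num_words (lower k z)) +
      (\<Sum>z\<in>?C. \<Sum>k\<in>{k. descent z k} - ?D. shift_sgn y z x * num_words (lower k z))"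
    unfolding sum.distrib[symmetric]
    by (intro sum.cong refl) (metis finite_descents sum.Int_Diff)
  also have "(\<Sum>z\<in>?C. \<Sum>k\<in>{k. descent z k} \<inter> ?D. shift_sgn y z x * num_words (lower k z)) =
      (\<Sum>k\<in>?D. \<Sum>z\<in>{z \<in> ?C. descent z k}. shift_sgn y z x * num_words (lower k z))"
  proof -
    have "(\<Sum>z\<in>?C. \<Sum>k\<in>{k \<in> ?D. descent z k}. shift_sgn y z x * num_words (lower k z)) =
      (\<Sum>k\<in>?D. \<Sum>z\<in>{z \<in> ?C. descent z k}. shift_sgn y z x * num_words (lower k z))"
      by (rule sum.swap_restrict[OF finC]) simp
    moreover have "{k. descent z k} \<inter> ?D = {k \<in> ?D. descent z k}" for z by auto
    ultimately show ?thesis by simp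
  qed
  also have "\<dots> = (\<Sum>k\<in>?D. weight y x k * num_words y)"
    by (intro sum.cong refl) (simp add: sum_covers_common_descent less.prems IH)
  also have "(\<Sum>z\<in>?C. \<Sum>k\<in>{k. descent z k} - ?D. shift_sgn y z x * num_words (lower k z)) =
      (\<Sum>k\<in>{k \<in> ?P - ?D. weight y x k \<noteq> 0}. weight y x k * num_words y)"
  proof -
    have "(\<Sum>z\<in>?C. \<Sum>k\<in>{k. descent z k} - ?D. shift_sgn y z x * num_words (lower k z)) =
        (\<Sum>(z, k)\<in>Sigma ?C (\<lambda>z. {k. descent z k} - ?D). shift_sgn y z x * num_words (lower k z))"
      by (rule sum.Sigma[OF finC]) simp
    also have "\<dots> = (\<Sum>k\<in>{k \<in> ?P - ?D. weight y x k \<noteq> 0}. weight y x k * num_words y)"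
    proof (rule sum.reindex_bij_witness[where i = "\<lambda>k. (raise k y, k)" and j = snd])
      fix zk assume "zk \<in> Sigma ?C (\<lambda>z. {k. descent z k} - ?D)"
      then obtain z k where zk: "zk = (z, k)" "z \<in> ?C" "descent z k" "\<not> descent y k" by auto
      then have z: "z = raise k y" using inv_covers_new_descent CI by blast
      show "(raise (snd zk) y, snd zk) = zk" by (simp add: zk(1) z)
      have w: "shift_sgn y z x = weight y x k"
        unfolding z by (rule shift_sgn_raise_self[OF less.prems zk(4)])
      have "weight y x k \<noteq> 0" using zk(2) by (auto simp: moving_covers_def sgn_0_0 simp flip: w)
      moreover from this have "k \<in> ?P" using weight_eq_0 by blast
      ultimately show "snd zk \<in> {k \<in> ?P - ?D. weight y x k \<noteq> 0}" using zk by simp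
      show "weight y x (snd zk) * num_words y =
          (case zk of (z, k) \<Rightarrow> shift_sgn y z x * num_words (lower k z))"
        using w by (simp add: zk(1) z lower_raise[OF less.prems zk(4)])
    next
      fix k assume k: "k \<in> {k \<in> ?P - ?D. weight y x k \<noteq> 0}"
      then have nd: "\<not> descent y k" by simp
      have "shift_sgn y (raise k y) x \<noteq> 0"
        using k shift_sgn_raise_self[OF less.prems nd, of x] by simp
      then have "raise k y \<langle>$\<rangle> x \<noteq> y \<langle>$\<rangle> x" by (metis diff_self sgn_0)
      then show "(raise k y, k) \<in> Sigma ?C (\<lambda>z. {k. descent z k} - ?D)"
        using nd inv_covers_raise[OF less.prems nd] raise_ascent_descent[OF less.prems nd]
        by (simp add: moving_covers_def)
    qed simp
    finally show ?thesis .
  qed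
  also have "\<dots> = (\<Sum>k\<in>(?P \<union> ?D) - ?D. weight y x k * num_words y)"
    by (intro sum.mono_neutral_left) auto
  also have "(\<Sum>k\<in>?D. weight y x k * num_words y) + \<dots> = (\<Sum>k\<in>?P \<union> ?D. weight y x k * num_words y)"
    by (subst add.commute) (rule sum.subset_diff[symmetric], auto)
  also have "\<dots> = (\<Sum>k\<in>?P \<union> ?D. weight y x k) * num_words y" by (simp add: sum_distrib_right)
  also have "\<dots> = 0" using sum_weight[of "?P \<union> ?D" x y] by simp
  finally show ?case using finC by simp
qed

section \<open>Covers and the operators \<open>\<tau>\<^sub>i\<^sub>j\<close>\<close>

lemma sorted_list_of_set_eqI:
  fixes A :: "int set"
  shows "set xs = A \<Longrightarrow> sorted xs \<Longrightarrow> distinct xs \<Longrightarrow> sorted_list_of_set A = xs"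
  by (auto intro: sorted_list_of_set.idem_if_sorted_distinct)

lemma swap_involution: "\<langle>a \<leftrightarrow> b\<rangle> \<in> involutions"
  by (simp add: involutions_def)

lemma two_swaps_involution: 
  "distinct [a, b, c, d] \<Longrightarrow> \<langle>a \<leftrightarrow> b\<rangle> * \<langle>c \<leftrightarrow> d\<rangle> \<in> involutions"
  by (rule involutionI) (auto simp: apply_mult apply_swap_if)

lemma replace_on_eqI:
  assumes "y \<in> involutions" "\<sigma> \<in> involutions" "finite A"
    and "\<forall>x\<in>A. y \<langle>$\<rangle> x \<in> A \<and> \<sigma> \<langle>$\<rangle> x \<in> A \<and> z \<langle>$\<rangle> x = \<sigma> \<langle>$\<rangle> x"
    and "\<And>x. x \<notin> A \<Longrightarrow> z \<langle>$\<rangle> x = y \<langle>$\<rangle> x"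
  shows "replace_on A y \<sigma> = z"
proof (rule perm_eqI)
  have "replace_on A y \<sigma> \<langle>$\<rangle> x = override_on (apply y) (apply \<sigma>) A x" for x
    by (subst apply_replace_on(1)) (use assms(1-4) in auto)
  then show "replace_on A y \<sigma> \<langle>$\<rangle> x = z \<langle>$\<rangle> x" for x
    using assms(4,5) by (simp add: override_on_def)
qed

context
  fixes y z :: "int perm"
  assumes y: "y \<in> involutions"
begin

lemma tau_fixed_points:
  assumes "a < b" "y \<langle>$\<rangle> a = a" "y \<langle>$\<rangle> b = b"
    and z: "z \<langle>$\<rangle> a = b" "z \<langle>$\<rangle> b = a" "\<And>x. x \<notin> {a, b} \<Longrightarrow> z \<langle>$\<rangle> x = y \<langle>$\<rangle> x"
  shows "tau a b y = z"
proof -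
  have A: "{a, b, y \<langle>$\<rangle> a, y \<langle>$\<rangle> b} = {a, b}" using assms by auto
  have sl: "sorted_list_of_set {a, b} = [a, b]"
    by (rule sorted_list_of_set_eqI) (use assms in auto)
  have "tau a b y = replace_on {a, b} y \<langle>a \<leftrightarrow> b\<rangle>"
    unfolding tau_def A Let_def sl using assms by (simp add: agree_on_def)
  also have "\<dots> = z"
    by (rule replace_on_eqI[OF y swap_involution]) (use assms in \<open>auto simp: apply_swap_if\<close>)
  finally show ?thesis .
qed

lemma tau_cycle_fixed_point:
  assumes "a < b" "b < c" "y \<langle>$\<rangle> a = b" "y \<langle>$\<rangle> c = c" and ij: "(i, j) \<in> {(b, c), (a, c)}"
    and z: "z \<langle>$\<rangle> a = c" "z \<langle>$\<rangle> c = a" "z \<langle>$\<rangle> b = b" "\<And>x. x \<notin> {a, b, c} \<Longrightarrow> z \<langle>$\<rangle> x = y \<langle>$\<rangle> x"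
  shows "tau i j y = z"
proof -
  have yb: "y \<langle>$\<rangle> b = a" using assms(3) y by (metis involution_apply)
  have A: "{i, j, y \<langle>$\<rangle> i, y \<langle>$\<rangle> j} = {a, b, c}" using ij assms(3,4) yb by auto
  have sl: "sorted_list_of_set {a, b, c} = [a, b, c]"
    by (rule sorted_list_of_set_eqI) (use assms in auto)
  have ag: "agree_on {a, b, c} y \<langle>a \<leftrightarrow> b\<rangle>"
    using assms(1-4) yb by (simp_all add: agree_on_def apply_swap_if)
  have "tau i j y = replace_on {a, b, c} y \<langle>a \<leftrightarrow> c\<rangle>"
    unfolding tau_def A Let_def sl using ag ij by simp
  also have "\<dots> = z"
    by (rule replace_on_eqI[OF y swap_involution]) (use assms(1-4) z yb in \<open>simp_all add: apply_swap_if\<close>)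
  finally show ?thesis .
qed

lemma tau_fixed_point_cycle:
  assumes "a < b" "b < c" "y \<langle>$\<rangle> b = c" "y \<langle>$\<rangle> a = a" and ij: "(i, j) \<in> {(a, b), (a, c)}"
    and z: "z \<langle>$\<rangle> a = c" "z \<langle>$\<rangle> c = a" "z \<langle>$\<rangle> b = b" "\<And>x. x \<notin> {a, b, c} \<Longrightarrow> z \<langle>$\<rangle> x = y \<langle>$\<rangle> x"
  shows "tau i j y = z"
proof -
  have yc: "y \<langle>$\<rangle> c = b" using assms(3) y by (metis involution_apply)
  have A: "{i, j, y \<langle>$\<rangle> i, y \<langle>$\<rangle> j} = {a, b, c}" using ij assms(3,4) yc by auto
  have sl: "sorted_list_of_set {a, b, c} = [a, b, c]"
    by (rule sorted_list_of_set_eqI) (use assms in auto)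
  have ag: "agree_on {a, b, c} y \<langle>b \<leftrightarrow> c\<rangle>" "\<not> agree_on {a, b, c} y \<langle>a \<leftrightarrow> b\<rangle>"
    using assms(1-4) yc by (simp_all add: agree_on_def apply_swap_if)
  have "tau i j y = replace_on {a, b, c} y \<langle>a \<leftrightarrow> c\<rangle>"
    unfolding tau_def A Let_def sl using ag ij by simp
  also have "\<dots> = z"
    by (rule replace_on_eqI[OF y swap_involution]) (use assms(1-4) z yc in \<open>simp_all add: apply_swap_if\<close>)
  finally show ?thesis .
qed

lemma tau_disjoint_cycles:
  assumes ord: "a < b" "b < c" "c < d" and ya: "y \<langle>$\<rangle> a = b" "y \<langle>$\<rangle> c = d"
    and out: "\<And>x. x \<notin> {a, b, c, d} \<Longrightarrow> z \<langle>$\<rangle> x = y \<langle>$\<rangle> x"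
  shows "z \<langle>$\<rangle> a = c \<Longrightarrow> z \<langle>$\<rangle> c = a \<Longrightarrow> z \<langle>$\<rangle> b = d \<Longrightarrow> z \<langle>$\<rangle> d = b \<Longrightarrow> tau b c y = z"
    and "z \<langle>$\<rangle> a = d \<Longrightarrow> z \<langle>$\<rangle> d = a \<Longrightarrow> z \<langle>$\<rangle> b = b \<Longrightarrow> z \<langle>$\<rangle> c = c \<Longrightarrow>
      (i, j) \<in> {(a, c), (b, d), (a, d)} \<Longrightarrow> tau i j y = z"
proof -
  have yb: "y \<langle>$\<rangle> b = a" "y \<langle>$\<rangle> d = c" using ya y by (metis involution_apply)+
  have ne: "a \<noteq> b" "a \<noteq> c" "a \<noteq> d" "b \<noteq> c" "b \<noteq> d" "c \<noteq> d" using ord by auto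
  have sl: "sorted_list_of_set {a, b, c, d} = [a, b, c, d]"
    by (rule sorted_list_of_set_eqI) (use ord in auto)
  have ag: "agree_on {a, b, c, d} y (\<langle>a \<leftrightarrow> b\<rangle> * \<langle>c \<leftrightarrow> d\<rangle>)"
    by (simp_all add: agree_on_def apply_mult apply_swap_if ya yb ne ne[symmetric])
  show "tau b c y = z"
    if z: "z \<langle>$\<rangle> a = c" "z \<langle>$\<rangle> c = a" "z \<langle>$\<rangle> b = d" "z \<langle>$\<rangle> d = b"
  proof -
    have A: "{b, c, y \<langle>$\<rangle> b, y \<langle>$\<rangle> c} = {a, b, c, d}" using ya yb by auto
    have "tau b c y = replace_on {a, b, c, d} y (\<langle>a \<leftrightarrow> c\<rangle> * \<langle>b \<leftrightarrow> d\<rangle>)"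
      unfolding tau_def A Let_def sl using ag by simp
    also have "\<dots> = z"
      by (rule replace_on_eqI[OF y two_swaps_involution])
        (simp_all add: apply_mult apply_swap_if ya yb z out ne ne[symmetric])
    finally show ?thesis .
  qed
  show "tau i j y = z"
    if z: "z \<langle>$\<rangle> a = d" "z \<langle>$\<rangle> d = a" "z \<langle>$\<rangle> b = b" "z \<langle>$\<rangle> c = c"
      and ij: "(i, j) \<in> {(a, c), (b, d), (a, d)}"
  proof -
    have A: "{i, j, y \<langle>$\<rangle> i, y \<langle>$\<rangle> j} = {a, b, c, d}" using ya yb ij by auto
    have "(i, j) \<noteq> (b, c)" using ij ord by auto
    with ag ij have "tau i j y = replace_on {a, b, c, d} y \<langle>a \<leftrightarrow> d\<rangle>"
      unfolding tau_def A Let_def sl by (simp only: list.case if_False if_True simp_thms)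
    also have "\<dots> = z"
      by (rule replace_on_eqI[OF y swap_involution])
        (simp_all add: apply_swap_if ya yb z out ne ne[symmetric])
    finally show ?thesis .
  qed
qed

lemma tau_crossing_cycles:
  assumes ord: "a < b" "b < c" "c < d" and ya: "y \<langle>$\<rangle> a = c" "y \<langle>$\<rangle> b = d"
    and ij: "(i, j) \<in> {(a, b), (c, d), (a, d)}"
    and z: "z \<langle>$\<rangle> a = d" "z \<langle>$\<rangle> d = a" "z \<langle>$\<rangle> b = c" "z \<langle>$\<rangle> c = b"
    and out: "\<And>x. x \<notin> {a, b, c, d} \<Longrightarrow> z \<langle>$\<rangle> x = y \<langle>$\<rangle> x"
  shows "tau i j y = z"
proof -
  have yb: "y \<langle>$\<rangle> c = a" "y \<langle>$\<rangle> d = b" using ya y by (metis involution_apply)+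
  have ne: "a \<noteq> b" "a \<noteq> c" "a \<noteq> d" "b \<noteq> c" "b \<noteq> d" "c \<noteq> d" using ord by auto
  have sl: "sorted_list_of_set {a, b, c, d} = [a, b, c, d]"
    by (rule sorted_list_of_set_eqI) (use ord in auto)
  have ag: "agree_on {a, b, c, d} y (\<langle>a \<leftrightarrow> c\<rangle> * \<langle>b \<leftrightarrow> d\<rangle>)"
    "\<not> agree_on {a, b, c, d} y (\<langle>a \<leftrightarrow> b\<rangle> * \<langle>c \<leftrightarrow> d\<rangle>)"
    by (simp_all add: agree_on_def apply_mult apply_swap_if ya yb ne ne[symmetric])
  have A: "{i, j, y \<langle>$\<rangle> i, y \<langle>$\<rangle> j} = {a, b, c, d}" using ya yb ij by auto
  have "tau i j y = replace_on {a, b, c, d} y (\<langle>a \<leftrightarrow> d\<rangle> * \<langle>b \<leftrightarrow> c\<rangle>)"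
    unfolding tau_def A Let_def sl using ag ij by simp
  also have "\<dots> = z"
    by (rule replace_on_eqI[OF y two_swaps_involution])
      (simp_all add: apply_mult apply_swap_if ya yb z out ne ne[symmetric])
  finally show ?thesis .
qed

end

text \<open>
  The branches in which \<open>\<tau>\<^sub>i\<^sub>j\<close> acts, grouped by the permutation that is put on \<open>A\<close>.
\<close>

lemma tau_unfold:
  defines "A i j y \<equiv> {i, j, y \<langle>$\<rangle> i, y \<langle>$\<rangle> j}"
  assumes "tau i j y \<noteq> y"
  obtains (two) a b where "sorted_list_of_set (A i j y) = [a, b]"
      "agree_on (A i j y) y 1" "(i, j) = (a, b)" "tau i j y = replace_on (A i j y) y \<langle>a \<leftrightarrow> b\<rangle>"
  | (three) a b c where "sorted_list_of_set (A i j y) = [a, b, c]"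
      "agree_on (A i j y) y \<langle>a \<leftrightarrow> b\<rangle> \<and> (i, j) \<in> {(b, c), (a, c)} \<or>
       agree_on (A i j y) y \<langle>b \<leftrightarrow> c\<rangle> \<and> (i, j) \<in> {(a, b), (a, c)}"
      "tau i j y = replace_on (A i j y) y \<langle>a \<leftrightarrow> c\<rangle>"
  | (four_merge) a b c d where "sorted_list_of_set (A i j y) = [a, b, c, d]"
      "agree_on (A i j y) y (\<langle>a \<leftrightarrow> b\<rangle> * \<langle>c \<leftrightarrow> d\<rangle>)" "(i, j) = (b, c)"
      "tau i j y = replace_on (A i j y) y (\<langle>a \<leftrightarrow> c\<rangle> * \<langle>b \<leftrightarrow> d\<rangle>)"
  | (four_drop) a b c d where "sorted_list_of_set (A i j y) = [a, b, c, d]"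
      "agree_on (A i j y) y (\<langle>a \<leftrightarrow> b\<rangle> * \<langle>c \<leftrightarrow> d\<rangle>)" "(i, j) \<in> {(a, c), (b, d), (a, d)}"
      "tau i j y = replace_on (A i j y) y \<langle>a \<leftrightarrow> d\<rangle>"
  | (four_nest) a b c d where "sorted_list_of_set (A i j y) = [a, b, c, d]"
      "agree_on (A i j y) y (\<langle>a \<leftrightarrow> c\<rangle> * \<langle>b \<leftrightarrow> d\<rangle>)" "(i, j) \<in> {(a, b), (c, d), (a, d)}"
      "tau i j y = replace_on (A i j y) y (\<langle>a \<leftrightarrow> d\<rangle> * \<langle>b \<leftrightarrow> c\<rangle>)"
proof -
  define xs where "xs = sorted_list_of_set (A i j y)"
  have t: "tau i j y =
    (case xs of
       [a, b] \<Rightarrow>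
         if agree_on (A i j y) y 1 \<and> (i, j) = (a, b)
         then replace_on (A i j y) y \<langle>a \<leftrightarrow> b\<rangle>
         else y
     | [a, b, c] \<Rightarrow>
         if agree_on (A i j y) y \<langle>a \<leftrightarrow> b\<rangle> \<and> (i, j) \<in> {(b, c), (a, c)}
         then replace_on (A i j y) y \<langle>a \<leftrightarrow> c\<rangle>
         else if agree_on (A i j y) y \<langle>b \<leftrightarrow> c\<rangle> \<and> (i, j) \<in> {(a, b), (a, c)}
         then replace_on (A i j y) y \<langle>a \<leftrightarrow> c\<rangle>
         else y
     | [a, b, c, d] \<Rightarrow>
         if agree_on (A i j y) y (\<langle>a \<leftrightarrow> b\<rangle> * \<langle>c \<leftrightarrow> d\<rangle>) \<and> (i, j) = (b, c)
         then replace_on (A i j y) y (\<langle>a \<leftrightarrow> c\<rangle> * \<langle>b \<leftrightarrow> d\<rangle>)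
         else if agree_on (A i j y) y (\<langle>a \<leftrightarrow> b\<rangle> * \<langle>c \<leftrightarrow> d\<rangle>) \<and> (i, j) \<in> {(a, c), (b, d), (a, d)}
         then replace_on (A i j y) y \<langle>a \<leftrightarrow> d\<rangle>
         else if agree_on (A i j y) y (\<langle>a \<leftrightarrow> c\<rangle> * \<langle>b \<leftrightarrow> d\<rangle>) \<and> (i, j) \<in> {(a, b), (c, d), (a, d)}
         then replace_on (A i j y) y (\<langle>a \<leftrightarrow> d\<rangle> * \<langle>b \<leftrightarrow> c\<rangle>)
         else y
     | _ \<Rightarrow> y)"
    unfolding tau_def xs_def A_def Let_def ..
  consider a b where "xs = [a, b]" | a b c where "xs = [a, b, c]" | a b c d where "xs = [a, b, c, d]"
    using assms(2) unfolding t by (auto split: list.splits)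
  then show thesis
  proof cases
    case 1
    then have "agree_on (A i j y) y 1 \<and> (i, j) = (a, b)" "tau i j y = replace_on (A i j y) y \<langle>a \<leftrightarrow> b\<rangle>"
      using assms(2) t by (simp_all split: if_splits)
    then show thesis using two[of a b] 1 unfolding xs_def by blast
  next
    case 2
    let ?P = "agree_on (A i j y) y \<langle>a \<leftrightarrow> b\<rangle> \<and> (i, j) \<in> {(b, c), (a, c)}"
    let ?Q = "agree_on (A i j y) y \<langle>b \<leftrightarrow> c\<rangle> \<and> (i, j) \<in> {(a, b), (a, c)}"
    let ?R = "replace_on (A i j y) y \<langle>a \<leftrightarrow> c\<rangle>"
    have "tau i j y = (if ?P then ?R else if ?Q then ?R else y)"
      unfolding t 2 by (simp only: list.case)
    then have "?P \<or> ?Q" "tau i j y = ?R" using assms(2) by meson+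
    then show thesis using three[of a b c] 2 unfolding xs_def by blast
  next
    case 3
    let ?P = "agree_on (A i j y) y (\<langle>a \<leftrightarrow> b\<rangle> * \<langle>c \<leftrightarrow> d\<rangle>)"
    let ?Q = "agree_on (A i j y) y (\<langle>a \<leftrightarrow> c\<rangle> * \<langle>b \<leftrightarrow> d\<rangle>)"
    let ?Q2 = "(i, j) \<in> {(a, c), (b, d), (a, d)}" and ?Q3 = "(i, j) \<in> {(a, b), (c, d), (a, d)}"
    let ?R1 = "replace_on (A i j y) y (\<langle>a \<leftrightarrow> c\<rangle> * \<langle>b \<leftrightarrow> d\<rangle>)"
    let ?R2 = "replace_on (A i j y) y \<langle>a \<leftrightarrow> d\<rangle>"
    let ?R3 = "replace_on (A i j y) y (\<langle>a \<leftrightarrow> d\<rangle> * \<langle>b \<leftrightarrow> c\<rangle>)"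
    have "tau i j y = (if ?P \<and> (i, j) = (b, c) then ?R1 else if ?P \<and> ?Q2 then ?R2
        else if ?Q \<and> ?Q3 then ?R3 else y)"
      unfolding t 3 by (simp only: list.case)
    then have "?P \<and> (i, j) = (b, c) \<and> tau i j y = ?R1 \<or> ?P \<and> ?Q2 \<and> tau i j y = ?R2 \<or>
        ?Q \<and> ?Q3 \<and> tau i j y = ?R3"
      using assms(2) by meson
    then show thesis
      using four_merge[of a b c d] four_drop[of a b c d] four_nest[of a b c d] 3
      unfolding xs_def by blast
  qed
qed

text \<open>In each of the cases the cycle of \<open>i\<close> is the one that moves up and that of \<open>j\<close> moves down.\<close>

lemma tau_moves:
  assumes y: "y \<in> involutions" and ne: "tau i j y \<noteq> y"
  shows "y \<langle>$\<rangle> i < tau i j y \<langle>$\<rangle> i" "tau i j y \<langle>$\<rangle> j < y \<langle>$\<rangle> j"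
proof -
  let ?A = "{i, j, y \<langle>$\<rangle> i, y \<langle>$\<rangle> j}"
  have sl: "set (sorted_list_of_set ?A) = ?A" "sorted_wrt (<) (sorted_list_of_set ?A)"
    by (rule set_sorted_list_of_set, simp) (rule strict_sorted_list_of_set)
  have yA: "x \<in> ?A \<Longrightarrow> y \<langle>$\<rangle> x \<in> ?A" for x using y by auto
  have rep: "replace_on ?A y \<sigma> \<langle>$\<rangle> x = \<sigma> \<langle>$\<rangle> x"
    if "\<sigma> \<in> involutions" "\<And>x. x \<in> ?A \<Longrightarrow> \<sigma> \<langle>$\<rangle> x \<in> ?A" "x \<in> ?A" for \<sigma> x
    using apply_replace_on(1)[OF y that(1) _ yA that(2)] that(3) by (simp add: override_on_def)
  define w where "w = tau i j y"
  have "y \<langle>$\<rangle> i < w \<langle>$\<rangle> i \<and> w \<langle>$\<rangle> j < y \<langle>$\<rangle> j"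
    using ne
  proof (cases rule: tau_unfold)
    case (two a b)
    then have A: "?A = {a, b}" and ord: "a < b" using sl by auto
    have "w \<langle>$\<rangle> x = \<langle>a \<leftrightarrow> b\<rangle> \<langle>$\<rangle> x" if "x \<in> ?A" for x
      unfolding w_def two(4) by (rule rep[OF swap_involution _ that]) (auto simp: A apply_swap_if)
    then have "w \<langle>$\<rangle> a = b" "w \<langle>$\<rangle> b = a" "y \<langle>$\<rangle> a = a" "y \<langle>$\<rangle> b = b"
      using two(2) unfolding A agree_on_def by simp_all
    then show ?thesis using two(3) ord by simp
  next
    case (three a b c)
    then have A: "?A = {a, b, c}" and ord: "a < b" "b < c" using sl by auto
    then have ord': "a < c" by simp
    have ne: "a \<noteq> b" "a \<noteq> c" "b \<noteq> c" using ord by auto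
    have "w \<langle>$\<rangle> x = \<langle>a \<leftrightarrow> c\<rangle> \<langle>$\<rangle> x" if "x \<in> ?A" for x
      unfolding w_def three(3) by (rule rep[OF swap_involution _ that]) (auto simp: A apply_swap_if)
    then have w: "w \<langle>$\<rangle> a = c" "w \<langle>$\<rangle> c = a" "w \<langle>$\<rangle> b = b"
      unfolding A by (simp_all add: ne ne[symmetric])
    from three(2) show ?thesis
    proof (elim disjE conjE)
      assume "agree_on ?A y \<langle>a \<leftrightarrow> b\<rangle>" and ij: "(i, j) \<in> {(b, c), (a, c)}"
      then have "y \<langle>$\<rangle> a = b" "y \<langle>$\<rangle> b = a" "y \<langle>$\<rangle> c = c"
        unfolding A agree_on_def by (simp_all add: apply_swap_if ne ne[symmetric])
      with ij w ord ord' show ?thesis by auto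
    next
      assume "agree_on ?A y \<langle>b \<leftrightarrow> c\<rangle>" and ij: "(i, j) \<in> {(a, b), (a, c)}"
      then have "y \<langle>$\<rangle> a = a" "y \<langle>$\<rangle> b = c" "y \<langle>$\<rangle> c = b"
        unfolding A agree_on_def by (simp_all add: apply_swap_if ne ne[symmetric])
      with ij w ord ord' show ?thesis by auto
    qed
  next
    case (four_merge a b c d)
    then have A: "?A = {a, b, c, d}" and ord: "a < b" "b < c" "c < d" using sl by auto
    have ne: "a \<noteq> b" "a \<noteq> c" "a \<noteq> d" "b \<noteq> c" "b \<noteq> d" "c \<noteq> d" using ord by auto
    have "w \<langle>$\<rangle> x = (\<langle>a \<leftrightarrow> c\<rangle> * \<langle>b \<leftrightarrow> d\<rangle>) \<langle>$\<rangle> x" if "x \<in> ?A" for x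
      unfolding w_def four_merge(4)
      by (rule rep[OF two_swaps_involution _ that]) (auto simp: A apply_mult apply_swap_if ne ne[symmetric])
    then have w: "w \<langle>$\<rangle> b = d" "w \<langle>$\<rangle> c = a"
      unfolding A by (simp_all add: apply_mult apply_swap_if ne ne[symmetric])
    have "y \<langle>$\<rangle> b = a" "y \<langle>$\<rangle> c = d"
      using four_merge(2) unfolding A agree_on_def
      by (simp_all add: apply_mult apply_swap_if ne ne[symmetric])
    then show ?thesis using four_merge(3) w ord by simp
  next
    case (four_drop a b c d)
    then have A: "?A = {a, b, c, d}" and ord: "a < b" "b < c" "c < d" using sl by auto
    then have ord': "a < c" "b < d" by simp_all
    have ne: "a \<noteq> b" "a \<noteq> c" "a \<noteq> d" "b \<noteq> c" "b \<noteq> d" "c \<noteq> d" using ord by auto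
    have "w \<langle>$\<rangle> x = \<langle>a \<leftrightarrow> d\<rangle> \<langle>$\<rangle> x" if "x \<in> ?A" for x
      unfolding w_def four_drop(4) by (rule rep[OF swap_involution _ that]) (auto simp: A apply_swap_if)
    then have w: "w \<langle>$\<rangle> a = d" "w \<langle>$\<rangle> d = a" "w \<langle>$\<rangle> b = b" "w \<langle>$\<rangle> c = c"
      unfolding A by (simp_all add: apply_swap_if ne ne[symmetric])
    have "y \<langle>$\<rangle> a = b" "y \<langle>$\<rangle> b = a" "y \<langle>$\<rangle> c = d" "y \<langle>$\<rangle> d = c"
      using four_drop(2) unfolding A agree_on_def
      by (simp_all add: apply_mult apply_swap_if ne ne[symmetric])
    then show ?thesis using four_drop(3) w ord ord' by auto
  next
    case (four_nest a b c d)
    then have A: "?A = {a, b, c, d}" and ord: "a < b" "b < c" "c < d" using sl by auto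
    have ne: "a \<noteq> b" "a \<noteq> c" "a \<noteq> d" "b \<noteq> c" "b \<noteq> d" "c \<noteq> d" using ord by auto
    have "w \<langle>$\<rangle> x = (\<langle>a \<leftrightarrow> d\<rangle> * \<langle>b \<leftrightarrow> c\<rangle>) \<langle>$\<rangle> x" if "x \<in> ?A" for x
      unfolding w_def four_nest(4)
      by (rule rep[OF two_swaps_involution _ that]) (auto simp: A apply_mult apply_swap_if ne ne[symmetric])
    then have w: "w \<langle>$\<rangle> a = d" "w \<langle>$\<rangle> d = a" "w \<langle>$\<rangle> b = c" "w \<langle>$\<rangle> c = b"
      unfolding A by (simp_all add: apply_mult apply_swap_if ne ne[symmetric])
    have "y \<langle>$\<rangle> a = c" "y \<langle>$\<rangle> b = d" "y \<langle>$\<rangle> c = a" "y \<langle>$\<rangle> d = b"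
      using four_nest(2) unfolding A agree_on_def
      by (simp_all add: apply_mult apply_swap_if ne ne[symmetric])
    then show ?thesis using four_nest(3) w ord by auto
  qed
  then show "y \<langle>$\<rangle> i < tau i j y \<langle>$\<rangle> i" "tau i j y \<langle>$\<rangle> j < y \<langle>$\<rangle> j"
    by (simp_all add: w_def)
qed

text \<open>
  In each of the six shapes, the largest point of the rising cycle can serve as \<open>i\<close>, and the
  smallest point of the falling cycle as \<open>j\<close>, with a suitable partner.
\<close>

lemma moves_tau:
  assumes cov: "inv_covers y z" and mv: "moves y z p c"
  shows "\<exists>j > y \<langle>$\<rangle> p. z = tau (y \<langle>$\<rangle> p) j y" "\<exists>i < c. z = tau i c y"
proof -
  note I = inv_coversD[OF cov]
  define q d where "q = y \<langle>$\<rangle> p" and "d = y \<langle>$\<rangle> c"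
  note [simp] = q_def[symmetric] d_def[symmetric]
  have yv: "y \<langle>$\<rangle> q = p" "y \<langle>$\<rangle> d = c" using I(1) by (simp_all only: q_def d_def involution_apply)
  have out: "z \<langle>$\<rangle> x = y \<langle>$\<rangle> x" if "x \<notin> {p, q, c, d}" for x
    using moves_shape(2)[OF cov mv, of x] that by simp
  have zz: "z \<langle>$\<rangle> b = a" if "z \<langle>$\<rangle> a = b" for a b using that I(2) by (metis involution_apply)
  have "(\<exists>j > q. z = tau q j y) \<and> (\<exists>i < c. z = tau i c y)"
    using moves_shape(1)[OF cov mv, folded q_def d_def]
  proof (elim disjE conjE)
    assume a: "p = q" "c = d" "p < c" "z \<langle>$\<rangle> p = c"
    have "tau q c y = z"
      by (rule tau_fixed_points[OF I(1)]) (use a zz[OF a(4)] out yv in auto)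
    then show ?thesis using a by blast
  next
    assume a: "p < q" "q < c" "c = d" "z \<langle>$\<rangle> p = c" "z \<langle>$\<rangle> q = q"
    have "tau q c y = z"
      by (rule tau_cycle_fixed_point[OF I(1), of p q c]) (use a zz[OF a(4)] out yv in auto)
    then show ?thesis using a by blast
  next
    assume a: "p = q" "p < c" "c < d" "z \<langle>$\<rangle> p = d" "z \<langle>$\<rangle> c = c"
    have "tau q c y = z"
      by (rule tau_fixed_point_cycle[OF I(1), of p c d]) (use a zz[OF a(4)] out yv in auto)
    then show ?thesis using a by blast
  next
    assume a: "p < q" "q < c" "c < d" "z \<langle>$\<rangle> p = c" "z \<langle>$\<rangle> q = d"
    have "tau q c y = z"
      by (rule tau_disjoint_cycles(1)[OF I(1), of p q c d]) (use a zz[OF a(4)] zz[OF a(5)] out yv in auto)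
    then show ?thesis using a by blast
  next
    assume a: "p < q" "q < c" "c < d" "z \<langle>$\<rangle> p = d" "z \<langle>$\<rangle> q = q" "z \<langle>$\<rangle> c = c"
    note tau = tau_disjoint_cycles(2)[OF I(1) a(1-3), of z, OF _ _ out a(4) zz[OF a(4)] a(5,6)]
    have "tau q d y = z" "tau p c y = z" by (rule tau; simp)+
    moreover have "q < d" "p < c" using a by simp_all
    ultimately show ?thesis by (intro conjI exI[of _ d] exI[of _ p]) simp_all
  next
    assume a: "p < c" "c < q" "q < d" "z \<langle>$\<rangle> p = d" "z \<langle>$\<rangle> q = c"
    have o: "z \<langle>$\<rangle> x = y \<langle>$\<rangle> x" if "x \<notin> {p, c, q, d}" for x using out[of x] that by auto
    note tau = tau_crossing_cycles[OF I(1) a(1-3), of _ _ z, OF _ _ _ a(4) zz[OF a(4)] zz[OF a(5)] a(5) o]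
    have "tau q d y = z" "tau p c y = z" by (rule tau; simp)+
    then show ?thesis using a(1,3) by (intro conjI exI[of _ d] exI[of _ p]) simp_all
  qed
  then show "\<exists>j > y \<langle>$\<rangle> p. z = tau (y \<langle>$\<rangle> p) j y" "\<exists>i < c. z = tau i c y" by auto
qed

text \<open>
  As \<open>q\<close> is the largest point of its cycle, it is the point that \<open>moves_tau\<close> provides.
\<close>

lemma Phi_plus_eq:
  assumes y: "y \<in> involutions" and q: "y \<langle>$\<rangle> q \<le> q"
  shows "Phi_plus y q = {z. inv_covers y z \<and> y \<langle>$\<rangle> q < z \<langle>$\<rangle> q}"
proof (intro equalityI subsetI CollectI conjI)
  fix z assume "z \<in> Phi_plus y q"
  then obtain j where z: "inv_covers y z" "z = tau q j y" by (auto simp: Phi_plus_def)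
  moreover from this have "z \<noteq> y" using inv_coversD(3) bruhat_less_irrefl by blast
  ultimately show "inv_covers y z" "y \<langle>$\<rangle> q < z \<langle>$\<rangle> q"
    using tau_moves(1)[OF y, of q j] by simp_all
next
  fix z assume "z \<in> {z. inv_covers y z \<and> y \<langle>$\<rangle> q < z \<langle>$\<rangle> q}"
  then have z: "inv_covers y z" "y \<langle>$\<rangle> q < z \<langle>$\<rangle> q" by auto
  obtain p c where mv: "moves y z p c" using inv_covers_moves[OF z(1)] by blast
  then have "q = p \<or> q = y \<langle>$\<rangle> p" "p \<le> y \<langle>$\<rangle> p" using z(2) by (auto simp: moves_def)
  then have "q = y \<langle>$\<rangle> p" using q y by auto
  then show "z \<in> Phi_plus y q"
    using moves_tau(1)[OF z(1) mv] z(1) inv_coversD(2)[OF z(1)] by (simp add: Phi_plus_def)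
qed

lemma Phi_minus_eq:
  assumes y: "y \<in> involutions" and p: "p \<le> y \<langle>$\<rangle> p"
  shows "Phi_minus y p = {z. inv_covers y z \<and> z \<langle>$\<rangle> p < y \<langle>$\<rangle> p}"
proof (intro equalityI subsetI CollectI conjI)
  fix z assume "z \<in> Phi_minus y p"
  then obtain i where z: "inv_covers y z" "z = tau i p y" by (auto simp: Phi_minus_def)
  moreover from this have "z \<noteq> y" using inv_coversD(3) bruhat_less_irrefl by blast
  ultimately show "inv_covers y z" "z \<langle>$\<rangle> p < y \<langle>$\<rangle> p"
    using tau_moves(2)[OF y, of i p] by simp_all
next
  fix z assume "z \<in> {z. inv_covers y z \<and> z \<langle>$\<rangle> p < y \<langle>$\<rangle> p}"
  then have z: "inv_covers y z" "z \<langle>$\<rangle> p < y \<langle>$\<rangle> p" by auto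
  obtain a c where mv: "moves y z a c" using inv_covers_moves[OF z(1)] by blast
  then have "p = c \<or> p = y \<langle>$\<rangle> c" "c \<le> y \<langle>$\<rangle> c" using z(2) by (auto simp: moves_def)
  then have "p = c" using p y by auto
  then show "z \<in> Phi_minus y p"
    using moves_tau(2)[OF z(1) mv] z(1) inv_coversD(2)[OF z(1)] by (simp add: Phi_minus_def)
qed

theorem proposition3p33:
  fixes y :: "int perm" and p q :: int
  assumes "y \<in> involutions" and "(p, q) \<in> Cyc y"
  shows "(\<Sum>z\<in>Phi_minus y p. card (involution_words z)) =
         (\<Sum>z\<in>Phi_plus y q. card (involution_words z))"
proof -
  have pq: "p \<le> q" "y \<langle>$\<rangle> p = q" "y \<langle>$\<rangle> q = p" using assms by (auto simp: Cyc_def)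
  let ?C = "moving_covers y q"
  have fin: "finite ?C" and sum0: "(\<Sum>z\<in>?C. shift_sgn y z q * num_words z) = 0"
    using sum_moving_covers[OF assms(1)] by auto
  have plus: "Phi_plus y q = {z. inv_covers y z \<and> y \<langle>$\<rangle> q < z \<langle>$\<rangle> q}"
    by (rule Phi_plus_eq) (use assms pq in auto)
  have sg: "shift_sgn y z q = shift_sgn y z p" if "inv_covers y z" for z
    using inv_covers_moves[OF that] moves_sgn[OF assms(1), of z _ _ p] pq by auto
  have "z \<langle>$\<rangle> p < y \<langle>$\<rangle> p \<longleftrightarrow> z \<langle>$\<rangle> q < y \<langle>$\<rangle> q" if "inv_covers y z" for z
    using sg[OF that] by (auto simp: sgn_if split: if_splits)
  moreover have "Phi_minus y p = {z. inv_covers y z \<and> z \<langle>$\<rangle> p < y \<langle>$\<rangle> p}"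
    by (rule Phi_minus_eq) (use assms pq in auto)
  ultimately have minus: "Phi_minus y p = {z. inv_covers y z \<and> z \<langle>$\<rangle> q < y \<langle>$\<rangle> q}" by blast
  have C: "?C = Phi_plus y q \<union> Phi_minus y p" "Phi_plus y q \<inter> Phi_minus y p = {}"
    unfolding plus minus moving_covers_def by auto
  have "0 = (\<Sum>z\<in>Phi_plus y q. shift_sgn y z q * num_words z) +
      (\<Sum>z\<in>Phi_minus y p. shift_sgn y z q * num_words z)"
    using sum0 fin unfolding C(1) by (simp add: sum.union_disjoint C(2))
  also have "(\<Sum>z\<in>Phi_plus y q. shift_sgn y z q * num_words z) = (\<Sum>z\<in>Phi_plus y q. num_words z)"
    by (intro sum.cong refl) (simp add: plus)
  also have "(\<Sum>z\<in>Phi_minus y p. shift_sgn y z q * num_words z) = - (\<Sum>z\<in>Phi_minus y p. num_words z)"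
    unfolding sum_negf[symmetric] by (intro sum.cong refl) (simp add: minus)
  finally have "int (\<Sum>z\<in>Phi_minus y p. card (involution_words z)) =
      int (\<Sum>z\<in>Phi_plus y q. card (involution_words z))" by simp
  then show ?thesis by (simp only: of_nat_eq_iff)
qed

end
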